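(* Let $q\in\mathbf{b}(H^\infty)$ be a rational outer function that is non-extreme, and let $r>0$. Let $a$ be the Pythagorean mate for $q$ and $a_r$ the Pythagorean mate for $q^r$. Then the co-analytic Toeplitz operators $T_{\overline{a}}$ and $T_{\overline{a_r}}$ on $H^2$ have the same range, namely $\mathscr{H}(q)$; that is, $T_{\overline{a}}H^2=T_{\overline{a_r}}H^2=\mathscr{H}(q)$ as sets.
   Context: $\mathbb{D}$ is the open unit disk, $\mathbb{T}$ the unit circle with normalized Lebesgue measure $m$. $H^2$ is the classical Hardy space. $H^\infty$ is the space of bounded analytic functions on $\mathbb{D}$ with the supremum norm, and $\mathbf{b}(H^\infty)=\{g\in H^\infty:\|g\|_\infty\le 1\}$. For $\varphi\in L^\infty(\mathbb{T})$, the Toeplitz operator on $H^2$ is $T_\varphi f=P_+(\varphi f)$, where $P_+$ is the orthogonal projection of $L^2(\mathbb{T})$ onto $H^2$. For $b\in\mathbf{b}(H^\infty)$, the de Branges-Rovnyak space $\mathscr{H}(b)$ is the reproducing kernel Hilbert space of analytic functions on $\mathbb{D}$ with kernel $k^b_\lambda(z)=\frac{1-\overline{b(\lambda)}b(z)}{1-\overline{\lambda}z}$, $\lambda,z\in\mathbb{D}$. An outer $q$ has no zeros in $\mathbb{D}$, so $q^r\in\mathbf{b}(H^\infty)$ is defined using any analytic logarithm of $q$. A function $b\in\mathbf{b}(H^\infty)$ is non-extreme if $\log(1-|b|)\in L^1(\mathbb{T},m)$; then its Pythagorean mate is the unique outer function $a\in\mathbf{b}(H^\infty)$ with $a(0)>0$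 and $|a|^2+|b|^2=1$ almost everywhere on $\mathbb{T}$. If $q$ is outer and non-extreme, then so is $q^r$. *)

theory Defs
  imports "HOL-Complex_Analysis.Complex_Analysis"
begin

abbreviation disc :: "complex set" where
  "disc \<equiv> ball 0 1"

text \<open>Normalized Lebesgue measure on the unit circle.\<close>

definition circle_measure :: "complex measure" where
  "circle_measure =
     distr (uniform_measure lborel {0..2 * pi}) (restrict_space borel (sphere 0 1)) cis"

text \<open>Analytic functions on the disc are represented by total functions that are \<open>0\<close> off the
  disc, so that equality of such functions (and of sets of them) is equality on the disc.\<close>

definition analytic_disc :: "(complex \<Rightarrow> complex) set" where
  "analytic_disc = {f. f holomorphic_on disc \<and> (\<forall>z. z \<notin> disc \<longrightarrow> f z = 0)}"

definition b_Hinf :: "(complex \<Rightarrow> complex) set" where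
  "b_Hinf = {g \<in> analytic_disc. \<forall>z\<in>disc. cmod (g z) \<le> 1}"

definition H2 :: "(complex \<Rightarrow> complex) set" where
  "H2 = {f \<in> analytic_disc.
     bdd_above ((\<lambda>r::real. \<integral>\<zeta>. (cmod (f (of_real r * \<zeta>)))\<^sup>2 \<partial>circle_measure) ` {0..<1})}"

text \<open>Radial boundary values; they exist almost everywhere for functions in \<open>H2\<close>.\<close>

definition bdry :: "(complex \<Rightarrow> complex) \<Rightarrow> complex \<Rightarrow> complex" where
  "bdry f \<zeta> = Lim (at_left (1::real)) (\<lambda>r. f (of_real r * \<zeta>))"

text \<open>For \<open>g\<close> in \<open>L\<^sup>2\<close> of the circle, \<open>P_plus g\<close> is the orthogonal projection of \<open>g\<close> onto \<open>H2\<close>,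
  where \<open>H2\<close> is embedded into \<open>L\<^sup>2\<close> by boundary values; the projection is returned as a function
  on the disc. It is unspecified for \<open>g\<close> outside \<open>L\<^sup>2\<close>.\<close>

definition P_plus :: "(complex \<Rightarrow> complex) \<Rightarrow> complex \<Rightarrow> complex" where
  "P_plus g = (THE h. h \<in> H2 \<and>
     (\<forall>k\<in>H2. (\<integral>\<zeta>. (g \<zeta> - bdry h \<zeta>) * cnj (bdry k \<zeta>) \<partial>circle_measure) = 0))"

definition toeplitz :: "(complex \<Rightarrow> complex) \<Rightarrow> (complex \<Rightarrow> complex) \<Rightarrow> complex \<Rightarrow> complex" where
  "toeplitz \<phi> f = P_plus (\<lambda>\<zeta>. \<phi> \<zeta> * bdry f \<zeta>)"

text \<open>The density \<open>u\<close> is \<open>log \<bar>f\<bar>\<close> almost everywhere on the circle.\<close>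

definition outer :: "(complex \<Rightarrow> complex) \<Rightarrow> bool" where
  "outer f \<longleftrightarrow> (\<exists>c (u :: complex \<Rightarrow> real). cmod c = 1 \<and> integrable circle_measure u \<and>
     (\<forall>z\<in>disc. f z =
        c * exp (\<integral>\<zeta>. (\<zeta> + z) / (\<zeta> - z) * of_real (u \<zeta>) \<partial>circle_measure)))"

definition rational_on_disc :: "(complex \<Rightarrow> complex) \<Rightarrow> bool" where
  "rational_on_disc f \<longleftrightarrow>
     (\<exists>p d :: complex poly. \<forall>z\<in>disc. poly d z \<noteq> 0 \<and> f z = poly p z / poly d z)"

text \<open>Since \<open>ln 0 = 0\<close> in the library, \<open>\<bar>b\<bar> < 1\<close> almost everywhere, which is implicit in
  \<open>log (1 - \<bar>b\<bar>) \<in> L\<^sup>1\<close>, has to be demanded explicitly.\<close>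

definition non_extreme :: "(complex \<Rightarrow> complex) \<Rightarrow> bool" where
  "non_extreme b \<longleftrightarrow> (AE \<zeta> in circle_measure. cmod (bdry b \<zeta>) < 1) \<and>
     integrable circle_measure (\<lambda>\<zeta>. ln (1 - cmod (bdry b \<zeta>)))"

definition pythagorean_mate :: "(complex \<Rightarrow> complex) \<Rightarrow> (complex \<Rightarrow> complex) \<Rightarrow> bool" where
  "pythagorean_mate b a \<longleftrightarrow> a \<in> b_Hinf \<and> outer a \<and> a 0 \<in> \<real> \<and> Re (a 0) > 0 \<and>
     (AE \<zeta> in circle_measure. (cmod (bdry a \<zeta>))\<^sup>2 + (cmod (bdry b \<zeta>))\<^sup>2 = 1)"

definition analytic_log :: "(complex \<Rightarrow> complex) \<Rightarrow> (complex \<Rightarrow> complex) \<Rightarrow> bool" where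
  "analytic_log q L \<longleftrightarrow> L holomorphic_on disc \<and> (\<forall>z\<in>disc. exp (L z) = q z)"

text \<open>The power \<open>q\<^sup>r\<close> determined by an analytic logarithm \<open>L\<close> of \<open>q\<close>.\<close>

definition disc_power :: "(complex \<Rightarrow> complex) \<Rightarrow> real \<Rightarrow> complex \<Rightarrow> complex" where
  "disc_power L r z = (if z \<in> disc then exp (of_real r * L z) else 0)"

text \<open>\<open>V\<close> with inner product \<open>ip\<close> (linear in the first argument) is a reproducing kernel Hilbert
  space of functions on \<open>X\<close> (extended by \<open>0\<close>) whose kernel at the point \<open>w\<close> is the function
  \<open>K w\<close>.\<close>

definition is_rkhs :: "'a set \<Rightarrow> ('a \<Rightarrow> 'a \<Rightarrow> complex) \<Rightarrow> ('a \<Rightarrow> complex) set \<Rightarrow>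
    (('a \<Rightarrow> complex) \<Rightarrow> ('a \<Rightarrow> complex) \<Rightarrow> complex) \<Rightarrow> bool" where
  "is_rkhs X K V ip \<longleftrightarrow>
     \<comment> \<open>linear space of functions on \<open>X\<close>\<close>
     (\<forall>f\<in>V. \<forall>z. z \<notin> X \<longrightarrow> f z = 0) \<and>
     (\<lambda>z. 0) \<in> V \<and>
     (\<forall>f\<in>V. \<forall>g\<in>V. (\<lambda>z. f z + g z) \<in> V) \<and>
     (\<forall>c. \<forall>f\<in>V. (\<lambda>z. c * f z) \<in> V) \<and>
     \<comment> \<open>inner product\<close>
     (\<forall>f\<in>V. \<forall>g\<in>V. \<forall>h\<in>V. ip (\<lambda>z. f z + g z) h = ip f h + ip g h) \<and>
     (\<forall>c. \<forall>f\<in>V. \<forall>g\<in>V. ip (\<lambda>z. c * f z) g = c * ip f g) \<and>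
     (\<forall>f\<in>V. \<forall>g\<in>V. ip g f = cnj (ip f g)) \<and>
     (\<forall>f\<in>V. Re (ip f f) \<ge> 0 \<and> (ip f f = 0 \<longrightarrow> f = (\<lambda>z. 0))) \<and>
     \<comment> \<open>completeness\<close>
     (\<forall>s :: nat \<Rightarrow> 'a \<Rightarrow> complex. (\<forall>n. s n \<in> V) \<and>
        (\<forall>e>0. \<exists>N. \<forall>m\<ge>N. \<forall>n\<ge>N.
           sqrt (Re (ip (\<lambda>z. s m z - s n z) (\<lambda>z. s m z - s n z))) < e) \<longrightarrow>
        (\<exists>f\<in>V. (\<lambda>n. sqrt (Re (ip (\<lambda>z. s n z - f z) (\<lambda>z. s n z - f z)))) \<longlonglongrightarrow> 0)) \<and>
     \<comment> \<open>reproducing property\<close>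
     (\<forall>w\<in>X. (\<lambda>z. if z \<in> X then K w z else 0) \<in> V \<and>
        (\<forall>f\<in>V. ip f (\<lambda>z. if z \<in> X then K w z else 0) = f w))"

definition dBR_kernel :: "(complex \<Rightarrow> complex) \<Rightarrow> complex \<Rightarrow> complex \<Rightarrow> complex" where
  "dBR_kernel b w z = (1 - cnj (b w) * b z) / (1 - cnj w * z)"

text \<open>The underlying set of the de Branges-Rovnyak space; a reproducing kernel Hilbert space is
  determined by its kernel.\<close>

definition dBR_space :: "(complex \<Rightarrow> complex) \<Rightarrow> (complex \<Rightarrow> complex) set" where
  "dBR_space b =
     (THE V. V \<subseteq> analytic_disc \<and> (\<exists>ip. is_rkhs disc (dBR_kernel b) V ip))"

end

theory Submission
  imports Defs
    "HOL-Computational_Algebra.Fundamental_Theorem_Algebra"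
begin

text \<open>
  Fatou's theorem for \<open>H2\<close> rests on a weak type maximal inequality, which comes from the
  \<open>T T\<^sup>*\<close> trick: Poisson kernels satisfy \<open>P\<^sub>r * P\<^sub>s = P\<^sub>r\<^sub>s \<le> 8 (P\<^sub>r + P\<^sub>s)\<close>.

  Let \<open>a\<close> be outer and \<open>f\<close> bounded analytic. If \<open>\<bar>f\<bar> \<le> C \<bar>a\<bar>\<close> almost everywhere on the circle, then \<open>f = G a\<close>
  for a bounded analytic \<open>G\<close>, so the range of the co-analytic Toeplitz operator of \<open>f\<close> lies in that of \<open>a\<close>.
  As \<open>1 - x\<^sup>r\<close> is comparable to \<open>1 - x\<close> on \<open>[0, 1]\<close>, this gives the equality of the two ranges.

  The space of \<open>q\<close> consists of those \<open>f\<close> in \<open>H2\<close> for which the co-analytic Toeplitz operator of \<open>q\<close> maps \<open>f\<close> into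
  the range of that of \<open>a\<close>; it equals this range as soon as \<open>a g\<^sub>1 + q g\<^sub>2 = 1\<close> has a bounded analytic
  solution. For \<open>q = p / d\<close> in lowest terms let \<open>W\<close> be the polynomial \<open>z\<^sup>N (\<bar>d\<bar>\<^sup>2 - \<bar>p\<bar>\<^sup>2)\<close> on the circle. It has no
  zero in common with \<open>p\<close>, and \<open>\<bar>W\<bar> = \<bar>d\<bar>\<^sup>2 \<bar>a\<bar>\<^sup>2\<close> on the circle makes it a bounded multiple of \<open>a\<close>, so a Bezout identity
  for \<open>W\<close> and \<open>p\<close> solves the corona equation without any factorization of \<open>a\<close>.
\<close>

text \<open>\<open>P_plus\<close> and \<open>dBR_space\<close> are definite descriptions and
  \<open>bdry\<close> is a \<open>Lim\<close>, so none of them says anything until existence and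
  uniqueness are settled: radial limits almost everywhere, the projection, and the fact that a
  kernel determines its Hilbert space as a set. This accounts for most of the length. Fatou's
  theorem is proved in L^2 only, yet the modulus of an outer function on the circle is governed by a
  density that is merely in L^1. Its Poisson integrals are shown to converge in L^1, hence almost
  everywhere along a subsequence of radii; as the radial limit already exists, the subsequence
  identifies it. Dividing by an outer function \<open>a\<close> is delicate because its inverse need
  not be bounded. The density of \<open>a\<close> is therefore cut off from below; the truncated
  outer functions have bounded inverses and decrease in modulus to \<open>a\<close>. The same
  truncation shows that the adjoint of multiplication by \<open>a\<close> is injective, which makes
  the companion function \<open>plus f\<close> unique.\<close>

section \<open>The normalized measure on the circle and the moments of its monomials\<close>

abbreviation circ :: "complex measure" where
  "circ \<equiv> circle_measure"

lemma space_circ [simp]: "space circ = sphere 0 1"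
  by (simp add: circle_measure_def space_restrict_space)

lemma sets_circ [measurable_cong]: "sets circ = sets (restrict_space borel (sphere 0 1))"
  by (simp add: circle_measure_def)

lemma cis_measurable_circ:
  "cis \<in> uniform_measure lborel {0..2 * pi} \<rightarrow>\<^sub>M restrict_space borel (sphere 0 1)"
proof (rule measurable_restrict_space2)
  have "cis \<in> borel_measurable borel"
    by (auto intro!: borel_measurable_continuous_onI continuous_intros)
  thus "cis \<in> borel_measurable (uniform_measure lborel {0..2 * pi})"
    by (simp add: measurable_def)
qed auto

lemma emeasure_space_circ: "emeasure circ (sphere 0 1) = 1"
proof -
  have "cis -` sphere 0 1 = UNIV" by auto
  moreover have "sphere 0 1 \<in> sets (restrict_space borel (sphere (0::complex) 1))"
    using sets.top[of circ] sets_circ by simp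
  ultimately show ?thesis
    unfolding circle_measure_def
    by (subst emeasure_distr[OF cis_measurable_circ]) (simp_all add: ennreal_mult_divide_eq)
qed

interpretation circ: finite_measure circ
  by standard (simp add: emeasure_space_circ)

lemma measure_space_circ [simp]: "measure circ (sphere 0 1) = 1"
  by (simp add: measure_def emeasure_space_circ)

lemma borel_measurable_circ_continuous:
  assumes "continuous_on (sphere 0 1) g"
  shows "g \<in> borel_measurable circ"
  by (subst measurable_cong_sets[OF sets_circ refl])
    (rule borel_measurable_continuous_on_restrict[OF assms])

lemma norm_circ: "\<zeta> \<in> space circ \<Longrightarrow> cmod \<zeta> = 1"
  by simp

lemma cnj_circ: "cmod \<zeta> = 1 \<Longrightarrow> \<zeta> * cnj \<zeta> = 1"
  by (simp add: complex_norm_square[symmetric])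

lemma AE_circI: "(\<And>\<zeta>. cmod \<zeta> = 1 \<Longrightarrow> P \<zeta>) \<Longrightarrow> AE \<zeta> in circ. P \<zeta>"
  by (rule AE_I2) auto

lemma integrable_circ_bounded:
  fixes g :: "complex \<Rightarrow> 'b::{banach, second_countable_topology}"
  assumes "g \<in> borel_measurable circ" "AE \<zeta> in circ. norm (g \<zeta>) \<le> B"
  shows "integrable circ g"
  by (rule circ.integrable_const_bound[OF assms(2,1)])

lemma integrable_circ_continuous:
  fixes g :: "complex \<Rightarrow> 'b::euclidean_space"
  assumes "continuous_on (sphere 0 1) g"
  shows "integrable circ g"
proof -
  have "compact (g ` sphere 0 1)"
    using assms by (intro compact_continuous_image) auto
  then obtain B where "\<forall>x\<in>g ` sphere 0 1. norm x \<le> B"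
    using compact_imp_bounded bounded_iff by meson
  thus ?thesis
    by (intro integrable_circ_bounded[of _ B] borel_measurable_circ_continuous assms AE_circI) auto
qed

lemma integral_circ_cis:
  fixes g :: "complex \<Rightarrow> 'b::euclidean_space"
  assumes "continuous_on (sphere 0 1) g"
  shows "(\<integral>\<zeta>. g \<zeta> \<partial>circ) = (1 / (2 * pi)) *\<^sub>R (\<integral>t. indicator {0..2*pi} t *\<^sub>R g (cis t) \<partial>lborel)"
proof -
  have gm: "g \<in> borel_measurable (restrict_space borel (sphere 0 1))"
    by (rule borel_measurable_continuous_on_restrict[OF assms])
  have cont: "continuous_on UNIV (\<lambda>t. g (cis t))"
    by (rule continuous_on_compose2[OF assms]) (auto intro!: continuous_intros)
  have "(\<integral>\<zeta>. g \<zeta> \<partial>circ) = (\<integral>t. g (cis t) \<partial>uniform_measure lborel {0..2 * pi})"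
    unfolding circle_measure_def by (rule integral_distr[OF cis_measurable_circ gm])
  also have "\<dots> = (\<integral>t. (indicator {0..2*pi} t / (2*pi)) *\<^sub>R g (cis t) \<partial>lborel)"
  proof -
    have "uniform_measure lborel {0..2 * pi}
        = density lborel (\<lambda>t. ennreal (indicator {0..2*pi} t / (2*pi)))"
      unfolding uniform_measure_def
      by (intro density_cong) (auto simp: indicator_def divide_ennreal[symmetric] intro!: divide_ennreal)
    thus ?thesis
      using borel_measurable_continuous_onI[OF cont] by (subst integral_density[symmetric]) auto
  qed
  also have "\<dots> = (\<integral>t. (1 / (2 * pi)) *\<^sub>R (indicator {0..2*pi} t *\<^sub>R g (cis t)) \<partial>lborel)"
    by (intro Bochner_Integration.integral_cong) (auto simp: field_simps)
  also have "\<dots> = (1 / (2 * pi)) *\<^sub>R (\<integral>t. indicator {0..2*pi} t *\<^sub>R g (cis t) \<partial>lborel)"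
    by (rule integral_scaleR_right)
  finally show ?thesis .
qed

lemma integral_circ_power: "(\<integral>\<zeta>. \<zeta> ^ n \<partial>circ) = (if n = 0 then 1 else 0)"
proof (cases "n = 0")
  case False
  have "(\<integral>t. indicator {0..2*pi} t *\<^sub>R (cis t ^ n) \<partial>lborel)
      = (cis (real n * (2*pi)) / (\<i> * n)) - cis (real n * 0) / (\<i> * n)"
  proof (rule integral_FTC_atLeastAtMost)
    fix t :: real
    show "((\<lambda>t. cis (real n * t) / (\<i> * n)) has_vector_derivative cis t ^ n) (at t within {0..2*pi})"
    proof -
      have "((\<lambda>z. exp (\<i> * (of_nat n * z)) / (\<i> * n)) has_field_derivative exp (\<i> * (of_nat n * of_real t)))
        (at (of_real t))"
        using False by (auto intro!: derivative_eq_intros simp: algebra_simps)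
      from has_vector_derivative_real_field[OF this]
      show ?thesis by (simp add: cis_conv_exp exp_of_nat_mult[symmetric] mult.left_commute)
    qed
  qed (auto intro!: continuous_intros)
  also have "\<dots> = 0"
    using cis_2pi by (simp add: mult.commute[of "real n"] cis_multiple_2pi)
  finally show ?thesis
    using False by (subst integral_circ_cis) (auto intro!: continuous_intros)
qed simp

lemma integral_circ_power_cnj:
  "(\<integral>\<zeta>. \<zeta> ^ n * cnj \<zeta> ^ m \<partial>circ) = (if n = m then 1 else 0)"
proof -
  have *: "(\<integral>\<zeta>. \<zeta> ^ n * cnj \<zeta> ^ m \<partial>circ) = (\<integral>\<zeta>. \<zeta> ^ (n - m) \<partial>circ)" if "m \<le> n" for n m
  proof (rule Bochner_Integration.integral_cong[OF refl])
    fix \<zeta> assume "\<zeta> \<in> space circ"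
    hence "\<zeta> * cnj \<zeta> = 1" using cnj_circ norm_circ by blast
    hence "\<zeta> ^ m * cnj \<zeta> ^ m = 1" by (metis power_mult_distrib power_one)
    thus "\<zeta> ^ n * cnj \<zeta> ^ m = \<zeta> ^ (n - m)"
      using that by (metis le_add_diff_inverse2 mult.assoc mult.right_neutral power_add)
  qed
  show ?thesis
  proof (cases "m \<le> n")
    case True
    thus ?thesis using *[OF True] integral_circ_power[of "n - m"] by auto
  next
    case False
    have "(\<integral>\<zeta>. \<zeta> ^ n * cnj \<zeta> ^ m \<partial>circ) = cnj (\<integral>\<zeta>. \<zeta> ^ m * cnj \<zeta> ^ n \<partial>circ)"
      using Bochner_Integration.integral_cnj[of circ "\<lambda>\<zeta>. \<zeta> ^ m * cnj \<zeta> ^ n"] by (simp add: mult.commute)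
    thus ?thesis using *[of n m] False integral_circ_power[of "m - n"] by simp
  qed
qed

subsection \<open>Square integrable functions on the circle\<close>

definition L2 :: "(complex \<Rightarrow> complex) set" where
  "L2 = {g \<in> borel_measurable circ. integrable circ (\<lambda>\<zeta>. (cmod (g \<zeta>))\<^sup>2)}"

definition L2norm :: "(complex \<Rightarrow> complex) \<Rightarrow> real" where
  "L2norm g = sqrt (\<integral>\<zeta>. (cmod (g \<zeta>))\<^sup>2 \<partial>circ)"

lemma L2_measurable: "g \<in> L2 \<Longrightarrow> g \<in> borel_measurable circ"
  and L2_integrable_sq: "g \<in> L2 \<Longrightarrow> integrable circ (\<lambda>\<zeta>. (cmod (g \<zeta>))\<^sup>2)"
  by (auto simp: L2_def)

lemma L2norm_nonneg [simp]: "L2norm g \<ge> 0"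
  by (simp add: L2norm_def)

lemma L2norm_sq: "(L2norm g)\<^sup>2 = (\<integral>\<zeta>. (cmod (g \<zeta>))\<^sup>2 \<partial>circ)"
  by (simp add: L2norm_def)

lemma L2_product_integrable:
  assumes "g \<in> L2" "h \<in> L2"
  shows "integrable circ (\<lambda>\<zeta>. cmod (g \<zeta>) * cmod (h \<zeta>))"
    "integrable circ (\<lambda>\<zeta>. g \<zeta> * h \<zeta>)" "integrable circ (\<lambda>\<zeta>. g \<zeta> * cnj (h \<zeta>))"
proof -
  note [measurable] = assms[THEN L2_measurable]
  have i: "integrable circ (\<lambda>\<zeta>. (cmod (g \<zeta>))\<^sup>2 + (cmod (h \<zeta>))\<^sup>2)"
    using assms by (auto simp: L2_def)
  have b: "x * y \<le> x\<^sup>2 + y\<^sup>2" if "x \<ge> 0" "y \<ge> 0" for x y :: real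
    using that sum_squares_bound[of x y] mult_nonneg_nonneg[OF that] by linarith
  have cm: "(\<lambda>\<zeta>. cnj (h \<zeta>)) \<in> borel_measurable circ"
    by (rule measurable_compose[OF L2_measurable[OF assms(2)]])
      (auto intro!: borel_measurable_continuous_onI continuous_intros)
  show "integrable circ (\<lambda>\<zeta>. cmod (g \<zeta>) * cmod (h \<zeta>))"
    by (rule Bochner_Integration.integrable_bound[OF i]) (auto intro!: AE_I2 b)
  show "integrable circ (\<lambda>\<zeta>. g \<zeta> * h \<zeta>)"
    by (rule Bochner_Integration.integrable_bound[OF i]) (auto intro!: AE_I2 b simp: norm_mult)
  show "integrable circ (\<lambda>\<zeta>. g \<zeta> * cnj (h \<zeta>))"
    using cm by (intro Bochner_Integration.integrable_bound[OF i]) (auto intro!: AE_I2 b simp: norm_mult)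
qed

lemma L2_mult_bounded:
  assumes "g \<in> L2" "\<phi> \<in> borel_measurable circ" "AE \<zeta> in circ. cmod (\<phi> \<zeta>) \<le> B"
  shows "(\<lambda>\<zeta>. \<phi> \<zeta> * g \<zeta>) \<in> L2"
proof -
  note [measurable] = L2_measurable[OF assms(1)] assms(2)
  have i: "integrable circ (\<lambda>\<zeta>. B\<^sup>2 * (cmod (g \<zeta>))\<^sup>2)"
    using assms by (auto simp: L2_def)
  have "AE \<zeta> in circ. norm ((cmod (\<phi> \<zeta> * g \<zeta>))\<^sup>2) \<le> norm (B\<^sup>2 * (cmod (g \<zeta>))\<^sup>2)"
    using assms(3) by eventually_elim (auto simp: norm_mult power_mult_distrib intro!: mult_right_mono power_mono)
  thus ?thesis
    unfolding L2_def by (auto intro!: Bochner_Integration.integrable_bound[OF i])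
qed

lemma L2_cnj: "g \<in> L2 \<Longrightarrow> (\<lambda>\<zeta>. cnj (g \<zeta>)) \<in> L2"
proof -
  assume g: "g \<in> L2"
  have "(\<lambda>\<zeta>. cnj (g \<zeta>)) \<in> borel_measurable circ"
    by (rule measurable_compose[OF L2_measurable[OF g]])
      (auto intro!: borel_measurable_continuous_onI continuous_intros)
  thus ?thesis using g by (auto simp: L2_def)
qed

lemma L2_continuous: "continuous_on (sphere 0 1) g \<Longrightarrow> g \<in> L2"
  unfolding L2_def
  by (auto intro!: borel_measurable_circ_continuous integrable_circ_continuous continuous_intros)

lemma L2_Cauchy_Schwarz:
  assumes "g \<in> L2" "h \<in> L2"
  shows "(\<integral>\<zeta>. cmod (g \<zeta>) * cmod (h \<zeta>) \<partial>circ) \<le> L2norm g * L2norm h"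
proof -
  define I where "I = (\<integral>\<zeta>. cmod (g \<zeta>) * cmod (h \<zeta>) \<partial>circ)"
  define A where "A = L2norm g"
  define B where "B = L2norm h"
  have A: "A \<ge> 0" "A\<^sup>2 = (\<integral>\<zeta>. (cmod (g \<zeta>))\<^sup>2 \<partial>circ)"
   and B: "B \<ge> 0" "B\<^sup>2 = (\<integral>\<zeta>. (cmod (h \<zeta>))\<^sup>2 \<partial>circ)"
    by (simp_all add: A_def B_def L2norm_sq)
  \<comment> \<open>AM-GM with a free weight \<open>s\<close>. The choice \<open>B / A\<close>
    balances the two terms; if one of the norms is 0, a very large or very small \<open>s\<close>
    makes the remaining term at most \<epsilon>.\<close>
  have key: "2 * I \<le> s * A\<^sup>2 + B\<^sup>2 / s" if "s > 0" for s
  proof -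
    have "2 * I = (\<integral>\<zeta>. 2 * (cmod (g \<zeta>) * cmod (h \<zeta>)) \<partial>circ)" by (simp add: I_def)
    also have "\<dots> \<le> (\<integral>\<zeta>. s * (cmod (g \<zeta>))\<^sup>2 + (cmod (h \<zeta>))\<^sup>2 / s \<partial>circ)"
    proof (rule integral_mono)
      fix \<zeta>
      have "0 \<le> (s * cmod (g \<zeta>) - cmod (h \<zeta>))\<^sup>2 / s" using that by simp
      also have "\<dots> = s * (cmod (g \<zeta>))\<^sup>2 + (cmod (h \<zeta>))\<^sup>2 / s - 2 * (cmod (g \<zeta>) * cmod (h \<zeta>))"
        using that by (simp add: power2_eq_square field_simps)
      finally show "2 * (cmod (g \<zeta>) * cmod (h \<zeta>)) \<le> s * (cmod (g \<zeta>))\<^sup>2 + (cmod (h \<zeta>))\<^sup>2 / s" by simp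
    qed (use assms in \<open>auto intro!: L2_product_integrable simp: L2_integrable_sq\<close>)
    also have "\<dots> = s * A\<^sup>2 + B\<^sup>2 / s"
      using assms by (simp add: A B L2_integrable_sq)
    finally show ?thesis .
  qed
  have "I \<le> A * B + \<epsilon> / 2" if "\<epsilon> > 0" for \<epsilon>
  proof (cases "A = 0 \<or> B = 0")
    case False
    hence "A > 0" "B > 0" using A(1) B(1) by auto
    with key[of "B / A"] that show ?thesis by (simp add: power2_eq_square)
  next
    case True
    thus ?thesis
    proof
      assume a: "A = 0"
      define s where "s = (B\<^sup>2 + 1) / \<epsilon>"
      have s: "s > 0" using that by (simp add: s_def add_nonneg_pos)
      have "\<epsilon> * B\<^sup>2 / (B\<^sup>2 + 1) \<le> \<epsilon>" 
        using that by (subst pos_divide_le_eq) (auto simp: add_pos_nonneg algebra_simps)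
      hence "B\<^sup>2 / s \<le> \<epsilon>" by (simp add: s_def mult.commute)
      with key[OF s] a show ?thesis by simp
    next
      assume b: "B = 0"
      define s where "s = \<epsilon> / (A\<^sup>2 + 1)"
      have s: "s > 0" using that by (simp add: s_def add_nonneg_pos)
      have "\<epsilon> * A\<^sup>2 / (A\<^sup>2 + 1) \<le> \<epsilon>"
        using that by (subst pos_divide_le_eq) (auto simp: add_pos_nonneg algebra_simps)
      hence "s * A\<^sup>2 \<le> \<epsilon>" by (simp add: s_def)
      with key[OF s] b show ?thesis by simp
    qed
  qed
  note eps = this
  have "I \<le> A * B"
  proof (rule field_le_epsilon)
    fix e :: real assume "e > 0"
    thus "I \<le> A * B + e" using eps[of e] by linarith
  qed
  thus ?thesis by (simp add: I_def A_def B_def)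
qed

lemma L2_Cauchy_Schwarz_norm:
  assumes "g \<in> L2" "h \<in> L2"
  shows "cmod (\<integral>\<zeta>. g \<zeta> * h \<zeta> \<partial>circ) \<le> L2norm g * L2norm h"
proof -
  have "cmod (\<integral>\<zeta>. g \<zeta> * h \<zeta> \<partial>circ) \<le> (\<integral>\<zeta>. cmod (g \<zeta> * h \<zeta>) \<partial>circ)" by (rule integral_norm_bound)
  also have "\<dots> \<le> L2norm g * L2norm h" using L2_Cauchy_Schwarz[OF assms] by (simp add: norm_mult)
  finally show ?thesis .
qed

lemma L2norm_cnj [simp]: "L2norm (\<lambda>\<zeta>. cnj (g \<zeta>)) = L2norm g"
  by (simp add: L2norm_def)

subsection \<open>Absolutely convergent power series on the circle\<close>

lemma summable_powser_cball:
  fixes c :: "nat \<Rightarrow> complex"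
  assumes "summable (\<lambda>n. cmod (c n))" "cmod z \<le> 1"
  shows "summable (\<lambda>n. cmod (c n * z ^ n))" "summable (\<lambda>n. c n * z ^ n)"
proof -
  have "cmod (c n * z ^ n) \<le> cmod (c n)" for n
    using assms(2) by (simp add: norm_mult norm_power mult_left_le power_le_one)
  thus "summable (\<lambda>n. cmod (c n * z ^ n))"
    by (intro summable_comparison_test'[OF assms(1), of 0]) auto
  thus "summable (\<lambda>n. c n * z ^ n)" by (rule summable_norm_cancel)
qed

lemma powser_continuous_cball:
  fixes c :: "nat \<Rightarrow> complex"
  assumes "summable (\<lambda>n. cmod (c n))"
  shows "continuous_on (cball 0 1) (\<lambda>z. \<Sum>n. c n * z ^ n)"
proof (rule uniform_limit_theorem)
  show "uniform_limit (cball 0 1) (\<lambda>N z. \<Sum>n<N. c n * z ^ n) (\<lambda>z. \<Sum>n. c n * z ^ n) sequentially"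
    by (rule Weierstrass_m_test[OF _ assms])
      (auto simp: norm_mult norm_power mult_left_le power_le_one)
qed (auto intro!: always_eventually continuous_intros)

text \<open>Serves both kinds of series that occur: \<open>f\<close> is the identity for Taylor
  series and \<open>cnj\<close> for the Herglotz kernel. Only integrability is asked of
  \<open>k\<close>, so that it may be the density of an outer function.\<close>

lemma integral_circ_series:
  fixes c :: "nat \<Rightarrow> complex"
  assumes "summable (\<lambda>n. cmod (c n))" "integrable circ k"
    and f: "f \<in> borel_measurable circ" "\<And>\<zeta>. cmod \<zeta> = 1 \<Longrightarrow> cmod (f \<zeta>) \<le> 1"
  shows "(\<lambda>n. c n * (\<integral>\<zeta>. f \<zeta> ^ n * k \<zeta> \<partial>circ)) sums (\<integral>\<zeta>. (\<Sum>n. c n * f \<zeta> ^ n) * k \<zeta> \<partial>circ)"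
proof -
  note [measurable] = f(1) borel_measurable_integrable[OF assms(2)]
  let ?f = "\<lambda>n \<zeta>. (c n * f \<zeta> ^ n) * k \<zeta>"
  have b: "norm (f \<zeta> ^ n * k \<zeta>) \<le> norm (k \<zeta>)" if "cmod \<zeta> = 1" for n \<zeta>
    using f(2)[OF that] by (simp add: norm_mult norm_power power_le_one mult_left_le_one_le)
  have ifk: "integrable circ (\<lambda>\<zeta>. f \<zeta> ^ n * k \<zeta>)" for n
    by (rule Bochner_Integration.integrable_bound[OF assms(2)]) (auto intro!: AE_circI b)
  have int: "integrable circ (?f n)" for n
    using integrable_mult_right[OF ifk, of "c n" n] by (simp add: mult.assoc)
  have "(\<lambda>n. integral\<^sup>L circ (?f n)) sums (\<integral>\<zeta>. (\<Sum>n. ?f n \<zeta>) \<partial>circ)"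
  proof (rule sums_integral[OF int])
    show "AE \<zeta> in circ. summable (\<lambda>n. norm (?f n \<zeta>))"
      by (rule AE_circI)
        (use summable_powser_cball(1)[OF assms(1) f(2)] in \<open>auto simp: norm_mult intro!: summable_mult2\<close>)
    show "summable (\<lambda>n. \<integral>\<zeta>. norm (?f n \<zeta>) \<partial>circ)"
    proof (rule summable_comparison_test'[OF summable_mult2[OF assms(1)]])
      fix n :: nat
      have "(\<integral>\<zeta>. norm (?f n \<zeta>) \<partial>circ) \<le> (\<integral>\<zeta>. cmod (c n) * norm (k \<zeta>) \<partial>circ)"
      proof (rule integral_mono)
        show "integrable circ (\<lambda>\<zeta>. norm (?f n \<zeta>))" using int by auto
        show "norm (?f n \<zeta>) \<le> cmod (c n) * norm (k \<zeta>)" if "\<zeta> \<in> space circ" for \<zeta>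
          using mult_left_mono[OF b[of \<zeta> n], of "cmod (c n)"] that
          by (simp add: norm_mult mult.assoc)
      qed (use assms(2) in auto)
      thus "norm (\<integral>\<zeta>. norm (?f n \<zeta>) \<partial>circ) \<le> cmod (c n) * (\<integral>\<zeta>. norm (k \<zeta>) \<partial>circ)"
        by (simp add: integral_nonneg_AE)
    qed
  qed
  also have "(\<integral>\<zeta>. (\<Sum>n. ?f n \<zeta>) \<partial>circ) = (\<integral>\<zeta>. (\<Sum>n. c n * f \<zeta> ^ n) * k \<zeta> \<partial>circ)"
  proof (rule Bochner_Integration.integral_cong[OF refl])
    fix \<zeta> assume "\<zeta> \<in> space circ"
    hence "cmod (f \<zeta>) \<le> 1" using f(2) by simp
    from suminf_mult2[OF summable_powser_cball(2)[OF assms(1) this], of "k \<zeta>"]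
    show "(\<Sum>n. ?f n \<zeta>) = (\<Sum>n. c n * f \<zeta> ^ n) * k \<zeta>" by simp
  qed
  finally show ?thesis by (simp add: mult.assoc)
qed

lemma integral_circ_powser_cnj:
  assumes "summable (\<lambda>n. cmod (c n))"
  shows "(\<integral>\<zeta>. (\<Sum>n. c n * \<zeta> ^ n) * cnj \<zeta> ^ m \<partial>circ) = c m"
proof -
  have "(\<lambda>n. c n * (\<integral>\<zeta>. \<zeta> ^ n * cnj \<zeta> ^ m \<partial>circ)) sums (\<integral>\<zeta>. (\<Sum>n. c n * \<zeta> ^ n) * cnj \<zeta> ^ m \<partial>circ)"
    by (rule integral_circ_series[OF assms])
      (auto intro!: integrable_circ_continuous borel_measurable_circ_continuous continuous_intros)
  moreover have "(\<lambda>n. c n * (\<integral>\<zeta>. \<zeta> ^ n * cnj \<zeta> ^ m \<partial>circ)) sums c m"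
    using sums_If_finite_set[of "{m}" c] by (simp add: integral_circ_power_cnj if_distrib cong: if_cong)
  ultimately show ?thesis by (rule sums_unique2)
qed

text \<open>Integrating the series termwise against the conjugate of its own sum leaves
  \<open>cnj (c n)\<close> as the n-th inner integral.\<close>

lemma Parseval_powser:
  assumes "summable (\<lambda>n. cmod (c n))"
  shows "(\<lambda>n. (cmod (c n))\<^sup>2) sums (\<integral>\<zeta>. (cmod (\<Sum>n. c n * \<zeta> ^ n))\<^sup>2 \<partial>circ)"
proof -
  let ?g = "\<lambda>\<zeta>. \<Sum>n. c n * \<zeta> ^ n"
  have cg: "continuous_on (sphere 0 1) ?g"
    by (rule continuous_on_subset[OF powser_continuous_cball[OF assms]]) auto
  have "(\<lambda>n. c n * (\<integral>\<zeta>. \<zeta> ^ n * cnj (?g \<zeta>) \<partial>circ)) sums (\<integral>\<zeta>. ?g \<zeta> * cnj (?g \<zeta>) \<partial>circ)"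
    by (rule integral_circ_series[OF assms])
      (auto intro!: integrable_circ_continuous borel_measurable_circ_continuous continuous_intros cg)
  also have "(\<lambda>n. c n * (\<integral>\<zeta>. \<zeta> ^ n * cnj (?g \<zeta>) \<partial>circ)) = (\<lambda>n. c n * cnj (c n))"
  proof
    fix n
    have "(\<integral>\<zeta>. \<zeta> ^ n * cnj (?g \<zeta>) \<partial>circ) = cnj (\<integral>\<zeta>. ?g \<zeta> * cnj \<zeta> ^ n \<partial>circ)"
      using Bochner_Integration.integral_cnj[of circ "\<lambda>\<zeta>. ?g \<zeta> * cnj \<zeta> ^ n"] by (simp add: mult.commute)
    thus "c n * (\<integral>\<zeta>. \<zeta> ^ n * cnj (?g \<zeta>) \<partial>circ) = c n * cnj (c n)"
      by (simp only: integral_circ_powser_cnj[OF assms])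
  qed
  also have "\<dots> = (\<lambda>n. complex_of_real ((cmod (c n))\<^sup>2))" by (simp only: complex_norm_square)
  also have "(\<integral>\<zeta>. ?g \<zeta> * cnj (?g \<zeta>) \<partial>circ) = (\<integral>\<zeta>. complex_of_real ((cmod (?g \<zeta>))\<^sup>2) \<partial>circ)"
    by (simp only: complex_norm_square)
  also have "\<dots> = complex_of_real (\<integral>\<zeta>. (cmod (?g \<zeta>))\<^sup>2 \<partial>circ)" by (rule integral_complex_of_real)
  finally show ?thesis by (simp only: sums_of_real_iff)
qed

subsection \<open>The Poisson kernel\<close>

text \<open>The Herglotz kernel, which is the kernel in the definition of \<open>outer\<close>; its
  real part on the circle is the Poisson kernel.\<close>

definition Herg :: "complex \<Rightarrow> complex \<Rightarrow> complex" where
  "Herg z \<zeta> = (\<zeta> + z) / (\<zeta> - z)"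

definition Pois :: "complex \<Rightarrow> complex \<Rightarrow> real" where
  "Pois z \<zeta> = (1 - (cmod z)\<^sup>2) / (cmod (\<zeta> - z))\<^sup>2"

lemma circ_diff_disc_nonzero: "cmod z < 1 \<Longrightarrow> cmod \<zeta> = 1 \<Longrightarrow> \<zeta> - z \<noteq> 0"
  by auto

lemma Re_Herg:
  assumes "cmod \<zeta> = 1"
  shows "Re (Herg z \<zeta>) = Pois z \<zeta>"
proof -
  have "Re (Herg z \<zeta>) = Re ((\<zeta> + z) * cnj (\<zeta> - z)) / (cmod (\<zeta> - z))\<^sup>2"
    unfolding Herg_def by (subst complex_div_cnj) (simp only: Re_divide_of_real)
  also have "Re ((\<zeta> + z) * cnj (\<zeta> - z)) = (cmod \<zeta>)\<^sup>2 - (cmod z)\<^sup>2"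
    unfolding cmod_power2 by (simp add: algebra_simps power2_eq_square)
  finally show ?thesis using assms by (simp add: Pois_def)
qed

lemma Pois_pos: "cmod z < 1 \<Longrightarrow> cmod \<zeta> = 1 \<Longrightarrow> Pois z \<zeta> > 0"
  unfolding Pois_def using circ_diff_disc_nonzero[of z \<zeta>]
  by (intro divide_pos_pos) (auto simp: abs_square_less_1)

lemma Pois_nonneg: "cmod z < 1 \<Longrightarrow> cmod \<zeta> = 1 \<Longrightarrow> Pois z \<zeta> \<ge> 0"
  using Pois_pos[of z \<zeta>] by simp

lemma continuous_on_Herg: "cmod z < 1 \<Longrightarrow> continuous_on (sphere 0 1) (Herg z)"
  unfolding Herg_def[abs_def] by (auto intro!: continuous_intros)

lemma continuous_on_Pois: "cmod z < 1 \<Longrightarrow> continuous_on (sphere 0 1) (Pois z)"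
  unfolding Pois_def[abs_def] by (auto intro!: continuous_intros)

text \<open>With \<open>w = z * cnj \<zeta>\<close> the kernel is (1 + w) / (1 - w) = 2 / (1 - w) -
  1, whence the coefficient 2 and the exception at index 0.\<close>

lemma Herg_sums:
  assumes "cmod z < 1" "cmod \<zeta> = 1"
  shows "(\<lambda>n. (if n = 0 then 1 else 2) * z ^ n * cnj \<zeta> ^ n) sums Herg z \<zeta>"
proof -
  define w where "w = z * cnj \<zeta>"
  have w: "cmod w < 1" using assms by (simp add: w_def norm_mult)
  have "\<zeta> \<noteq> 0" using assms by auto
  have c: "cnj \<zeta> = 1 / \<zeta>" using cnj_circ[OF assms(2)] \<open>\<zeta> \<noteq> 0\<close> by (simp add: field_simps)
  have "(\<lambda>n. 2 * w ^ n) sums (2 * (1 / (1 - w)))"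
    by (intro sums_mult geometric_sums w)
  moreover have "(\<lambda>n. if n = 0 then -1 else 0) sums (-1::complex)"
    using sums_If_finite_set[of "{0::nat}" "\<lambda>_. -1::complex"] by (simp cong: if_cong)
  ultimately have "(\<lambda>n. 2 * w ^ n + (if n = 0 then -1 else 0)) sums (2 * (1 / (1 - w)) + -1)"
    by (rule sums_add)
  moreover have "2 * (1 / (1 - w)) + -1 = Herg z \<zeta>"
    using circ_diff_disc_nonzero[OF assms] \<open>\<zeta> \<noteq> 0\<close>
    by (simp add: Herg_def w_def c field_simps)
  moreover have "(\<lambda>n. 2 * w ^ n + (if n = 0 then -1 else 0)) = (\<lambda>n. (if n = 0 then 1 else 2) * z ^ n * cnj \<zeta> ^ n)"
    by (auto simp: w_def power_mult_distrib)
  ultimately show ?thesis by simp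
qed

lemma summable_Herg_coeffs:
  assumes "cmod z < 1"
  shows "summable (\<lambda>n. cmod ((if n = 0 then 1 else 2) * z ^ n))"
proof (rule summable_comparison_test')
  show "summable (\<lambda>n. 2 * cmod z ^ n)" using assms by (intro summable_mult summable_geometric) auto
qed (auto simp: norm_mult norm_power)

lemma integral_Herg_series:
  assumes "cmod z < 1" "integrable circ k"
  shows "(\<lambda>n. (if n = 0 then 1 else 2) * z ^ n * (\<integral>\<zeta>. cnj \<zeta> ^ n * k \<zeta> \<partial>circ)) sums (\<integral>\<zeta>. Herg z \<zeta> * k \<zeta> \<partial>circ)"
proof -
  have "(\<lambda>n. (if n = 0 then 1 else 2) * z ^ n * (\<integral>\<zeta>. cnj \<zeta> ^ n * k \<zeta> \<partial>circ)) sums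
    (\<integral>\<zeta>. (\<Sum>n. (if n = 0 then 1 else 2) * z ^ n * cnj \<zeta> ^ n) * k \<zeta> \<partial>circ)"
    by (rule integral_circ_series[OF summable_Herg_coeffs[OF assms(1)] assms(2)])
      (auto intro!: borel_measurable_circ_continuous continuous_intros)
  also have "\<dots> = (\<integral>\<zeta>. Herg z \<zeta> * k \<zeta> \<partial>circ)"
    using Herg_sums[OF assms(1)]
    by (intro Bochner_Integration.integral_cong refl) (auto simp: sums_iff)
  finally show ?thesis .
qed

text \<open>\<open>Pois\<close> is half the sum of \<open>Herg\<close> and its conjugate. For m > 0
  the kernel \<open>Herg\<close> contributes 2 z^m and its conjugate nothing; for m = 0 both
  contribute 1.\<close>

lemma integral_Pois_power:
  assumes "cmod z < 1"
  shows "(\<integral>\<zeta>. of_real (Pois z \<zeta>) * \<zeta> ^ m \<partial>circ) = z ^ m"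
proof -
  have int: "integrable circ (\<lambda>\<zeta>. \<zeta> ^ m)" 
    by (intro integrable_circ_continuous continuous_intros)
  have iH: "integrable circ (\<lambda>\<zeta>. Herg z \<zeta> * \<zeta> ^ m)" "integrable circ (\<lambda>\<zeta>. cnj (Herg z \<zeta>) * \<zeta> ^ m)"
    by (intro integrable_circ_continuous continuous_intros continuous_on_Herg assms)+
  have "(\<lambda>n. (if n = 0 then 1 else 2) * z ^ n * (\<integral>\<zeta>. cnj \<zeta> ^ n * \<zeta> ^ m \<partial>circ)) sums (\<integral>\<zeta>. Herg z \<zeta> * \<zeta> ^ m \<partial>circ)"
    by (rule integral_Herg_series[OF assms int])
  moreover have "(\<lambda>n. (if n = 0 then 1 else 2) * z ^ n * (\<integral>\<zeta>. cnj \<zeta> ^ n * \<zeta> ^ m \<partial>circ)) =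
      (\<lambda>n. if n \<in> {m} then (if n = 0 then 1 else 2) * z ^ n else 0)"
    using integral_circ_power_cnj by (auto simp: mult.commute)
  ultimately have 1: "(\<integral>\<zeta>. Herg z \<zeta> * \<zeta> ^ m \<partial>circ) = (if m = 0 then 1 else 2) * z ^ m"
    using sums_If_finite_set[of "{m}" "\<lambda>n. (if n = 0 then 1 else 2) * z ^ n"] by (auto intro: sums_unique2)
  have "(\<lambda>n. (if n = 0 then 1 else 2) * z ^ n * (\<integral>\<zeta>. cnj \<zeta> ^ n * cnj \<zeta> ^ m \<partial>circ)) sums (\<integral>\<zeta>. Herg z \<zeta> * cnj \<zeta> ^ m \<partial>circ)"
    by (rule integral_Herg_series[OF assms])
      (intro integrable_circ_continuous continuous_intros)
  moreover have "(\<integral>\<zeta>. cnj \<zeta> ^ n * cnj \<zeta> ^ m \<partial>circ) = (if n + m = 0 then 1 else 0)" for n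
  proof -
    have "(\<integral>\<zeta>. cnj \<zeta> ^ n * cnj \<zeta> ^ m \<partial>circ) = cnj (\<integral>\<zeta>. \<zeta> ^ (n + m) \<partial>circ)"
      by (subst Bochner_Integration.integral_cnj[symmetric]) (simp add: power_add)
    thus ?thesis by (simp add: integral_circ_power)
  qed
  ultimately have "(\<lambda>n. if n \<in> {0} then (if m = 0 then 1 else 0) else 0) sums (\<integral>\<zeta>. Herg z \<zeta> * cnj \<zeta> ^ m \<partial>circ)"
    by (auto simp: if_distrib cong: if_cong) (smt (verit) mult_cancel_left1 power_0 sums_cong)
  hence 2: "(\<integral>\<zeta>. Herg z \<zeta> * cnj \<zeta> ^ m \<partial>circ) = (if m = 0 then 1 else 0)"
    using sums_If_finite_set[of "{0::nat}" "\<lambda>n. (if m = 0 then 1 else 0::complex)"] by (auto intro: sums_unique2)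
  have "(\<integral>\<zeta>. cnj (Herg z \<zeta>) * \<zeta> ^ m \<partial>circ) = cnj (\<integral>\<zeta>. Herg z \<zeta> * cnj \<zeta> ^ m \<partial>circ)"
    by (subst Bochner_Integration.integral_cnj[symmetric]) simp
  hence 3: "(\<integral>\<zeta>. cnj (Herg z \<zeta>) * \<zeta> ^ m \<partial>circ) = (if m = 0 then 1 else 0)" by (simp add: 2)
  have "(\<integral>\<zeta>. of_real (Pois z \<zeta>) * \<zeta> ^ m \<partial>circ)
      = (\<integral>\<zeta>. (Herg z \<zeta> * \<zeta> ^ m + cnj (Herg z \<zeta>) * \<zeta> ^ m) / 2 \<partial>circ)"
  proof (rule Bochner_Integration.integral_cong[OF refl])
    fix \<zeta> assume "\<zeta> \<in> space circ"
    hence "Pois z \<zeta> = Re (Herg z \<zeta>)" using Re_Herg by simp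
    thus "of_real (Pois z \<zeta>) * \<zeta> ^ m = (Herg z \<zeta> * \<zeta> ^ m + cnj (Herg z \<zeta>) * \<zeta> ^ m) / 2"
      by (simp add: distrib_right[symmetric] complex_add_cnj)
  qed
  also have "\<dots> = z ^ m" using iH by (simp add: 1 3)
  finally show ?thesis .
qed

lemma integral_Pois_1: 
  assumes "cmod z < 1"
  shows "(\<integral>\<zeta>. Pois z \<zeta> \<partial>circ) = 1"
proof -
  have "complex_of_real (\<integral>\<zeta>. Pois z \<zeta> \<partial>circ) = (\<integral>\<zeta>. of_real (Pois z \<zeta>) * \<zeta> ^ 0 \<partial>circ)"
    by (simp add: integral_complex_of_real)
  thus ?thesis using integral_Pois_power[OF assms, of 0] by simp
qed

lemma Poisson_powser:
  assumes "summable (\<lambda>n. cmod (c n))" "cmod z < 1"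
  shows "(\<integral>\<zeta>. of_real (Pois z \<zeta>) * (\<Sum>n. c n * \<zeta> ^ n) \<partial>circ) = (\<Sum>n. c n * z ^ n)"
proof -
  have "(\<lambda>n. c n * (\<integral>\<zeta>. \<zeta> ^ n * of_real (Pois z \<zeta>) \<partial>circ)) sums
      (\<integral>\<zeta>. (\<Sum>n. c n * \<zeta> ^ n) * of_real (Pois z \<zeta>) \<partial>circ)"
    by (rule integral_circ_series[OF assms(1)])
      (auto intro!: integrable_circ_continuous borel_measurable_circ_continuous continuous_intros continuous_on_Pois assms)
  thus ?thesis
    by (simp add: integral_Pois_power[OF assms(2)] mult.commute[of _ "complex_of_real _"] sums_iff)
qed

lemma Pois_symmetric:
  assumes "cmod \<zeta> = 1" "cmod \<xi> = 1"
  shows "Pois (of_real r * \<zeta>) \<xi> = Pois (of_real r * \<xi>) \<zeta>"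
proof -
  have "cmod (\<xi> - of_real r * \<zeta>) = cmod (\<zeta> - of_real r * \<xi>)"
  proof -
    have e: "\<xi> * cnj \<xi> = 1" "\<zeta> * cnj \<zeta> = 1" using assms by (simp_all add: cnj_circ)
    have "cmod (\<xi> - of_real r * \<zeta>) = cmod (cnj \<xi> * cnj \<zeta> * (\<xi> - of_real r * \<zeta>))"
      using assms by (simp add: norm_mult)
    also have "cnj \<xi> * cnj \<zeta> * (\<xi> - of_real r * \<zeta>) = cnj \<zeta> * (\<xi> * cnj \<xi>) - of_real r * (cnj \<xi> * (\<zeta> * cnj \<zeta>))"
      by (simp add: algebra_simps)
    also have "\<dots> = cnj (\<zeta> - of_real r * \<xi>)" by (simp add: e)
    finally show ?thesis by (simp only: complex_mod_cnj)
  qed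
  thus ?thesis using assms by (simp add: Pois_def norm_mult)
qed

text \<open>As a function of \<eta>, \<open>Herg (of_real r * \<eta>) \<zeta>\<close> is a power
  series converging absolutely on the closed disc. The Poisson integral therefore reproduces its
  value at s \<xi>, and the real part of this identity is the claim up to the symmetry of the
  kernel.\<close>

lemma Pois_semigroup:
  assumes "cmod \<zeta> = 1" "cmod \<xi> = 1" "0 \<le> r" "r < 1" "0 \<le> s" "s < 1"
  shows "(\<integral>\<eta>. Pois (of_real r * \<zeta>) \<eta> * Pois (of_real s * \<xi>) \<eta> \<partial>circ) = Pois (of_real (r * s) * \<zeta>) \<xi>"
proof -
  have ne: "cmod (of_real s * \<xi>) < 1" "cmod (of_real r * \<zeta>) < 1" using assms by (auto simp: norm_mult)
  define c where "c = (\<lambda>n::nat. (if n = 0 then 1 else 2) * (of_real r * cnj \<zeta>) ^ n)"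
  have sc: "summable (\<lambda>n. cmod (c n))"
    unfolding c_def by (rule summable_Herg_coeffs) (use assms in \<open>auto simp: norm_mult\<close>)
  have G: "(\<Sum>n. c n * (of_real t * \<eta>) ^ n) = Herg (of_real (r * t) * \<eta>) \<zeta>" if "cmod \<eta> = 1" "0 \<le> t" "t \<le> 1" for t \<eta>
  proof -
    have "cmod (of_real (r * t) * \<eta>) < 1"
      using assms that mult_left_le[of t r] by (simp add: norm_mult abs_mult del: of_real_mult)
    from Herg_sums[OF this assms(1)] show ?thesis
      unfolding c_def by (simp add: sums_iff power_mult_distrib mult_ac)
  qed
  have G1: "(\<Sum>n. c n * \<eta> ^ n) = Herg (of_real r * \<eta>) \<zeta>" if "cmod \<eta> = 1" for \<eta>
    using G[of \<eta> 1] that by simp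
  have "(\<integral>\<eta>. of_real (Pois (of_real s * \<xi>) \<eta>) * (\<Sum>n. c n * \<eta> ^ n) \<partial>circ) = Herg (of_real (r * s) * \<xi>) \<zeta>"
    using Poisson_powser[OF sc ne(1)] G[of \<xi> s] assms by simp
  hence "Re (\<integral>\<eta>. of_real (Pois (of_real s * \<xi>) \<eta>) * (\<Sum>n. c n * \<eta> ^ n) \<partial>circ) = Pois (of_real (r * s) * \<xi>) \<zeta>"
    using Re_Herg[OF assms(1)] by simp
  also have "Re (\<integral>\<eta>. of_real (Pois (of_real s * \<xi>) \<eta>) * (\<Sum>n. c n * \<eta> ^ n) \<partial>circ)
     = (\<integral>\<eta>. Re (of_real (Pois (of_real s * \<xi>) \<eta>) * (\<Sum>n. c n * \<eta> ^ n)) \<partial>circ)"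
    by (rule integral_Re[symmetric])
      (auto intro!: integrable_circ_continuous continuous_intros continuous_on_Pois ne
        continuous_on_subset[OF powser_continuous_cball[OF sc]])
  also have "\<dots> = (\<integral>\<eta>. Pois (of_real r * \<zeta>) \<eta> * Pois (of_real s * \<xi>) \<eta> \<partial>circ)"
    by (intro Bochner_Integration.integral_cong refl)
      (use assms in \<open>auto simp: G1 Re_Herg Pois_symmetric[of _ \<zeta> r]\<close>)
  finally show ?thesis using Pois_symmetric[OF assms(1,2), of "r * s"] by simp
qed

text \<open>The 8 is 2 times 4. As r \<le> s, passing from r to r s at most doubles 1 - r, which
  costs 2 in the numerator. The distance of r \<zeta> from \<xi> is at most twice that of r s
  \<zeta>, because r - r s \<le> 1 - r s; squaring costs 4 in the denominator.\<close>

lemma Pois_product_bound: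
  assumes "cmod \<zeta> = 1" "cmod \<xi> = 1" "0 \<le> r" "r < 1" "0 \<le> s" "s < 1" "r \<le> s"
  shows "Pois (of_real (r * s) * \<zeta>) \<xi> \<le> 8 * Pois (of_real r * \<zeta>) \<xi>"
proof -
  define \<rho> where "\<rho> = r * s"
  have \<rho>: "0 \<le> \<rho>" "\<rho> \<le> r" "\<rho> < 1" using assms mult_left_le[of s r] by (auto simp: \<rho>_def)
  have "0 \<le> (1 - r) * (1 - s)" using assms by simp
  hence 1: "1 - \<rho> \<le> 2 * (1 - r)" using assms by (simp add: \<rho>_def algebra_simps)
  have num: "1 - \<rho>\<^sup>2 \<le> 2 * (1 - r\<^sup>2)"
  proof -
    have "1 - \<rho>\<^sup>2 = (1 - \<rho>) * (1 + \<rho>)" by (simp add: algebra_simps power2_eq_square)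
    also have "\<dots> \<le> (2 * (1 - r)) * (1 + r)" using 1 \<rho> assms by (intro mult_mono) auto
    finally show ?thesis by (simp add: algebra_simps power2_eq_square)
  qed
  have l: "1 - \<rho> \<le> cmod (\<xi> - of_real \<rho> * \<zeta>)"
    using norm_triangle_ineq2[of \<xi> "of_real \<rho> * \<zeta>"] assms \<rho> by (simp add: norm_mult)
  have "cmod (\<xi> - of_real r * \<zeta>) \<le> cmod (\<xi> - of_real \<rho> * \<zeta>) + cmod (of_real (r - \<rho>) * \<zeta>)"
    using norm_triangle_ineq4[of "\<xi> - of_real \<rho> * \<zeta>" "of_real (r - \<rho>) * \<zeta>"] by (simp add: algebra_simps)
  also have "cmod (of_real (r - \<rho>) * \<zeta>) = r - \<rho>" using \<rho> assms by (simp add: norm_mult del: of_real_diff)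
  finally have den: "cmod (\<xi> - of_real r * \<zeta>) \<le> 2 * cmod (\<xi> - of_real \<rho> * \<zeta>)" using l assms by linarith
  have p1: "cmod (\<xi> - of_real \<rho> * \<zeta>) > 0" using l \<rho> by linarith
  have p2: "cmod (\<xi> - of_real r * \<zeta>) > 0"
    using norm_triangle_ineq2[of \<xi> "of_real r * \<zeta>"] assms circ_diff_disc_nonzero[of "of_real r * \<zeta>" \<xi>]
    by (simp add: norm_mult)
  have "(cmod (\<xi> - of_real r * \<zeta>))\<^sup>2 \<le> (2 * cmod (\<xi> - of_real \<rho> * \<zeta>))\<^sup>2"
    using den by (intro power_mono) auto
  hence den2: "(cmod (\<xi> - of_real r * \<zeta>))\<^sup>2 \<le> 4 * (cmod (\<xi> - of_real \<rho> * \<zeta>))\<^sup>2"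
    by (simp add: power_mult_distrib)
  have r2: "1 - r\<^sup>2 \<ge> 0" using assms by (simp add: abs_square_le_1)
  have "(1 - \<rho>\<^sup>2) * (cmod (\<xi> - of_real r * \<zeta>))\<^sup>2 \<le> (2 * (1 - r\<^sup>2)) * (4 * (cmod (\<xi> - of_real \<rho> * \<zeta>))\<^sup>2)"
    using num den2 r2 by (intro mult_mono) auto
  hence "(1 - \<rho>\<^sup>2) / (cmod (\<xi> - of_real \<rho> * \<zeta>))\<^sup>2 \<le> 8 * ((1 - r\<^sup>2) / (cmod (\<xi> - of_real r * \<zeta>))\<^sup>2)"
    using p1 p2 by (simp add: divide_simps) (simp add: algebra_simps)
  thus ?thesis
    using assms \<rho> by (simp add: Pois_def norm_mult \<rho>_def[symmetric] power_mult_distrib del: of_real_mult)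
qed

lemma Pois_product_bound_sum:
  assumes "cmod \<zeta> = 1" "cmod \<xi> = 1" "0 \<le> r" "r < 1" "0 \<le> s" "s < 1"
  shows "Pois (of_real (r * s) * \<zeta>) \<xi> \<le> 8 * Pois (of_real r * \<zeta>) \<xi> + 8 * Pois (of_real s * \<xi>) \<zeta>"
proof -
  have p: "Pois (of_real r * \<zeta>) \<xi> \<ge> 0" "Pois (of_real s * \<xi>) \<zeta> \<ge> 0"
    using assms by (auto intro!: Pois_nonneg simp: norm_mult)
  show ?thesis
  proof (cases "r \<le> s")
    case True
    thus ?thesis using Pois_product_bound[of \<zeta> \<xi> r s] assms p by simp
  next
    case False
    hence "Pois (of_real (s * r) * \<xi>) \<zeta> \<le> 8 * Pois (of_real s * \<xi>) \<zeta>" 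
      using Pois_product_bound[of \<xi> \<zeta> s r] assms by simp
    thus ?thesis using p Pois_symmetric[OF assms(1,2), of "r * s"] by (simp add: mult.commute)
  qed
qed

subsection \<open>The radial maximal inequality\<close>

interpretation circ2: pair_sigma_finite circ circ ..

lemma id_circ [measurable]: "(\<lambda>\<zeta>. \<zeta>) \<in> borel_measurable circ"
  by (rule borel_measurable_circ_continuous) (rule continuous_on_id)

lemma nn_integral_Pois:
  assumes "cmod z < 1"
  shows "(\<integral>\<^sup>+\<zeta>. ennreal (Pois z \<zeta>) \<partial>circ) = 1"
  using nn_integral_eq_integral[OF integrable_circ_continuous[OF continuous_on_Pois[OF assms]]]
    Pois_nonneg[OF assms] integral_Pois_1[OF assms] by (simp add: AE_circI)

text \<open>The Poisson formula with absolute values, written with \<open>nn_integral\<close> so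
  that Tonelli's theorem applies directly in \<open>maximal_powser\<close>.\<close>

lemma norm_Poisson_powser_le:
  assumes "summable (\<lambda>n. cmod (c n))" "cmod z < 1"
  shows "ennreal (cmod (\<Sum>n. c n * z ^ n)) \<le> (\<integral>\<^sup>+\<zeta>. ennreal (Pois z \<zeta>) * ennreal (cmod (\<Sum>n. c n * \<zeta> ^ n)) \<partial>circ)"
proof -
  have cont: "continuous_on (sphere 0 1) (\<lambda>\<zeta>. \<Sum>n. c n * \<zeta> ^ n)"
    by (rule continuous_on_subset[OF powser_continuous_cball[OF assms(1)]]) auto
  have "cmod (\<Sum>n. c n * z ^ n) \<le> (\<integral>\<zeta>. cmod (of_real (Pois z \<zeta>) * (\<Sum>n. c n * \<zeta> ^ n)) \<partial>circ)"
    unfolding Poisson_powser[OF assms, symmetric] by (rule integral_norm_bound)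
  also have "\<dots> = (\<integral>\<zeta>. Pois z \<zeta> * cmod (\<Sum>n. c n * \<zeta> ^ n) \<partial>circ)"
    using Pois_nonneg[OF assms(2)] by (intro Bochner_Integration.integral_cong refl) (auto simp: norm_mult)
  finally have "ennreal (cmod (\<Sum>n. c n * z ^ n)) \<le> ennreal (\<integral>\<zeta>. Pois z \<zeta> * cmod (\<Sum>n. c n * \<zeta> ^ n) \<partial>circ)"
    by (rule ennreal_leI)
  also have "\<dots> = (\<integral>\<^sup>+\<zeta>. ennreal (Pois z \<zeta> * cmod (\<Sum>n. c n * \<zeta> ^ n)) \<partial>circ)"
    using Pois_nonneg[OF assms(2)]
    by (intro nn_integral_eq_integral[symmetric] integrable_circ_continuous continuous_intros
        continuous_on_Pois assms cont AE_circI) auto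
  also have "\<dots> = (\<integral>\<^sup>+\<zeta>. ennreal (Pois z \<zeta>) * ennreal (cmod (\<Sum>n. c n * \<zeta> ^ n)) \<partial>circ)"
    using Pois_nonneg[OF assms(2)] by (intro nn_integral_cong) (auto simp: ennreal_mult)
  finally show ?thesis .
qed

text \<open>\<open>\<rho>\<close> linearizes the radial maximal function: the integrand on the left is \<open>T\<^sup>*\<close> of the indicator of \<open>E\<close>, where
  \<open>T G (\<zeta>)\<close> is the Poisson integral of \<open>G\<close> at \<open>\<rho>(\<zeta>)\<zeta>\<close>, and the kernel of \<open>T T\<^sup>*\<close> is at most \<open>8\<close> times that of \<open>T + T\<^sup>*\<close>.\<close>

lemma Poisson_TT_bound:
  assumes E: "E \<in> sets circ" and \<rho>[measurable]: "\<rho> \<in> borel_measurable circ"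
    and \<rho>01: "\<And>\<zeta>. 0 \<le> \<rho> \<zeta> \<and> \<rho> \<zeta> < (1::real)"
  shows "(\<integral>\<^sup>+\<eta>. (\<integral>\<^sup>+\<zeta>. indicator E \<zeta> * ennreal (Pois (of_real (\<rho> \<zeta>) * \<zeta>) \<eta>) \<partial>circ)\<^sup>2 \<partial>circ) \<le> 16 * emeasure circ E"
proof -
  define K where "K = (\<lambda>\<zeta> \<eta>. ennreal (Pois (of_real (\<rho> \<zeta>) * \<zeta>) \<eta>))"
  define A where "A = (\<lambda>\<zeta> \<eta>. indicator E \<zeta> * K \<zeta> \<eta>)"
  have ne: "cmod (of_real (\<rho> \<zeta>) * \<zeta>) < 1" if "cmod \<zeta> = 1" for \<zeta>
    using \<rho>01[of \<zeta>] that by (simp add: norm_mult)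
  \<comment> \<open>Composition with arbitrary \<open>f\<close> and \<open>g\<close> lets
    measurability be derived in either order of the arguments and over product spaces.\<close>
  have [measurable]: "(\<lambda>x. K (f x) (g x)) \<in> borel_measurable N" if [measurable]: "f \<in> N \<rightarrow>\<^sub>M circ" "g \<in> N \<rightarrow>\<^sub>M circ"
    for f g :: "_ \<Rightarrow> complex" and N :: "'n measure"
  proof -
    have [measurable]: "f \<in> borel_measurable N" "g \<in> borel_measurable N" "(\<lambda>x. \<rho> (f x)) \<in> borel_measurable N"
      using measurable_compose[OF that(1) id_circ] measurable_compose[OF that(2) id_circ]
        measurable_compose[OF that(1) \<rho>] by simp_all
    show ?thesis unfolding K_def Pois_def by measurable
  qed
  have [measurable]: "E \<in> sets circ" by fact
  have [measurable]: "(\<lambda>x. A (f x) (g x)) \<in> borel_measurable N" if [measurable]: "f \<in> N \<rightarrow>\<^sub>M circ" "g \<in> N \<rightarrow>\<^sub>M circ"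
    for f g :: "_ \<Rightarrow> complex" and N :: "'n measure"
    unfolding A_def by measurable
  have K1: "(\<integral>\<^sup>+\<eta>. K \<zeta> \<eta> \<partial>circ) = 1" if "cmod \<zeta> = 1" for \<zeta>
    unfolding K_def by (rule nn_integral_Pois[OF ne[OF that]])
  have KK: "(\<integral>\<^sup>+\<eta>. K \<zeta> \<eta> * K \<xi> \<eta> \<partial>circ) \<le> 8 * K \<zeta> \<xi> + 8 * K \<xi> \<zeta>" if "cmod \<zeta> = 1" "cmod \<xi> = 1" for \<zeta> \<xi>
  proof -
    have "(\<integral>\<^sup>+\<eta>. K \<zeta> \<eta> * K \<xi> \<eta> \<partial>circ) =
        (\<integral>\<^sup>+\<eta>. ennreal (Pois (of_real (\<rho> \<zeta>) * \<zeta>) \<eta> * Pois (of_real (\<rho> \<xi>) * \<xi>) \<eta>) \<partial>circ)"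
      using Pois_nonneg[OF ne[OF that(1)]] Pois_nonneg[OF ne[OF that(2)]]
      by (intro nn_integral_cong) (auto simp: K_def ennreal_mult)
    also have "\<dots> = ennreal (\<integral>\<eta>. Pois (of_real (\<rho> \<zeta>) * \<zeta>) \<eta> * Pois (of_real (\<rho> \<xi>) * \<xi>) \<eta> \<partial>circ)"
      using Pois_nonneg[OF ne[OF that(1)]] Pois_nonneg[OF ne[OF that(2)]]
      by (intro nn_integral_eq_integral integrable_circ_continuous continuous_intros
          continuous_on_Pois ne that AE_circI) auto
    also have "\<dots> \<le> ennreal (8 * Pois (of_real (\<rho> \<zeta>) * \<zeta>) \<xi> + 8 * Pois (of_real (\<rho> \<xi>) * \<xi>) \<zeta>)"
      using \<rho>01 that by (intro ennreal_leI) (simp add: Pois_semigroup Pois_product_bound_sum del: of_real_mult)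
    also have "\<dots> = 8 * K \<zeta> \<xi> + 8 * K \<xi> \<zeta>"
      using Pois_nonneg[OF ne[OF that(1)] that(2)] Pois_nonneg[OF ne[OF that(2)] that(1)]
      by (simp add: K_def ennreal_mult)
    finally show ?thesis .
  qed
  \<comment> \<open>The square becomes a double integral over two copies of \<open>E\<close>, and
    Tonelli moves the \<eta>-integral inside, where the kernel bound \<open>KK\<close>
    applies.\<close>
  have "(\<integral>\<^sup>+\<eta>. (\<integral>\<^sup>+\<zeta>. A \<zeta> \<eta> \<partial>circ)\<^sup>2 \<partial>circ) = (\<integral>\<^sup>+\<eta>. (\<integral>\<^sup>+\<xi>. (\<integral>\<^sup>+\<zeta>. A \<zeta> \<eta> * A \<xi> \<eta> \<partial>circ) \<partial>circ) \<partial>circ)"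
    by (intro nn_integral_cong) (simp add: power2_eq_square nn_integral_cmult nn_integral_multc)
  also have "\<dots> = (\<integral>\<^sup>+\<xi>. (\<integral>\<^sup>+\<eta>. (\<integral>\<^sup>+\<zeta>. A \<zeta> \<eta> * A \<xi> \<eta> \<partial>circ) \<partial>circ) \<partial>circ)"
    by (rule circ2.Fubini') measurable
  also have "\<dots> = (\<integral>\<^sup>+\<xi>. (\<integral>\<^sup>+\<zeta>. (\<integral>\<^sup>+\<eta>. A \<zeta> \<eta> * A \<xi> \<eta> \<partial>circ) \<partial>circ) \<partial>circ)"
    by (intro nn_integral_cong circ2.Fubini') measurable
  also have "\<dots> \<le> (\<integral>\<^sup>+\<xi>. (\<integral>\<^sup>+\<zeta>. 8 * A \<zeta> \<xi> + 8 * A \<xi> \<zeta> \<partial>circ) \<partial>circ)"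
  proof (intro nn_integral_mono)
    fix \<xi> \<zeta> assume s: "\<xi> \<in> space circ" "\<zeta> \<in> space circ"
    have "(\<integral>\<^sup>+\<eta>. A \<zeta> \<eta> * A \<xi> \<eta> \<partial>circ) = (\<integral>\<^sup>+\<eta>. (indicator E \<zeta> * indicator E \<xi>) * (K \<zeta> \<eta> * K \<xi> \<eta>) \<partial>circ)"
      by (intro nn_integral_cong) (simp add: A_def mult_ac)
    also have "\<dots> = (indicator E \<zeta> * indicator E \<xi>) * (\<integral>\<^sup>+\<eta>. K \<zeta> \<eta> * K \<xi> \<eta> \<partial>circ)"
      using s by (intro nn_integral_cmult) measurable
    also have "\<dots> \<le> (indicator E \<zeta> * indicator E \<xi>) * (8 * K \<zeta> \<xi> + 8 * K \<xi> \<zeta>)"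
      using s KK by (intro mult_left_mono) auto
    also have "\<dots> \<le> 8 * A \<zeta> \<xi> + 8 * A \<xi> \<zeta>"
      by (auto simp: A_def indicator_def)
    finally show "(\<integral>\<^sup>+\<eta>. A \<zeta> \<eta> * A \<xi> \<eta> \<partial>circ) \<le> 8 * A \<zeta> \<xi> + 8 * A \<xi> \<zeta>" .
  qed
  \<comment> \<open>Each kernel has mass 1 in its second variable, so after exchanging the order in
    one term both double integrals equal the measure of \<open>E\<close>; 8 + 8 is the constant
    16.\<close>
  also have "\<dots> = 8 * (\<integral>\<^sup>+\<xi>. (\<integral>\<^sup>+\<zeta>. A \<zeta> \<xi> \<partial>circ) \<partial>circ) + 8 * (\<integral>\<^sup>+\<xi>. (\<integral>\<^sup>+\<zeta>. A \<xi> \<zeta> \<partial>circ) \<partial>circ)"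
    by (simp add: nn_integral_add nn_integral_cmult cong: nn_integral_cong)
  also have "(\<integral>\<^sup>+\<xi>. (\<integral>\<^sup>+\<zeta>. A \<zeta> \<xi> \<partial>circ) \<partial>circ) = (\<integral>\<^sup>+\<xi>. (\<integral>\<^sup>+\<zeta>. A \<xi> \<zeta> \<partial>circ) \<partial>circ)"
    by (rule circ2.Fubini') measurable
  also have "(\<integral>\<^sup>+\<xi>. (\<integral>\<^sup>+\<zeta>. A \<xi> \<zeta> \<partial>circ) \<partial>circ) = (\<integral>\<^sup>+\<xi>. indicator E \<xi> \<partial>circ)"
    by (intro nn_integral_cong) (simp add: A_def nn_integral_cmult K1)
  also have "\<dots> = emeasure circ E" by simp
  also have "8 * emeasure circ E + 8 * emeasure circ E = 16 * emeasure circ E"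
    by (simp add: distrib_right[symmetric])
  finally show ?thesis by (simp add: A_def K_def)
qed

text \<open>The supremum over radii is linearized by a measurable choice \<rho> of a radius where
  \<kappa> is exceeded. Integrating over \<open>E\<close> and exchanging integrals bounds \<kappa>
  times the measure of \<open>E\<close> by the integral of \<open>H\<close> times \<open>g\<close>,
  and \<open>Poisson_TT_bound\<close> controls the square integral of \<open>H\<close> by the
  measure of \<open>E\<close> itself.\<close>

lemma maximal_powser:
  assumes c: "summable (\<lambda>n. cmod (c n))" and "\<kappa> > 0"
  defines "E \<equiv> {\<zeta> \<in> sphere 0 1. \<exists>r\<in>{0..<1}. cmod (\<Sum>n. c n * (of_real r * \<zeta>) ^ n) > \<kappa>}"
  shows "E \<in> sets circ" "measure circ E \<le> 16 * (\<Sum>n. (cmod (c n))\<^sup>2) / \<kappa>\<^sup>2"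
proof -
  define G where "G = (\<lambda>z. \<Sum>n. c n * z ^ n)"
  have contG: "continuous_on (cball 0 1) G"
    unfolding G_def by (rule powser_continuous_cball[OF c])
  \<comment> \<open>Countably many radii suffice by continuity along each radius; this makes
    \<open>E\<close> measurable and allows the choice of a first admissible index.\<close>
  define Q where "Q = from_nat_into ({0..<1} \<inter> \<rat> :: real set)"
  have cQ: "countable ({0..<1} \<inter> \<rat> :: real set)" by (rule countable_Int2[OF countable_rat])
  have "0 \<in> {0..<1::real} \<inter> \<rat>" by simp
  hence neQ: "{0..<1::real} \<inter> \<rat> \<noteq> {}" by blast
  have Q: "0 \<le> Q j \<and> Q j < 1" for j
    using from_nat_into[OF neQ, of j] by (simp add: Q_def)
  define P where "P = (\<lambda>j \<zeta>. cmod (G (of_real (Q j) * \<zeta>)) > \<kappa>)"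
  have G_rad: "continuous_on (sphere 0 1) (\<lambda>\<zeta>. G (of_real r * \<zeta>))" if "0 \<le> r" "r \<le> 1" for r
    by (rule continuous_on_compose2[OF contG]) (use that in \<open>auto intro!: continuous_intros simp: norm_mult\<close>)
  have [measurable]: "Measurable.pred circ (P j)" for j
  proof -
    have [measurable]: "(\<lambda>\<zeta>. G (of_real (Q j) * \<zeta>)) \<in> borel_measurable circ"
      using Q[of j] by (intro borel_measurable_circ_continuous G_rad) auto
    show ?thesis unfolding P_def by measurable
  qed
  have EP: "E = {\<zeta> \<in> space circ. \<exists>j. P j \<zeta>}"
  proof (intro equalityI subsetI)
    fix \<zeta> assume "\<zeta> \<in> E"
    then obtain r where z: "cmod \<zeta> = 1" and r: "0 \<le> r" "r < 1" "cmod (G (of_real r * \<zeta>)) > \<kappa>"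
      by (auto simp: E_def G_def)
    have "continuous_on {0..1} (\<lambda>r. cmod (G (of_real r * \<zeta>)))"
      by (intro continuous_on_norm continuous_on_compose2[OF contG])
        (use z in \<open>auto intro!: continuous_intros simp: norm_mult\<close>)
    hence "continuous (at r within {0..1}) (\<lambda>r. cmod (G (of_real r * \<zeta>)))"
      using r by (simp add: continuous_on_eq_continuous_within)
    hence "\<forall>\<^sub>F s in at r within {0..1}. cmod (G (of_real s * \<zeta>)) > \<kappa>"
      using r(3) unfolding continuous_within by (rule order_tendstoD)
    then obtain d where d: "d > 0" "\<And>s. s \<in> {0..1} \<Longrightarrow> s \<noteq> r \<Longrightarrow> dist s r < d \<Longrightarrow> cmod (G (of_real s * \<zeta>)) > \<kappa>"
      unfolding eventually_at by blast
    obtain s where s: "s \<in> \<rat>" "r < s" "s < min 1 (r + d)"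
      using Rats_dense_in_real[of r "min 1 (r + d)"] r d by auto
    hence "cmod (G (of_real s * \<zeta>)) > \<kappa>" using d(2)[of s] r by (simp add: dist_real_def)
    moreover have "s \<in> {0..<1} \<inter> \<rat>" using s r by simp
    then obtain j where "Q j = s" using from_nat_into_surj[OF cQ] unfolding Q_def by blast
    ultimately have "P j \<zeta>" by (simp add: P_def)
    thus "\<zeta> \<in> {\<zeta> \<in> space circ. \<exists>j. P j \<zeta>}" using z by auto
  next
    fix \<zeta> assume "\<zeta> \<in> {\<zeta> \<in> space circ. \<exists>j. P j \<zeta>}"
    then obtain j where "cmod \<zeta> = 1" "P j \<zeta>" by auto
    thus "\<zeta> \<in> E" using Q[of j] by (auto simp: E_def P_def G_def)
  qed
  show E[measurable]: "E \<in> sets circ" unfolding EP by measurable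
  \<comment> \<open>Off \<open>E\<close> the \<open>LEAST\<close> is arbitrary, but \<rho> still
    takes values of \<open>Q\<close>, hence in [0, 1), as \<open>Poisson_TT_bound\<close> requires
    everywhere.\<close>
  define \<rho> where "\<rho> = (\<lambda>\<zeta>. Q (LEAST j. P j \<zeta>))"
  have [measurable]: "\<rho> \<in> borel_measurable circ" unfolding \<rho>_def by measurable
  have \<rho>01: "0 \<le> \<rho> \<zeta> \<and> \<rho> \<zeta> < 1" for \<zeta> using Q by (simp add: \<rho>_def)
  have \<rho>E: "cmod (G (of_real (\<rho> \<zeta>) * \<zeta>)) > \<kappa>" if "\<zeta> \<in> E" for \<zeta>
    using that LeastI_ex[of "\<lambda>j. P j \<zeta>"] by (auto simp: EP \<rho>_def P_def)
  define K where "K = (\<lambda>\<zeta> \<eta>. ennreal (Pois (of_real (\<rho> \<zeta>) * \<zeta>) \<eta>))"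
  have [measurable]: "(\<lambda>x. K (f x) (g x)) \<in> borel_measurable N" if [measurable]: "f \<in> N \<rightarrow>\<^sub>M circ" "g \<in> N \<rightarrow>\<^sub>M circ"
    for f g :: "_ \<Rightarrow> complex" and N :: "'n measure"
  proof -
    have [measurable]: "f \<in> borel_measurable N" "g \<in> borel_measurable N" "(\<lambda>x. \<rho> (f x)) \<in> borel_measurable N"
      using measurable_compose[OF that(1) id_circ] measurable_compose[OF that(2) id_circ]
        measurable_compose[OF that(1) \<open>\<rho> \<in> borel_measurable circ\<close>] by simp_all
    show ?thesis unfolding K_def Pois_def by measurable
  qed
  define g where "g = (\<lambda>\<eta>. cmod (G \<eta>))"
  have contg: "continuous_on (sphere 0 1) g" 
    unfolding g_def using G_rad[of 1] by (auto intro!: continuous_intros)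
  have [measurable]: "g \<in> borel_measurable circ"
    by (rule borel_measurable_circ_continuous[OF contg])
  define H where "H = (\<lambda>\<eta>. \<integral>\<^sup>+\<zeta>. indicator E \<zeta> * K \<zeta> \<eta> \<partial>circ)"
  have [measurable]: "H \<in> borel_measurable circ" unfolding H_def by measurable
  define m where "m = measure circ E"
  have m: "emeasure circ E = ennreal m" by (simp add: m_def circ.emeasure_eq_measure)
  have mn: "m \<ge> 0" by (simp add: m_def)
  define S where "S = (\<Sum>n. (cmod (c n))\<^sup>2)"
  have S: "S = (\<integral>\<eta>. (g \<eta>)\<^sup>2 \<partial>circ)"
    using Parseval_powser[OF c] by (simp add: S_def g_def G_def sums_iff)
  have Sn: "S \<ge> 0" unfolding S by simp
  have "ennreal \<kappa> * ennreal m = (\<integral>\<^sup>+\<zeta>. ennreal \<kappa> * indicator E \<zeta> \<partial>circ)"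
    by (simp add: nn_integral_cmult m)
  also have "\<dots> \<le> (\<integral>\<^sup>+\<zeta>. (\<integral>\<^sup>+\<eta>. indicator E \<zeta> * K \<zeta> \<eta> * ennreal (g \<eta>) \<partial>circ) \<partial>circ)"
  proof (rule nn_integral_mono)
    fix \<zeta> assume s: "\<zeta> \<in> space circ"
    have e: "(\<integral>\<^sup>+\<eta>. indicator E \<zeta> * K \<zeta> \<eta> * ennreal (g \<eta>) \<partial>circ) = indicator E \<zeta> * (\<integral>\<^sup>+\<eta>. K \<zeta> \<eta> * ennreal (g \<eta>) \<partial>circ)"
      using s by (simp add: mult.assoc nn_integral_cmult)
    show "ennreal \<kappa> * indicator E \<zeta> \<le> (\<integral>\<^sup>+\<eta>. indicator E \<zeta> * K \<zeta> \<eta> * ennreal (g \<eta>) \<partial>circ)"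
    proof (cases "\<zeta> \<in> E")
      case True
      have "ennreal \<kappa> \<le> ennreal (cmod (G (of_real (\<rho> \<zeta>) * \<zeta>)))"
        using \<rho>E[OF True] by (intro ennreal_leI) simp
      also have "\<dots> \<le> (\<integral>\<^sup>+\<eta>. K \<zeta> \<eta> * ennreal (g \<eta>) \<partial>circ)"
        unfolding K_def g_def G_def
        by (rule norm_Poisson_powser_le[OF c]) (use \<rho>01[of \<zeta>] s in \<open>simp add: norm_mult\<close>)
      finally show ?thesis using True by (simp add: e)
    qed simp
  qed
  also have "\<dots> = (\<integral>\<^sup>+\<eta>. (\<integral>\<^sup>+\<zeta>. indicator E \<zeta> * K \<zeta> \<eta> * ennreal (g \<eta>) \<partial>circ) \<partial>circ)"
    by (rule circ2.Fubini') measurable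
  also have "\<dots> = (\<integral>\<^sup>+\<eta>. H \<eta> * ennreal (g \<eta>) \<partial>circ)"
    unfolding H_def by (intro nn_integral_cong nn_integral_multc) measurable
  finally have 1: "ennreal (\<kappa> * m) \<le> (\<integral>\<^sup>+\<eta>. H \<eta> * ennreal (g \<eta>) \<partial>circ)"
    using \<open>\<kappa> > 0\<close> mn by (simp add: ennreal_mult)
  \<comment> \<open>With this weight in AM-GM the term 16 m / t equals \<kappa> m, half of the
    left-hand side 2 \<kappa> m, and is absorbed there.\<close>
  define t where "t = 16 / \<kappa>"
  have t: "t > 0" using \<open>\<kappa> > 0\<close> by (simp add: t_def)
  have amgm: "2 * (h * ennreal x) \<le> ennreal (t * x\<^sup>2) + ennreal (1 / t) * h\<^sup>2" if "x \<ge> 0" for h x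
  proof (cases h)
    case (real y)
    have "0 \<le> (t * x - y)\<^sup>2 / t" using t by simp
    also have "\<dots> = t * x\<^sup>2 + 1 / t * y\<^sup>2 - 2 * (y * x)"
      using t by (simp add: power2_eq_square field_simps)
    finally have "2 * (y * x) \<le> t * x\<^sup>2 + 1 / t * y\<^sup>2" by simp
    hence "ennreal (2 * (y * x)) \<le> ennreal (t * x\<^sup>2 + 1 / t * y\<^sup>2)" by (rule ennreal_leI)
    also have "ennreal (2 * (y * x)) = 2 * (h * ennreal x)"
      using real that by (simp add: ennreal_mult)
    also have "ennreal (t * x\<^sup>2 + 1 / t * y\<^sup>2) = ennreal (t * x\<^sup>2) + ennreal (1 / t) * h\<^sup>2"
      using real t that by (subst ennreal_plus) (simp_all add: ennreal_mult[symmetric] ennreal_power del: ennreal_plus)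
    finally show ?thesis .
  next
    case top
    hence "ennreal (1 / t) * h\<^sup>2 = top" using t by (simp add: power2_eq_square ennreal_mult_top)
    thus ?thesis by simp
  qed
  have "ennreal (2 * (\<kappa> * m)) = 2 * ennreal (\<kappa> * m)" using \<open>\<kappa> > 0\<close> mn by (simp add: ennreal_mult)
  also have "\<dots> \<le> 2 * (\<integral>\<^sup>+\<eta>. H \<eta> * ennreal (g \<eta>) \<partial>circ)" using 1 by (intro mult_left_mono) auto
  also have "\<dots> = (\<integral>\<^sup>+\<eta>. 2 * (H \<eta> * ennreal (g \<eta>)) \<partial>circ)" by (intro nn_integral_cmult[symmetric]) measurable
  also have "\<dots> \<le> (\<integral>\<^sup>+\<eta>. ennreal (t * (g \<eta>)\<^sup>2) + ennreal (1 / t) * (H \<eta>)\<^sup>2 \<partial>circ)"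
    by (intro nn_integral_mono amgm) (simp add: g_def)
  also have "\<dots> = (\<integral>\<^sup>+\<eta>. ennreal (t * (g \<eta>)\<^sup>2) \<partial>circ) + ennreal (1 / t) * (\<integral>\<^sup>+\<eta>. (H \<eta>)\<^sup>2 \<partial>circ)"
    by (subst nn_integral_add) (simp_all add: nn_integral_cmult)
  also have "(\<integral>\<^sup>+\<eta>. ennreal (t * (g \<eta>)\<^sup>2) \<partial>circ) = ennreal (t * S)"
    using t contg by (subst nn_integral_eq_integral)
      (auto simp: S intro!: integrable_circ_continuous continuous_intros)
  also have "(\<integral>\<^sup>+\<eta>. (H \<eta>)\<^sup>2 \<partial>circ) \<le> 16 * emeasure circ E"
    unfolding H_def K_def by (rule Poisson_TT_bound) (use E \<rho>01 in auto)
  also have "ennreal (t * S) + ennreal (1 / t) * (16 * emeasure circ E) = ennreal (t * S + 1 / t * (16 * m))"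
  proof -
    have "16 * emeasure circ E = ennreal (16 * m)" using mn by (simp add: m ennreal_mult)
    thus ?thesis using t Sn mn by (simp add: ennreal_mult[symmetric] ennreal_plus[symmetric] del: ennreal_plus)
  qed
  finally have "ennreal (2 * (\<kappa> * m)) \<le> ennreal (t * S + 1 / t * (16 * m))"
    by (simp add: mult_left_mono add_left_mono)
  hence "2 * (\<kappa> * m) \<le> t * S + 1 / t * (16 * m)"
    using t Sn mn by (subst (asm) ennreal_le_iff) auto
  hence "\<kappa> * m \<le> 16 / \<kappa> * S" by (simp add: t_def)
  thus "measure circ E \<le> 16 * (\<Sum>n. (cmod (c n))\<^sup>2) / \<kappa>\<^sup>2"
    using \<open>\<kappa> > 0\<close> unfolding m_def[symmetric] S_def[symmetric]
    by (simp add: field_simps power2_eq_square)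
qed

subsection \<open>Taylor coefficients\<close>

definition tcoeff :: "(complex \<Rightarrow> complex) \<Rightarrow> nat \<Rightarrow> complex" where
  "tcoeff f n = (deriv ^^ n) f 0 / fact n"

lemma analytic_disc_holo: "f \<in> analytic_disc \<Longrightarrow> f holomorphic_on disc"
  and analytic_disc_off: "f \<in> analytic_disc \<Longrightarrow> cmod z \<ge> 1 \<Longrightarrow> f z = 0"
  by (auto simp: analytic_disc_def)

lemma analytic_disc_cont: "f \<in> analytic_disc \<Longrightarrow> continuous_on disc f"
  by (intro holomorphic_on_imp_continuous_on analytic_disc_holo)

lemma tcoeff_sums: "f \<in> analytic_disc \<Longrightarrow> cmod z < 1 \<Longrightarrow> (\<lambda>n. tcoeff f n * z ^ n) sums f z"
  using holomorphic_power_series[OF analytic_disc_holo, of f z] by (simp add: tcoeff_def)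

lemma powser_disc_abs_summable:
  fixes c :: "nat \<Rightarrow> complex"
  assumes "\<And>z. cmod z < 1 \<Longrightarrow> summable (\<lambda>n. c n * z ^ n)" "cmod w < 1"
  shows "summable (\<lambda>n. cmod (c n * w ^ n))"
proof -
  obtain t where t: "cmod w < t" "t < 1" using dense assms(2) by blast
  have "summable (\<lambda>n. c n * of_real t ^ n)"
    using t by (intro assms(1)) (metis abs_of_nonneg norm_ge_zero norm_of_real order.strict_trans1 less_imp_le)
  thus ?thesis
    by (rule powser_insidea) (use t norm_ge_zero[of w] in auto)
qed

lemma tcoeff_abs_summable:
  "f \<in> analytic_disc \<Longrightarrow> cmod z < 1 \<Longrightarrow> summable (\<lambda>n. cmod (tcoeff f n * z ^ n))"
  using powser_disc_abs_summable[of "tcoeff f"] tcoeff_sums sums_summable by blast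

lemma analytic_discI_sums:
  assumes "\<And>z. cmod z < 1 \<Longrightarrow> (\<lambda>n. c n * z ^ n) sums f z" "\<And>z. cmod z \<ge> 1 \<Longrightarrow> f z = 0"
  shows "f \<in> analytic_disc"
  unfolding analytic_disc_def using assms power_series_holomorphic[of 0 1 c f] by auto

text \<open>Both series converge absolutely on the circle of radius 1/2, where their coefficients
  are recovered as Fourier coefficients. The coefficients of all functions constructed below are
  computed through this lemma.\<close>

lemma tcoeff_unique:
  assumes "\<And>z. cmod z < 1 \<Longrightarrow> (\<lambda>n. c n * z ^ n) sums f z" "\<And>z. cmod z \<ge> 1 \<Longrightarrow> f z = 0"
  shows "tcoeff f = c"
proof
  fix m
  have f: "f \<in> analytic_disc" using assms by (rule analytic_discI_sums)
  have a1: "summable (\<lambda>n. cmod (c n * (1/2) ^ n))"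
    by (rule powser_disc_abs_summable) (use assms sums_summable in auto)
  have a2: "summable (\<lambda>n. cmod (tcoeff f n * (1/2) ^ n))"
    by (rule tcoeff_abs_summable[OF f]) simp
  have "(\<integral>\<zeta>. (\<Sum>n. (c n * (1/2) ^ n) * \<zeta> ^ n) * cnj \<zeta> ^ m \<partial>circ)
      = (\<integral>\<zeta>. (\<Sum>n. (tcoeff f n * (1/2) ^ n) * \<zeta> ^ n) * cnj \<zeta> ^ m \<partial>circ)"
  proof (rule Bochner_Integration.integral_cong[OF refl])
    fix \<zeta> assume "\<zeta> \<in> space circ"
    hence z: "cmod (1/2 * \<zeta>) < 1" by (simp add: norm_mult norm_divide)
    have "(\<Sum>n. c n * (1/2 * \<zeta>) ^ n) = (\<Sum>n. tcoeff f n * (1/2 * \<zeta>) ^ n)"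
      using assms(1)[OF z] tcoeff_sums[OF f z] by (simp add: sums_iff)
    thus "(\<Sum>n. (c n * (1/2) ^ n) * \<zeta> ^ n) * cnj \<zeta> ^ m = (\<Sum>n. (tcoeff f n * (1/2) ^ n) * \<zeta> ^ n) * cnj \<zeta> ^ m"
      by (simp add: power_mult_distrib mult.assoc del: times_divide_eq_left times_divide_eq_right power_one_over)
  qed
  thus "tcoeff f m = c m"
    by (simp only: integral_circ_powser_cnj[OF a1] integral_circ_powser_cnj[OF a2]) simp
qed

lemma analytic_disc_ext:
  assumes "f \<in> analytic_disc" "g \<in> analytic_disc" "\<And>n. tcoeff f n = tcoeff g n"
  shows "f = g"
proof
  fix z
  show "f z = g z"
  proof (cases "cmod z < 1")
    case True
    thus ?thesis using tcoeff_sums[OF assms(1) True] tcoeff_sums[OF assms(2) True] assms(3)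
      by (metis (no_types, lifting) sums_unique2 sums_cong)
  qed (use analytic_disc_off[OF assms(1), of z] analytic_disc_off[OF assms(2), of z] in simp)
qed

lemma analytic_disc_zero: "(\<lambda>z. 0) \<in> analytic_disc" by (auto simp: analytic_disc_def)

lemma analytic_disc_add: "f \<in> analytic_disc \<Longrightarrow> g \<in> analytic_disc \<Longrightarrow> (\<lambda>z. f z + g z) \<in> analytic_disc"
  by (auto simp: analytic_disc_def intro!: holomorphic_intros)

lemma analytic_disc_mult: "f \<in> analytic_disc \<Longrightarrow> g \<in> analytic_disc \<Longrightarrow> (\<lambda>z. f z * g z) \<in> analytic_disc"
  by (auto simp: analytic_disc_def intro!: holomorphic_intros)

lemma analytic_disc_scale: "f \<in> analytic_disc \<Longrightarrow> (\<lambda>z. c * f z) \<in> analytic_disc"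
  by (auto simp: analytic_disc_def intro!: holomorphic_intros)

lemma tcoeff_zero: "tcoeff (\<lambda>z. 0) n = 0"
  using tcoeff_unique[of "\<lambda>n. 0" "\<lambda>z. 0"] by simp

lemma tcoeff_add: 
  assumes "f \<in> analytic_disc" "g \<in> analytic_disc"
  shows "tcoeff (\<lambda>z. f z + g z) n = tcoeff f n + tcoeff g n"
proof -
  have "tcoeff (\<lambda>z. f z + g z) = (\<lambda>n. tcoeff f n + tcoeff g n)"
    by (rule tcoeff_unique)
      (auto simp: distrib_right analytic_disc_off assms intro!: sums_add tcoeff_sums)
  thus ?thesis by simp
qed

lemma tcoeff_scale: 
  assumes "f \<in> analytic_disc"
  shows "tcoeff (\<lambda>z. c * f z) n = c * tcoeff f n"
proof -
  have "tcoeff (\<lambda>z. c * f z) = (\<lambda>n. c * tcoeff f n)"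
    by (rule tcoeff_unique)
      (auto simp: mult.assoc analytic_disc_off assms intro!: sums_mult tcoeff_sums)
  thus ?thesis by simp
qed

lemma tcoeff_diff: 
  assumes "f \<in> analytic_disc" "g \<in> analytic_disc"
  shows "tcoeff (\<lambda>z. f z - g z) n = tcoeff f n - tcoeff g n"
  using tcoeff_add[OF assms(1) analytic_disc_scale[OF assms(2), of "-1"]] tcoeff_scale[OF assms(2), of "-1"] by simp

section \<open>The Hardy space in terms of square-summable Taylor coefficients\<close>

lemma dilation_powser:
  assumes "f \<in> analytic_disc" "cmod w < 1" "cmod z \<le> 1"
  shows "(\<Sum>n. (tcoeff f n * w ^ n) * z ^ n) = f (w * z)"
proof -
  have "cmod (w * z) \<le> cmod w" using assms by (simp add: norm_mult mult_left_le)
  thus ?thesis using tcoeff_sums[OF assms(1), of "w * z"] assms by (simp add: sums_iff power_mult_distrib mult_ac)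
qed

lemma Parseval_dilation:
  assumes "f \<in> analytic_disc" "0 \<le> r" "r < 1"
  shows "(\<lambda>n. (cmod (tcoeff f n))\<^sup>2 * (r ^ n)\<^sup>2) sums (\<integral>\<zeta>. (cmod (f (of_real r * \<zeta>)))\<^sup>2 \<partial>circ)"
proof -
  have r: "cmod (of_real r) < 1" using assms by simp
  have "(\<lambda>n. (cmod (tcoeff f n * of_real r ^ n))\<^sup>2) sums (\<integral>\<zeta>. (cmod (\<Sum>n. (tcoeff f n * of_real r ^ n) * \<zeta> ^ n))\<^sup>2 \<partial>circ)"
    by (rule Parseval_powser[OF tcoeff_abs_summable[OF assms(1) r]])
  moreover have "(\<integral>\<zeta>. (cmod (\<Sum>n. (tcoeff f n * of_real r ^ n) * \<zeta> ^ n))\<^sup>2 \<partial>circ) = (\<integral>\<zeta>. (cmod (f (of_real r * \<zeta>)))\<^sup>2 \<partial>circ)"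
    by (intro Bochner_Integration.integral_cong refl) (auto simp: dilation_powser[OF assms(1) r])
  ultimately show ?thesis using assms by (simp add: norm_mult norm_power power_mult_distrib)
qed

text \<open>Parseval's identity on circles of radius r < 1 links the two conditions: partial sums
  are bounded by letting r tend to 1, and conversely the factors r^(2n) are at most 1.\<close>

lemma H2_iff: "f \<in> H2 \<longleftrightarrow> f \<in> analytic_disc \<and> summable (\<lambda>n. (cmod (tcoeff f n))\<^sup>2)"
proof (intro iffI conjI)
  assume "f \<in> H2"
  then obtain B where f: "f \<in> analytic_disc" and B: "\<And>r. 0 \<le> r \<Longrightarrow> r < 1 \<Longrightarrow> (\<integral>\<zeta>. (cmod (f (of_real r * \<zeta>)))\<^sup>2 \<partial>circ) \<le> B"
    by (simp add: H2_def bdd_above_def) (meson atLeastLessThan_iff)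
  show "f \<in> analytic_disc" by fact
  show "summable (\<lambda>n. (cmod (tcoeff f n))\<^sup>2)"
  proof (rule bounded_imp_summable)
    fix N
    have "((\<lambda>r. \<Sum>n\<le>N. (cmod (tcoeff f n))\<^sup>2 * (r ^ n)\<^sup>2) \<longlongrightarrow> (\<Sum>n\<le>N. (cmod (tcoeff f n))\<^sup>2 * (1 ^ n)\<^sup>2)) (at_left (1::real))"
      by (intro tendsto_intros)
    moreover have "\<forall>\<^sub>F r in at_left (1::real). (\<Sum>n\<le>N. (cmod (tcoeff f n))\<^sup>2 * (r ^ n)\<^sup>2) \<le> B"
    proof -
      have "\<forall>\<^sub>F r in at_left (1::real). r \<in> {0<..<1}" by (rule eventually_at_left_real) simp
      thus ?thesis
      proof eventually_elim
        case (elim r)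
        have "(\<Sum>n\<le>N. (cmod (tcoeff f n))\<^sup>2 * (r ^ n)\<^sup>2) \<le> (\<Sum>n. (cmod (tcoeff f n))\<^sup>2 * (r ^ n)\<^sup>2)"
          using Parseval_dilation[OF f, of r] elim by (intro sum_le_suminf) (auto simp: sums_iff)
        also have "\<dots> \<le> B" using Parseval_dilation[OF f, of r] B[of r] elim by (simp add: sums_iff)
        finally show ?case .
      qed
    qed
    ultimately show "(\<Sum>n\<le>N. (cmod (tcoeff f n))\<^sup>2) \<le> B"
      by (intro tendsto_upperbound[of _ _ "at_left 1"]) auto
  qed auto
next
  assume "f \<in> analytic_disc \<and> summable (\<lambda>n. (cmod (tcoeff f n))\<^sup>2)"
  hence f: "f \<in> analytic_disc" and s: "summable (\<lambda>n. (cmod (tcoeff f n))\<^sup>2)" by auto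
  have "(\<integral>\<zeta>. (cmod (f (of_real r * \<zeta>)))\<^sup>2 \<partial>circ) \<le> (\<Sum>n. (cmod (tcoeff f n))\<^sup>2)" if "r \<in> {0..<1}" for r
  proof -
    have P: "(\<lambda>n. (cmod (tcoeff f n))\<^sup>2 * (r ^ n)\<^sup>2) sums (\<integral>\<zeta>. (cmod (f (of_real r * \<zeta>)))\<^sup>2 \<partial>circ)"
      using Parseval_dilation[OF f, of r] that by simp
    have "(\<Sum>n. (cmod (tcoeff f n))\<^sup>2 * (r ^ n)\<^sup>2) \<le> (\<Sum>n. (cmod (tcoeff f n))\<^sup>2)"
      using P s that by (intro suminf_le) (auto simp: sums_iff mult_left_le power_le_one)
    thus ?thesis using P by (simp add: sums_iff)
  qed
  thus "f \<in> H2" using f unfolding H2_def bdd_above_def by blast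
qed

lemma H2_analytic: "f \<in> H2 \<Longrightarrow> f \<in> analytic_disc"
  and H2_summable: "f \<in> H2 \<Longrightarrow> summable (\<lambda>n. (cmod (tcoeff f n))\<^sup>2)"
  by (simp_all add: H2_iff)

lemma summable_sq_add:
  fixes c d :: "nat \<Rightarrow> complex"
  assumes "summable (\<lambda>n. (cmod (c n))\<^sup>2)" "summable (\<lambda>n. (cmod (d n))\<^sup>2)"
  shows "summable (\<lambda>n. (cmod (c n + d n))\<^sup>2)"
proof (rule summable_comparison_test')
  show "summable (\<lambda>n. 2 * (cmod (c n))\<^sup>2 + 2 * (cmod (d n))\<^sup>2)" using assms by (intro summable_add summable_mult)
  fix n
  have "(cmod (c n + d n))\<^sup>2 \<le> (cmod (c n) + cmod (d n))\<^sup>2"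
    by (simp add: norm_triangle_ineq power_mono)
  also have "\<dots> \<le> 2 * (cmod (c n))\<^sup>2 + 2 * (cmod (d n))\<^sup>2"
    using sum_squares_bound[of "cmod (c n)" "cmod (d n)"] by (simp add: power2_sum)
  finally show "norm ((cmod (c n + d n))\<^sup>2) \<le> 2 * (cmod (c n))\<^sup>2 + 2 * (cmod (d n))\<^sup>2" by simp
qed

lemma H2_zero: "(\<lambda>z. 0) \<in> H2"
  by (simp add: H2_iff analytic_disc_zero tcoeff_zero)

lemma H2_add: "f \<in> H2 \<Longrightarrow> g \<in> H2 \<Longrightarrow> (\<lambda>z. f z + g z) \<in> H2"
  by (simp add: H2_iff analytic_disc_add tcoeff_add summable_sq_add)

lemma H2_scale: "f \<in> H2 \<Longrightarrow> (\<lambda>z. c * f z) \<in> H2"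
  by (simp add: H2_iff analytic_disc_scale tcoeff_scale norm_mult power_mult_distrib summable_mult)

lemma H2_diff: "f \<in> H2 \<Longrightarrow> g \<in> H2 \<Longrightarrow> (\<lambda>z. f z - g z) \<in> H2"
  using H2_add[OF _ H2_scale[of g "-1"], of f] by simp

definition powser_disc :: "(nat \<Rightarrow> complex) \<Rightarrow> complex \<Rightarrow> complex" where
  "powser_disc c z = (if cmod z < 1 then \<Sum>n. c n * z ^ n else 0)"

lemma summable_sq_powser:
  fixes c :: "nat \<Rightarrow> complex"
  assumes "summable (\<lambda>n. (cmod (c n))\<^sup>2)" "cmod z < 1"
  shows "summable (\<lambda>n. c n * z ^ n)"
proof (rule summable_norm_cancel, rule summable_comparison_test')
  have "(cmod z)\<^sup>2 < 1" using assms(2) by (simp add: power_less_one_iff abs_square_less_1)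
  thus "summable (\<lambda>n. (cmod (c n))\<^sup>2 + ((cmod z)\<^sup>2) ^ n)"
    using assms(1) by (intro summable_add summable_geometric) auto
  fix n
  have "2 * (cmod (c n) * cmod z ^ n) \<le> (cmod (c n))\<^sup>2 + (cmod z ^ n)\<^sup>2"
    using sum_squares_bound[of "cmod (c n)" "cmod z ^ n"] by simp
  moreover have "0 \<le> cmod (c n) * cmod z ^ n" by simp
  ultimately have "cmod (c n) * cmod z ^ n \<le> (cmod (c n))\<^sup>2 + (cmod z ^ n)\<^sup>2" by linarith
  thus "norm (norm (c n * z ^ n)) \<le> (cmod (c n))\<^sup>2 + ((cmod z)\<^sup>2) ^ n"
    by (simp add: norm_mult norm_power power_mult[symmetric] mult.commute)
qed

lemma powser_disc_H2:
  assumes "summable (\<lambda>n. (cmod (c n))\<^sup>2)"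
  shows "powser_disc c \<in> H2" "tcoeff (powser_disc c) = c"
proof -
  have s: "(\<lambda>n. c n * z ^ n) sums powser_disc c z" if "cmod z < 1" for z
    using summable_sq_powser[OF assms that] that by (simp add: powser_disc_def summable_sums)
  show t: "tcoeff (powser_disc c) = c"
    by (rule tcoeff_unique[OF s]) (auto simp: powser_disc_def)
  show "powser_disc c \<in> H2"
    unfolding H2_iff t using assms by (auto intro!: analytic_discI_sums[OF s] simp: powser_disc_def)
qed

text \<open>A fixed sequence of radii increasing to 1; the shift by 2 keeps every term strictly
  between 0 and 1.\<close>

definition rad_seq :: "nat \<Rightarrow> real" where "rad_seq k = 1 - 1 / (real k + 2)"

lemma rad_seq: "0 < rad_seq k" "rad_seq k < 1"
  by (auto simp: rad_seq_def field_simps)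

lemma rad_seq_tendsto: "rad_seq \<longlonglongrightarrow> 1"
proof -
  have "(\<lambda>k. 1 / (real k + 2)) \<longlonglongrightarrow> 0"
    using LIMSEQ_ignore_initial_segment[OF lim_1_over_n[where 'a = real], of 2] by (simp add: add.commute)
  from tendsto_diff[OF tendsto_const this, of 1] show ?thesis by (simp add: rad_seq_def[abs_def])
qed

text \<open>\<open>maximal_powser\<close> asks for absolute summability up to the circle, so it is
  applied to the dilation of \<open>f\<close> by \<open>R k\<close>. Its exceptional set
  \<open>F k\<close> is exactly the one for radii below \<open>R k\<close>; these sets increase to
  \<open>E\<close> under a common bound.\<close>

lemma maximal_H2:
  assumes f: "f \<in> H2" and "\<kappa> > 0"
  defines "E \<equiv> {\<zeta> \<in> sphere 0 1. \<exists>r\<in>{0..<1}. cmod (f (of_real r * \<zeta>)) > \<kappa>}"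
  shows "E \<in> sets circ" "measure circ E \<le> 16 * (\<Sum>n. (cmod (tcoeff f n))\<^sup>2) / \<kappa>\<^sup>2"
proof -
  note fa = H2_analytic[OF f] and fs = H2_summable[OF f]
  define R where "R = rad_seq"
  note R = rad_seq[folded R_def] and Rlim = rad_seq_tendsto[folded R_def]
  have Rmono: "R k \<le> R l" if "k \<le> l" for k l
    using that by (auto simp: R_def rad_seq_def intro!: divide_left_mono)
  define c where "c = (\<lambda>k n. tcoeff f n * of_real (R k) ^ n)"
  have cs: "summable (\<lambda>n. cmod (c k n))" for k
    unfolding c_def using R[of k] by (intro tcoeff_abs_summable[OF fa]) simp
  define F where "F = (\<lambda>k. {\<zeta> \<in> sphere 0 1. \<exists>r\<in>{0..<1}. cmod (\<Sum>n. c k n * (of_real r * \<zeta>) ^ n) > \<kappa>})"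
  have F: "F k = {\<zeta> \<in> sphere 0 1. \<exists>r\<in>{0..<R k}. cmod (f (of_real r * \<zeta>)) > \<kappa>}" for k
  proof -
    have e: "(\<Sum>n. c k n * (of_real r * \<zeta>) ^ n) = f (of_real (R k * r) * \<zeta>)" if "0 \<le> r" "r < 1" "cmod \<zeta> = 1" for r \<zeta>
      unfolding c_def using that R[of k] by (subst dilation_powser[OF fa]) (auto simp: norm_mult mult_ac)
    show ?thesis
    proof (intro equalityI subsetI)
      fix \<zeta> assume "\<zeta> \<in> F k"
      then obtain r where "cmod \<zeta> = 1" "0 \<le> r" "r < 1" "cmod (f (of_real (R k * r) * \<zeta>)) > \<kappa>"
        by (auto simp: F_def e)
      thus "\<zeta> \<in> {\<zeta> \<in> sphere 0 1. \<exists>r\<in>{0..<R k}. cmod (f (of_real r * \<zeta>)) > \<kappa>}"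
        using R[of k] by (auto intro!: bexI[of _ "R k * r"])
    next
      fix \<zeta> assume "\<zeta> \<in> {\<zeta> \<in> sphere 0 1. \<exists>r\<in>{0..<R k}. cmod (f (of_real r * \<zeta>)) > \<kappa>}"
      then obtain r where r: "cmod \<zeta> = 1" "0 \<le> r" "r < R k" "cmod (f (of_real r * \<zeta>)) > \<kappa>" by auto
      show "\<zeta> \<in> F k"
      proof -
        have "R k * (r / R k) = r" using R[of k] by simp
        hence "cmod (\<Sum>n. c k n * (of_real (r / R k) * \<zeta>) ^ n) > \<kappa>"
          using e[of "r / R k" \<zeta>] R[of k] r by (simp del: of_real_divide of_real_mult)
        thus ?thesis unfolding F_def using R[of k] r
          by (intro CollectI conjI bexI[of _ "r / R k"]) auto
      qed
    qed
  qed
  have EF: "E = (\<Union>k. F k)"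
  proof (intro equalityI subsetI)
    fix \<zeta> assume "\<zeta> \<in> E"
    then obtain r where r: "cmod \<zeta> = 1" "0 \<le> r" "r < 1" "cmod (f (of_real r * \<zeta>)) > \<kappa>" by (auto simp: E_def)
    obtain k where "r < R k" using order_tendstoD(1)[OF Rlim r(3)] eventually_sequentially by (metis order_refl)
    thus "\<zeta> \<in> (\<Union>k. F k)" using r by (auto simp: F intro!: exI[of _ k] bexI[of _ r])
  next
    fix \<zeta> assume "\<zeta> \<in> (\<Union>k. F k)"
    thus "\<zeta> \<in> E" unfolding E_def using R by (auto simp: F) (meson atLeastLessThan_iff order_less_trans)
  qed
  have Fm: "F k \<in> sets circ" for k
    unfolding F_def by (rule maximal_powser(1)[OF cs \<open>\<kappa> > 0\<close>])
  show "E \<in> sets circ" unfolding EF using Fm by auto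
  have inc: "incseq F"
  proof (rule incseq_SucI)
    fix k show "F k \<le> F (Suc k)" using Rmono[of k "Suc k"] by (auto simp: F)
  qed
  have b: "measure circ (F k) \<le> 16 * (\<Sum>n. (cmod (tcoeff f n))\<^sup>2) / \<kappa>\<^sup>2" for k
  proof -
    have le: "(cmod (c k n))\<^sup>2 \<le> (cmod (tcoeff f n))\<^sup>2" for n
      unfolding c_def using R[of k] by (auto simp: norm_mult norm_power mult_left_le power_le_one intro!: power_mono)
    have "(\<Sum>n. (cmod (c k n))\<^sup>2) \<le> (\<Sum>n. (cmod (tcoeff f n))\<^sup>2)"
      by (intro suminf_le le fs summable_comparison_test'[OF fs, of 0]) (use le in auto)
    hence "16 * (\<Sum>n. (cmod (c k n))\<^sup>2) / \<kappa>\<^sup>2 \<le> 16 * (\<Sum>n. (cmod (tcoeff f n))\<^sup>2) / \<kappa>\<^sup>2"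
      by (intro divide_right_mono mult_left_mono) auto
    thus ?thesis using maximal_powser(2)[OF cs[of k] \<open>\<kappa> > 0\<close>] unfolding F_def by linarith
  qed
  have "(\<lambda>k. measure circ (F k)) \<longlonglongrightarrow> measure circ E"
    unfolding EF by (rule circ.finite_Lim_measure_incseq) (use Fm inc in auto)
  thus "measure circ E \<le> 16 * (\<Sum>n. (cmod (tcoeff f n))\<^sup>2) / \<kappa>\<^sup>2"
    by (rule LIMSEQ_le_const2) (use b in auto)
qed

definition tail :: "(complex \<Rightarrow> complex) \<Rightarrow> nat \<Rightarrow> complex \<Rightarrow> complex" where
  "tail f N z = (if cmod z < 1 then f z - (\<Sum>n<N. tcoeff f n * z ^ n) else 0)"

lemma tail_H2:
  assumes "f \<in> H2"
  shows "tail f N \<in> H2" "tcoeff (tail f N) = (\<lambda>n. if n < N then 0 else tcoeff f n)"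
proof -
  let ?c = "\<lambda>n. if n < N then 0 else tcoeff f n"
  have s: "(\<lambda>n. ?c n * z ^ n) sums tail f N z" if "cmod z < 1" for z
  proof -
    have "(\<lambda>n. if n \<in> {..<N} then tcoeff f n * z ^ n else 0) sums (\<Sum>n\<in>{..<N}. tcoeff f n * z ^ n)"
      by (rule sums_If_finite_set) simp
    from sums_diff[OF tcoeff_sums[OF H2_analytic[OF assms] that] this]
    have "(\<lambda>n. tcoeff f n * z ^ n - (if n \<in> {..<N} then tcoeff f n * z ^ n else 0)) sums tail f N z"
      using that by (simp add: tail_def)
    moreover have "(\<lambda>n. tcoeff f n * z ^ n - (if n \<in> {..<N} then tcoeff f n * z ^ n else 0)) = (\<lambda>n. ?c n * z ^ n)"
      by auto
    ultimately show ?thesis by simp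
  qed
  show t: "tcoeff (tail f N) = ?c"
    by (rule tcoeff_unique[OF s]) (auto simp: tail_def)
  have "summable (\<lambda>n. (cmod (?c n))\<^sup>2)"
    by (rule summable_comparison_test'[OF H2_summable[OF assms], of 0]) auto
  thus "tail f N \<in> H2"
    unfolding H2_iff t by (auto intro!: analytic_discI_sums[OF s] simp: tail_def)
qed

lemma tail_norm_tendsto:
  assumes "f \<in> H2"
  shows "(\<lambda>N. \<Sum>n. (cmod (tcoeff (tail f N) n))\<^sup>2) \<longlonglongrightarrow> 0"
proof -
  let ?a = "\<lambda>n. (cmod (tcoeff f n))\<^sup>2"
  have "(\<Sum>n. (cmod (tcoeff (tail f N) n))\<^sup>2) = suminf ?a - (\<Sum>n<N. ?a n)" for N
  proof -
    have "(\<lambda>n. if n \<in> {..<N} then ?a n else 0) sums (\<Sum>n\<in>{..<N}. ?a n)"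
      by (rule sums_If_finite_set) simp
    from sums_diff[OF summable_sums[OF H2_summable[OF assms]] this]
    have "(\<lambda>n. ?a n - (if n \<in> {..<N} then ?a n else 0)) sums (suminf ?a - (\<Sum>n<N. ?a n))" .
    moreover have "(\<lambda>n. ?a n - (if n \<in> {..<N} then ?a n else 0)) = (\<lambda>n. (cmod (tcoeff (tail f N) n))\<^sup>2)"
      by (auto simp: tail_H2[OF assms])
    ultimately show ?thesis by (simp add: sums_iff)
  qed
  moreover have "(\<lambda>N. suminf ?a - (\<Sum>n<N. ?a n)) \<longlonglongrightarrow> suminf ?a - suminf ?a"
    by (intro tendsto_intros summable_LIMSEQ H2_summable assms)
  ultimately show ?thesis by simp
qed

subsection \<open>Radial boundary values\<close>

definition radial_limit :: "(complex \<Rightarrow> complex) \<Rightarrow> complex \<Rightarrow> complex \<Rightarrow> bool" where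
  "radial_limit f \<zeta> l \<longleftrightarrow> ((\<lambda>r. f (of_real r * \<zeta>)) \<longlongrightarrow> l) (at_left (1::real))"

lemma bdry_eqI: "radial_limit f \<zeta> l \<Longrightarrow> bdry f \<zeta> = l"
  unfolding radial_limit_def bdry_def by (rule tendsto_Lim) auto

lemma at_left_1_iff:
  "(\<forall>\<^sub>F r in at_left (1::real). P r) \<longleftrightarrow> (\<exists>d<1. \<forall>r. d < r \<and> r < 1 \<longrightarrow> P r)"
  using eventually_at_left[of 0 "1::real" P] by auto

lemma rad_seq_at_left: "filterlim rad_seq (at_left 1) sequentially"
  using rad_seq_tendsto rad_seq less_imp_neq[OF rad_seq(2)]
  by (auto simp: filterlim_at intro!: always_eventually)

lemma rad_seq_gt: "d < 1 \<Longrightarrow> \<exists>k. d < rad_seq k"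
  using order_tendstoD(1)[OF rad_seq_tendsto, of d] by (auto simp: eventually_sequentially)

lemma radial_limit_seq: "radial_limit f \<zeta> l \<Longrightarrow> (\<lambda>k. f (of_real (rad_seq k) * \<zeta>)) \<longlonglongrightarrow> l"
  unfolding radial_limit_def by (rule filterlim_compose[OF _ rad_seq_at_left])

text \<open>The Cauchy criterion with countably many tolerances and thresholds, a first step towards
  measurability of the set of convergence. The non-strict inequality is chosen because it survives
  passage from rational to real radii.\<close>

lemma radial_limit_iff_Cauchy:
  "(\<exists>l. radial_limit f \<zeta> l) \<longleftrightarrow>
    (\<forall>j. \<exists>k. \<forall>r s. rad_seq k < r \<and> r < 1 \<and> rad_seq k < s \<and> s < 1 \<longrightarrow>
        dist (f (of_real r * \<zeta>)) (f (of_real s * \<zeta>)) \<le> 1 / real (Suc j))"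
  (is "_ \<longleftrightarrow> ?C")
proof
  assume "\<exists>l. radial_limit f \<zeta> l"
  then obtain l where l: "radial_limit f \<zeta> l" ..
  show ?C
  proof
    fix j
    have "0 < 1 / real (Suc j) / 2" by simp
    from tendstoD[OF l[unfolded radial_limit_def] this]
    obtain d where d: "d < 1" "\<And>r. d < r \<Longrightarrow> r < 1 \<Longrightarrow> dist (f (of_real r * \<zeta>)) l < 1 / real (Suc j) / 2"
      unfolding at_left_1_iff by blast
    obtain k where k: "d < rad_seq k" using rad_seq_gt[OF d(1)] ..
    have "dist (f (of_real r * \<zeta>)) (f (of_real s * \<zeta>)) \<le> 1 / real (Suc j)"
      if "rad_seq k < r \<and> r < 1 \<and> rad_seq k < s \<and> s < 1" for r s
      using d(2)[of r] d(2)[of s] k that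
        dist_triangle2[of "f (of_real r * \<zeta>)" "f (of_real s * \<zeta>)" l] by linarith
    thus "\<exists>k. \<forall>r s. rad_seq k < r \<and> r < 1 \<and> rad_seq k < s \<and> s < 1 \<longrightarrow>
        dist (f (of_real r * \<zeta>)) (f (of_real s * \<zeta>)) \<le> 1 / real (Suc j)" by blast
  qed
next
  assume C: ?C
  have small: "\<exists>j. 1 / real (Suc j) < e" if "e > 0" for e :: real
    using reals_Archimedean[OF that] by (simp add: inverse_eq_divide)
  have ev: "\<forall>\<^sub>F n in sequentially. rad_seq k < rad_seq n" for k
    by (rule order_tendstoD(1)[OF rad_seq_tendsto rad_seq(2)])
  have "Cauchy (\<lambda>n. f (of_real (rad_seq n) * \<zeta>))"
  proof (rule metric_CauchyI)
    fix e :: real assume "e > 0"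
    then obtain j where j: "1 / real (Suc j) < e" using small by blast
    obtain k where k: "\<And>r s. rad_seq k < r \<and> r < 1 \<and> rad_seq k < s \<and> s < 1 \<Longrightarrow>
        dist (f (of_real r * \<zeta>)) (f (of_real s * \<zeta>)) \<le> 1 / real (Suc j)" using C by meson
    obtain M where "\<And>n. n \<ge> M \<Longrightarrow> rad_seq k < rad_seq n" using ev[of k] eventually_sequentially by auto
    hence "dist (f (of_real (rad_seq m) * \<zeta>)) (f (of_real (rad_seq n) * \<zeta>)) < e" if "m \<ge> M" "n \<ge> M" for m n
      using k[of "rad_seq m" "rad_seq n"] that rad_seq j by fastforce
    thus "\<exists>M. \<forall>m\<ge>M. \<forall>n\<ge>M. dist (f (of_real (rad_seq m) * \<zeta>)) (f (of_real (rad_seq n) * \<zeta>)) < e" by blast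
  qed
  then obtain l where l: "(\<lambda>n. f (of_real (rad_seq n) * \<zeta>)) \<longlonglongrightarrow> l"
    using Cauchy_convergent convergent_def by blast
  have "radial_limit f \<zeta> l" unfolding radial_limit_def
  proof (rule tendstoI)
    fix e :: real assume "e > 0"
    then obtain j where j: "1 / real (Suc j) < e" using small by blast
    obtain k where k: "\<And>r s. rad_seq k < r \<and> r < 1 \<and> rad_seq k < s \<and> s < 1 \<Longrightarrow>
        dist (f (of_real r * \<zeta>)) (f (of_real s * \<zeta>)) \<le> 1 / real (Suc j)" using C by meson
    have "dist (f (of_real r * \<zeta>)) l < e" if "rad_seq k < r" "r < 1" for r
    proof -
      have "(\<lambda>n. dist (f (of_real r * \<zeta>)) (f (of_real (rad_seq n) * \<zeta>))) \<longlonglongrightarrow> dist (f (of_real r * \<zeta>)) l"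
        by (intro tendsto_intros l)
      moreover have "\<forall>\<^sub>F n in sequentially. dist (f (of_real r * \<zeta>)) (f (of_real (rad_seq n) * \<zeta>)) \<le> 1 / real (Suc j)"
        using ev[of k] by eventually_elim (use k that rad_seq in blast)
      ultimately have "dist (f (of_real r * \<zeta>)) l \<le> 1 / real (Suc j)"
        by (intro tendsto_upperbound[of _ _ sequentially]) auto
      thus ?thesis using j by linarith
    qed
    thus "\<forall>\<^sub>F r in at_left 1. dist (f (of_real r * \<zeta>)) l < e"
      unfolding at_left_1_iff using rad_seq(2)[of k] by blast
  qed
  thus "\<exists>l. radial_limit f \<zeta> l" ..
qed

lemma continuous_radial:
  assumes "f \<in> analytic_disc" "cmod \<zeta> = 1"
  shows "continuous_on {-1<..<1} (\<lambda>r. f (of_real r * \<zeta>))"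
  by (rule continuous_on_compose2[OF analytic_disc_cont[OF assms(1)]])
    (use assms in \<open>auto intro!: continuous_intros simp: norm_mult\<close>)

lemma measurable_dilation [measurable]:
  assumes "f \<in> analytic_disc"
  shows "(\<lambda>\<zeta>. f (of_real r * \<zeta>)) \<in> borel_measurable circ"
proof (cases "\<bar>r\<bar> < 1")
  case True
  show ?thesis
    by (rule borel_measurable_circ_continuous, rule continuous_on_compose2[OF analytic_disc_cont[OF assms]])
      (use True in \<open>auto intro!: continuous_intros simp: norm_mult\<close>)
next
  case False
  have "(\<lambda>\<zeta>. f (of_real r * \<zeta>)) \<in> borel_measurable circ \<longleftrightarrow> (\<lambda>\<zeta>. 0::complex) \<in> borel_measurable circ"
    by (rule measurable_cong) (use False analytic_disc_off[OF assms] in \<open>auto simp: norm_mult\<close>)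
  thus ?thesis by simp
qed

lemma closure_rats_Ioo: 
  assumes "continuous_on {a<..<b::real} g" "\<And>q. q \<in> \<rat> \<Longrightarrow> a < q \<Longrightarrow> q < b \<Longrightarrow> g q \<le> (c::real)" "a < r" "r < b"
  shows "g r \<le> c"
proof (rule ccontr)
  assume "\<not> g r \<le> c"
  hence "g r > c" by simp
  have "isCont g r" using assms by (simp add: continuous_on_eq_continuous_at)
  hence "\<forall>\<^sub>F s in at r. c < g s" using \<open>g r > c\<close> unfolding isCont_def by (rule order_tendstoD)
  then obtain d where d: "d > 0" "\<And>s. s \<noteq> r \<Longrightarrow> dist s r < d \<Longrightarrow> c < g s"
    unfolding eventually_at by auto
  obtain q where q: "q \<in> \<rat>" "r < q" "q < min b (r + d)"
    using Rats_dense_in_real[of r "min b (r + d)"] assms d by auto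
  hence "g q \<le> c" using assms by auto
  moreover have "c < g q" using q d(2)[of q] by (auto simp: dist_real_def)
  ultimately show False by simp
qed

text \<open>Continuity along the radius, used in one variable at a time, extends the inequality from
  rational to all radii. Now all quantifiers range over countable sets.\<close>

lemma radial_limit_rational:
  assumes "f \<in> analytic_disc" "cmod \<zeta> = 1"
  shows "(\<exists>l. radial_limit f \<zeta> l) \<longleftrightarrow>
    (\<forall>j. \<exists>k. \<forall>p q :: rat. rad_seq k < of_rat p \<and> of_rat p < (1::real) \<and> rad_seq k < of_rat q \<and> of_rat q < (1::real) \<longrightarrow>
        dist (f (of_real (of_rat p) * \<zeta>)) (f (of_real (of_rat q) * \<zeta>)) \<le> 1 / real (Suc j))"
  unfolding radial_limit_iff_Cauchy
proof (intro all_cong1 ex_cong1 iffI allI impI)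
  fix j k r s
  assume H: "\<forall>p q :: rat. rad_seq k < of_rat p \<and> of_rat p < (1::real) \<and> rad_seq k < of_rat q \<and> of_rat q < (1::real) \<longrightarrow>
        dist (f (of_real (of_rat p) * \<zeta>)) (f (of_real (of_rat q) * \<zeta>)) \<le> 1 / real (Suc j)"
    and rs: "rad_seq k < r \<and> r < 1 \<and> rad_seq k < s \<and> s < 1"
  have c: "continuous_on {rad_seq k<..<1} (\<lambda>r. f (of_real r * \<zeta>))"
    by (rule continuous_on_subset[OF continuous_radial[OF assms]]) (use rad_seq(1)[of k] in auto)
  have 1: "dist (f (of_real r * \<zeta>)) (f (of_real q * \<zeta>)) \<le> 1 / real (Suc j)"
    if "q \<in> \<rat>" "rad_seq k < q" "q < 1" for q
  proof (rule closure_rats_Ioo[of "rad_seq k" 1 "\<lambda>r. dist (f (of_real r * \<zeta>)) (f (of_real q * \<zeta>))"])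
    show "continuous_on {rad_seq k<..<1} (\<lambda>r. dist (f (of_real r * \<zeta>)) (f (of_real q * \<zeta>)))"
      by (intro continuous_intros c)
    fix p :: real assume "p \<in> \<rat>" "rad_seq k < p" "p < 1"
    thus "dist (f (of_real p * \<zeta>)) (f (of_real q * \<zeta>)) \<le> 1 / real (Suc j)"
      using H that unfolding Rats_def by blast
  qed (use rs in auto)
  show "dist (f (of_real r * \<zeta>)) (f (of_real s * \<zeta>)) \<le> 1 / real (Suc j)"
    by (rule closure_rats_Ioo[of "rad_seq k" 1 "\<lambda>s. dist (f (of_real r * \<zeta>)) (f (of_real s * \<zeta>))"])
      (use 1 rs in \<open>auto intro!: continuous_intros c\<close>)
qed blast

lemma bdry_measurable [measurable]:
  assumes "f \<in> analytic_disc"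
  shows "bdry f \<in> borel_measurable circ"
proof -
  note [measurable] = measurable_dilation[OF assms]
  define C where "C = {\<zeta> \<in> space circ. \<forall>j. \<exists>k. \<forall>p q :: rat. rad_seq k < of_rat p \<and> of_rat p < (1::real) \<and> rad_seq k < of_rat q \<and> of_rat q < (1::real) \<longrightarrow>
        dist (f (of_real (of_rat p) * \<zeta>)) (f (of_real (of_rat q) * \<zeta>)) \<le> 1 / real (Suc j)}"
  have [measurable]: "C \<in> sets circ" unfolding C_def by measurable
  \<comment> \<open>Where there is no radial limit, \<open>Lim\<close> is the \<open>THE\<close> of
    the empty predicate. This is one fixed value, so \<open>bdry f\<close> is measurable there
    too.\<close>
  define l0 :: complex where "l0 = (THE l. False)"
  have "bdry f \<zeta> = (if \<zeta> \<in> C then lim (\<lambda>k. f (of_real (rad_seq k) * \<zeta>)) else l0)" if "\<zeta> \<in> space circ" for \<zeta>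
  proof (cases "\<zeta> \<in> C")
    case True
    then obtain l where l: "radial_limit f \<zeta> l"
      using radial_limit_rational[OF assms, of \<zeta>] by (auto simp: C_def)
    thus ?thesis using True bdry_eqI[OF l] limI[OF radial_limit_seq[OF l]] by simp
  next
    case False
    hence "\<not> (\<exists>l. radial_limit f \<zeta> l)"
      using radial_limit_rational[OF assms, of \<zeta>] that by (simp add: C_def)
    hence "(\<lambda>l. ((\<lambda>r. f (of_real r * \<zeta>)) \<longlongrightarrow> l) (at_left (1::real))) = (\<lambda>l. False)"
      by (auto simp: radial_limit_def)
    thus ?thesis using False by (simp add: bdry_def Topological_Spaces.Lim_def l0_def)
  qed
  hence "bdry f \<in> borel_measurable circ \<longleftrightarrow>
    (\<lambda>\<zeta>. if \<zeta> \<in> C then lim (\<lambda>k. f (of_real (rad_seq k) * \<zeta>)) else l0) \<in> borel_measurable circ"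
    by (rule measurable_cong)
  also have "\<dots>" by measurable
  finally show ?thesis .
qed

text \<open>\<open>f\<close> is a Taylor polynomial, which extends continuously, plus a tail. By the
  maximal inequality the tail is uniformly small along the radius off a set whose measure tends to 0
  with the norm of the tail, so almost every point is good for some \<open>N\<close>.\<close>

theorem Fatou_H2:
  assumes f: "f \<in> H2"
  shows "AE \<zeta> in circ. radial_limit f \<zeta> (bdry f \<zeta>)"
proof -
  note fa = H2_analytic[OF f]
  \<comment> \<open>The quarter: comparing two radii involves a tail error and a polynomial error at
    each of them, four in all.\<close>
  define E where "E = (\<lambda>j N. {\<zeta> \<in> sphere 0 1. \<exists>r\<in>{0..<1}. cmod (tail f N (of_real r * \<zeta>)) > 1 / (4 * real (Suc j))})"
  have E: "E j N \<in> sets circ" "measure circ (E j N) \<le> 16 * (\<Sum>n. (cmod (tcoeff (tail f N) n))\<^sup>2) / (1 / (4 * real (Suc j)))\<^sup>2" for j N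
    unfolding E_def by (rule maximal_H2[OF tail_H2(1)[OF f]]; simp)+
  have nullE: "(\<Inter>N. E j N) \<in> null_sets circ" for j
  proof -
    have I: "(\<Inter>N. E j N) \<in> sets circ" using E(1) by auto
    have b1: "measure circ (\<Inter>N. E j N) \<le> 16 * (\<Sum>n. (cmod (tcoeff (tail f N) n))\<^sup>2) / (1 / (4 * real (Suc j)))\<^sup>2" for N
      using circ.finite_measure_mono[OF _ E(1)[of j N], of "\<Inter>N. E j N"] E(2)[of j N] by fastforce
    have b2: "(\<lambda>N. 16 * (\<Sum>n. (cmod (tcoeff (tail f N) n))\<^sup>2) / (1 / (4 * real (Suc j)))\<^sup>2) \<longlonglongrightarrow> 16 * 0 / (1 / (4 * real (Suc j)))\<^sup>2"
      by (intro tendsto_intros tail_norm_tendsto[OF f]) simp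
    have "measure circ (\<Inter>N. E j N) \<le> 16 * 0 / (1 / (4 * real (Suc j)))\<^sup>2"
      by (rule LIMSEQ_le_const[OF b2]) (use b1 in blast)
    hence "measure circ (\<Inter>N. E j N) = 0" by (simp add: measure_le_0_iff)
    thus ?thesis using I by (simp add: null_sets_def circ.emeasure_eq_measure)
  qed
  have "AE \<zeta> in circ. \<forall>j. \<zeta> \<notin> (\<Inter>N. E j N)"
    unfolding AE_all_countable using nullE AE_not_in by blast
  thus ?thesis
  proof (rule AE_mp, intro AE_circI impI)
    fix \<zeta> assume z: "cmod \<zeta> = 1" and nE: "\<forall>j. \<zeta> \<notin> (\<Inter>N. E j N)"
    have "\<exists>l. radial_limit f \<zeta> l"
      unfolding radial_limit_iff_Cauchy
    proof
      fix j
      obtain N where "\<zeta> \<notin> E j N" using nE by blast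
      hence t: "cmod (tail f N (of_real r * \<zeta>)) \<le> 1 / (4 * real (Suc j))" if "0 \<le> r" "r < 1" for r
        using z that by (force simp: E_def)
      define S where "S = (\<lambda>r::real. \<Sum>n<N. tcoeff f n * (of_real r * \<zeta>) ^ n)"
      have "(S \<longlongrightarrow> S 1) (at_left 1)" unfolding S_def by (intro tendsto_intros)
      from tendstoD[OF this, of "1 / (4 * real (Suc j))"]
      obtain d where d: "d < 1" "\<And>r. d < r \<Longrightarrow> r < 1 \<Longrightarrow> dist (S r) (S 1) < 1 / (4 * real (Suc j))"
        unfolding at_left_1_iff by auto
      obtain k where k: "d < rad_seq k" using rad_seq_gt[OF d(1)] ..
      have "dist (f (of_real r * \<zeta>)) (f (of_real s * \<zeta>)) \<le> 1 / real (Suc j)"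
        if "rad_seq k < r \<and> r < 1 \<and> rad_seq k < s \<and> s < 1" for r s
      proof -
        have fr: "dist (f (of_real r * \<zeta>)) (S 1) \<le> 2 * (1 / (4 * real (Suc j)))" if "rad_seq k < r" "r < 1" for r
        proof -
          have r: "0 \<le> r" using that rad_seq(1)[of k] by linarith
          hence "f (of_real r * \<zeta>) = tail f N (of_real r * \<zeta>) + S r"
            using that z by (simp add: tail_def S_def norm_mult)
          hence "dist (f (of_real r * \<zeta>)) (S 1) \<le> cmod (tail f N (of_real r * \<zeta>)) + dist (S r) (S 1)"
            using norm_triangle_ineq[of "tail f N (of_real r * \<zeta>)" "S r - S 1"] by (simp add: dist_norm add_diff_eq)
          thus ?thesis using t[OF r] d(2)[of r] k that by linarith
        qed
        have "dist (f (of_real r * \<zeta>)) (f (of_real s * \<zeta>)) \<le> 4 * (1 / (4 * real (Suc j)))"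
          using fr[of r] fr[of s] that dist_triangle2[of "f (of_real r * \<zeta>)" "f (of_real s * \<zeta>)" "S 1"] by linarith
        thus ?thesis by (simp add: field_simps)
      qed
      thus "\<exists>k. \<forall>r s. rad_seq k < r \<and> r < 1 \<and> rad_seq k < s \<and> s < 1 \<longrightarrow>
        dist (f (of_real r * \<zeta>)) (f (of_real s * \<zeta>)) \<le> 1 / real (Suc j)" by blast
    qed
    thus "radial_limit f \<zeta> (bdry f \<zeta>)" using bdry_eqI by blast
  qed
qed

section \<open>Boundary values in L^2: Fourier coefficients, Parseval's identity and the Poisson
  formula\<close>

text \<open>Fatou's lemma along \<open>rad_seq\<close> gives only an inequality. Applied to tails it
  yields \<open>integral_bdry_series\<close>, from which the equality \<open>Parseval_H2\<close>
  follows.\<close>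

lemma bdry_L2_bound:
  assumes f: "f \<in> H2"
  shows "bdry f \<in> L2" "(L2norm (bdry f))\<^sup>2 \<le> (\<Sum>n. (cmod (tcoeff f n))\<^sup>2)"
proof -
  note fa = H2_analytic[OF f]
  note [measurable] = bdry_measurable[OF fa] measurable_dilation[OF fa]
  define S where "S = (\<Sum>n. (cmod (tcoeff f n))\<^sup>2)"
  have S0: "S \<ge> 0" unfolding S_def by (intro suminf_nonneg H2_summable f) auto
  have b: "(\<integral>\<^sup>+\<zeta>. ennreal ((cmod (f (of_real (rad_seq k) * \<zeta>)))\<^sup>2) \<partial>circ) \<le> ennreal S" for k
  proof -
    have c: "continuous_on (sphere 0 1) (\<lambda>\<zeta>. f (of_real (rad_seq k) * \<zeta>))"
      by (rule continuous_on_compose2[OF analytic_disc_cont[OF fa]])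
        (use rad_seq[of k] in \<open>auto intro!: continuous_intros simp: norm_mult\<close>)
    have e: "(\<integral>\<^sup>+\<zeta>. ennreal ((cmod (f (of_real (rad_seq k) * \<zeta>)))\<^sup>2) \<partial>circ) = ennreal (\<integral>\<zeta>. (cmod (f (of_real (rad_seq k) * \<zeta>)))\<^sup>2 \<partial>circ)"
      by (intro nn_integral_eq_integral integrable_circ_continuous continuous_intros c) auto
    have P: "(\<lambda>n. (cmod (tcoeff f n))\<^sup>2 * (rad_seq k ^ n)\<^sup>2) sums (\<integral>\<zeta>. (cmod (f (of_real (rad_seq k) * \<zeta>)))\<^sup>2 \<partial>circ)"
      using rad_seq[of k] by (intro Parseval_dilation[OF fa]) auto
    have "(\<Sum>n. (cmod (tcoeff f n))\<^sup>2 * (rad_seq k ^ n)\<^sup>2) \<le> S"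
      unfolding S_def
    proof (rule suminf_le)
      show "(cmod (tcoeff f n))\<^sup>2 * (rad_seq k ^ n)\<^sup>2 \<le> (cmod (tcoeff f n))\<^sup>2" for n
        using rad_seq[of k] by (intro mult_left_le power_le_one) auto
    qed (use P H2_summable[OF f] in \<open>auto simp: sums_iff\<close>)
    hence "ennreal (\<integral>\<zeta>. (cmod (f (of_real (rad_seq k) * \<zeta>)))\<^sup>2 \<partial>circ) \<le> ennreal S"
      using P by (intro ennreal_leI) (simp add: sums_iff)
    thus ?thesis by (simp only: e)
  qed
  have "(\<integral>\<^sup>+\<zeta>. ennreal ((cmod (bdry f \<zeta>))\<^sup>2) \<partial>circ) = (\<integral>\<^sup>+\<zeta>. liminf (\<lambda>k. ennreal ((cmod (f (of_real (rad_seq k) * \<zeta>)))\<^sup>2)) \<partial>circ)"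
  proof (rule nn_integral_cong_AE)
    show "AE \<zeta> in circ. ennreal ((cmod (bdry f \<zeta>))\<^sup>2) = liminf (\<lambda>k. ennreal ((cmod (f (of_real (rad_seq k) * \<zeta>)))\<^sup>2))"
      using Fatou_H2[OF f]
    proof eventually_elim
      case (elim \<zeta>)
      have "(\<lambda>k. ennreal ((cmod (f (of_real (rad_seq k) * \<zeta>)))\<^sup>2)) \<longlonglongrightarrow> ennreal ((cmod (bdry f \<zeta>))\<^sup>2)"
        by (intro tendsto_ennrealI tendsto_intros radial_limit_seq elim)
      thus ?case using lim_imp_Liminf[OF sequentially_bot] by metis
    qed
  qed
  also have "\<dots> \<le> liminf (\<lambda>k. (\<integral>\<^sup>+\<zeta>. ennreal ((cmod (f (of_real (rad_seq k) * \<zeta>)))\<^sup>2) \<partial>circ))"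
    by (rule nn_integral_liminf) measurable
  also have "\<dots> \<le> liminf (\<lambda>k. ennreal S)"
    by (intro Liminf_mono always_eventually allI b)
  also have "\<dots> = ennreal S" by (simp add: Liminf_const)
  finally have le: "(\<integral>\<^sup>+\<zeta>. ennreal ((cmod (bdry f \<zeta>))\<^sup>2) \<partial>circ) \<le> ennreal S" .
  have int: "integrable circ (\<lambda>\<zeta>. (cmod (bdry f \<zeta>))\<^sup>2)"
  proof (rule integrableI_bounded)
    show "(\<integral>\<^sup>+ x. ennreal (norm ((cmod (bdry f x))\<^sup>2)) \<partial>circ) < \<infinity>"
      using le_less_trans[OF le, of \<infinity>] by simp
  qed measurable
  thus L2: "bdry f \<in> L2" unfolding L2_def by simp
  have "ennreal ((L2norm (bdry f))\<^sup>2) \<le> ennreal S"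
    using le unfolding L2norm_sq by (subst (asm) nn_integral_eq_integral[OF int]) auto
  thus "(L2norm (bdry f))\<^sup>2 \<le> (\<Sum>n. (cmod (tcoeff f n))\<^sup>2)" using S0 by (simp add: S_def)
qed

lemma bdry_L2: "f \<in> H2 \<Longrightarrow> bdry f \<in> L2"
  by (rule bdry_L2_bound(1))

lemma bdry_tail:
  assumes f: "f \<in> H2"
  shows "AE \<zeta> in circ. bdry (tail f N) \<zeta> = bdry f \<zeta> - (\<Sum>n<N. tcoeff f n * \<zeta> ^ n)"
  using Fatou_H2[OF f]
proof (rule AE_mp, intro AE_circI impI)
  fix \<zeta> assume z: "cmod \<zeta> = 1" and l: "radial_limit f \<zeta> (bdry f \<zeta>)"
  have "((\<lambda>r. f (of_real r * \<zeta>) - (\<Sum>n<N. tcoeff f n * (of_real r * \<zeta>) ^ n)) \<longlongrightarrow>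
      bdry f \<zeta> - (\<Sum>n<N. tcoeff f n * (of_real 1 * \<zeta>) ^ n)) (at_left (1::real))"
    by (intro tendsto_intros l[unfolded radial_limit_def])
  moreover have "\<forall>\<^sub>F r in at_left (1::real). f (of_real r * \<zeta>) - (\<Sum>n<N. tcoeff f n * (of_real r * \<zeta>) ^ n) = tail f N (of_real r * \<zeta>)"
    unfolding at_left_1_iff by (rule exI[of _ 0]) (auto simp: tail_def norm_mult z)
  ultimately have "radial_limit (tail f N) \<zeta> (bdry f \<zeta> - (\<Sum>n<N. tcoeff f n * \<zeta> ^ n))"
    unfolding radial_limit_def by (simp add: tendsto_cong)
  thus "bdry (tail f N) \<zeta> = bdry f \<zeta> - (\<Sum>n<N. tcoeff f n * \<zeta> ^ n)" by (rule bdry_eqI)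
qed

text \<open>The error after \<open>N\<close> terms is the integral of \<open>bdry (tail f N)\<close>
  against \<open>g\<close>, which Cauchy-Schwarz and \<open>bdry_L2_bound\<close> send to 0. Fourier
  coefficients, inner products, the Poisson formula and the projection all come from special choices
  of \<open>g\<close>.\<close>

lemma integral_bdry_series:
  assumes f: "f \<in> H2" and g: "g \<in> L2"
  shows "(\<lambda>n. tcoeff f n * (\<integral>\<zeta>. \<zeta> ^ n * g \<zeta> \<partial>circ)) sums (\<integral>\<zeta>. bdry f \<zeta> * g \<zeta> \<partial>circ)"
proof -
  have fl: "bdry f \<in> L2" using f by (rule bdry_L2)
  have pl: "(\<lambda>\<zeta>. \<zeta> ^ n) \<in> L2" for n by (intro L2_continuous continuous_intros)
  have ip: "integrable circ (\<lambda>\<zeta>. \<zeta> ^ n * g \<zeta>)" for n by (rule L2_product_integrable(2)[OF pl g])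
  have d: "(\<integral>\<zeta>. bdry f \<zeta> * g \<zeta> \<partial>circ) - (\<Sum>n<N. tcoeff f n * (\<integral>\<zeta>. \<zeta> ^ n * g \<zeta> \<partial>circ))
      = (\<integral>\<zeta>. bdry (tail f N) \<zeta> * g \<zeta> \<partial>circ)" for N
  proof -
    have [measurable]: "bdry f \<in> borel_measurable circ" "g \<in> borel_measurable circ" "bdry (tail f N) \<in> borel_measurable circ"
      using fl g bdry_L2[OF tail_H2(1)[OF f]] by (auto intro: L2_measurable)
    have "(\<Sum>n<N. tcoeff f n * (\<integral>\<zeta>. \<zeta> ^ n * g \<zeta> \<partial>circ)) = (\<integral>\<zeta>. (\<Sum>n<N. tcoeff f n * (\<zeta> ^ n * g \<zeta>)) \<partial>circ)"
      using ip by (subst Bochner_Integration.integral_sum) auto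
    also have "(\<integral>\<zeta>. bdry f \<zeta> * g \<zeta> \<partial>circ) - \<dots> = (\<integral>\<zeta>. bdry f \<zeta> * g \<zeta> - (\<Sum>n<N. tcoeff f n * (\<zeta> ^ n * g \<zeta>)) \<partial>circ)"
      using ip L2_product_integrable(2)[OF fl g] by (intro Bochner_Integration.integral_diff[symmetric]) auto
    also have "\<dots> = (\<integral>\<zeta>. bdry (tail f N) \<zeta> * g \<zeta> \<partial>circ)"
    proof (rule integral_cong_AE)
      show "AE \<zeta> in circ. bdry f \<zeta> * g \<zeta> - (\<Sum>n<N. tcoeff f n * (\<zeta> ^ n * g \<zeta>)) = bdry (tail f N) \<zeta> * g \<zeta>"
        using bdry_tail[OF f, of N] by eventually_elim (simp add: left_diff_distrib sum_distrib_right mult.assoc)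
    qed measurable
    finally show ?thesis .
  qed
  have "(\<lambda>N. (\<integral>\<zeta>. bdry f \<zeta> * g \<zeta> \<partial>circ) - (\<Sum>n<N. tcoeff f n * (\<integral>\<zeta>. \<zeta> ^ n * g \<zeta> \<partial>circ))) \<longlonglongrightarrow> 0"
  proof (rule tendsto_norm_zero_cancel, rule tendsto_sandwich[OF _ _ tendsto_const])
    show "\<forall>\<^sub>F N in sequentially. norm ((\<integral>\<zeta>. bdry f \<zeta> * g \<zeta> \<partial>circ) - (\<Sum>n<N. tcoeff f n * (\<integral>\<zeta>. \<zeta> ^ n * g \<zeta> \<partial>circ)))
        \<le> sqrt (\<Sum>n. (cmod (tcoeff (tail f N) n))\<^sup>2) * L2norm g"
    proof (rule always_eventually, rule allI)
      fix N
      have t: "tail f N \<in> H2" by (rule tail_H2(1)[OF f])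
      have "norm (\<integral>\<zeta>. bdry (tail f N) \<zeta> * g \<zeta> \<partial>circ) \<le> L2norm (bdry (tail f N)) * L2norm g"
        by (rule L2_Cauchy_Schwarz_norm[OF bdry_L2[OF t] g])
      also have "\<dots> \<le> sqrt (\<Sum>n. (cmod (tcoeff (tail f N) n))\<^sup>2) * L2norm g"
        using bdry_L2_bound(2)[OF t] by (intro mult_right_mono real_le_rsqrt) auto
      finally show "norm ((\<integral>\<zeta>. bdry f \<zeta> * g \<zeta> \<partial>circ) - (\<Sum>n<N. tcoeff f n * (\<integral>\<zeta>. \<zeta> ^ n * g \<zeta> \<partial>circ)))
        \<le> sqrt (\<Sum>n. (cmod (tcoeff (tail f N) n))\<^sup>2) * L2norm g" by (simp only: d)
    qed
    have "(\<lambda>N. sqrt (\<Sum>n. (cmod (tcoeff (tail f N) n))\<^sup>2) * L2norm g) \<longlonglongrightarrow> sqrt 0 * L2norm g"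
      by (intro tendsto_intros tail_norm_tendsto[OF f])
    thus "(\<lambda>N. sqrt (\<Sum>n. (cmod (tcoeff (tail f N) n))\<^sup>2) * L2norm g) \<longlonglongrightarrow> 0" by simp
  qed auto
  from tendsto_diff[OF tendsto_const this, of "\<integral>\<zeta>. bdry f \<zeta> * g \<zeta> \<partial>circ"]
  show ?thesis by (simp add: sums_def)
qed

lemma Fourier_bdry:
  assumes "f \<in> H2"
  shows "(\<integral>\<zeta>. bdry f \<zeta> * cnj \<zeta> ^ m \<partial>circ) = tcoeff f m"
proof -
  have "(\<lambda>n. tcoeff f n * (\<integral>\<zeta>. \<zeta> ^ n * cnj \<zeta> ^ m \<partial>circ)) sums (\<integral>\<zeta>. bdry f \<zeta> * cnj \<zeta> ^ m \<partial>circ)"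
    by (rule integral_bdry_series[OF assms]) (intro L2_continuous continuous_intros)
  moreover have "(\<lambda>n. tcoeff f n * (\<integral>\<zeta>. \<zeta> ^ n * cnj \<zeta> ^ m \<partial>circ)) sums tcoeff f m"
    using sums_If_finite_set[of "{m}" "tcoeff f"] by (simp add: integral_circ_power_cnj if_distrib cong: if_cong)
  ultimately show ?thesis by (rule sums_unique2)
qed

lemma H2_inner_sums:
  assumes "f \<in> H2" "g \<in> H2"
  shows "(\<lambda>n. tcoeff f n * cnj (tcoeff g n)) sums (\<integral>\<zeta>. bdry f \<zeta> * cnj (bdry g \<zeta>) \<partial>circ)"
proof -
  have "(\<integral>\<zeta>. \<zeta> ^ n * cnj (bdry g \<zeta>) \<partial>circ) = cnj (tcoeff g n)" for n
    unfolding Fourier_bdry[OF assms(2), symmetric] Bochner_Integration.integral_cnj[symmetric]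
    by (simp add: mult.commute)
  thus ?thesis using integral_bdry_series[OF assms(1) L2_cnj[OF bdry_L2[OF assms(2)]]] by simp
qed

lemma Parseval_H2:
  assumes "f \<in> H2"
  shows "(\<Sum>n. (cmod (tcoeff f n))\<^sup>2) = (L2norm (bdry f))\<^sup>2"
proof -
  have "(\<lambda>n. complex_of_real ((cmod (tcoeff f n))\<^sup>2)) sums (\<integral>\<zeta>. complex_of_real ((cmod (bdry f \<zeta>))\<^sup>2) \<partial>circ)"
    using H2_inner_sums[OF assms assms] by (simp only: complex_norm_square)
  hence "(\<lambda>n. (cmod (tcoeff f n))\<^sup>2) sums (L2norm (bdry f))\<^sup>2"
    unfolding integral_complex_of_real sums_of_real_iff L2norm_sq .
  thus ?thesis by (simp add: sums_iff)
qed

lemma Poisson_bdry: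
  assumes "f \<in> H2" "cmod z < 1"
  shows "(\<integral>\<zeta>. of_real (Pois z \<zeta>) * bdry f \<zeta> \<partial>circ) = f z"
proof -
  have "(\<lambda>n. tcoeff f n * (\<integral>\<zeta>. \<zeta> ^ n * of_real (Pois z \<zeta>) \<partial>circ)) sums (\<integral>\<zeta>. bdry f \<zeta> * of_real (Pois z \<zeta>) \<partial>circ)"
    by (rule integral_bdry_series[OF assms(1)]) (intro L2_continuous continuous_intros continuous_on_Pois assms)
  hence "(\<lambda>n. tcoeff f n * z ^ n) sums (\<integral>\<zeta>. of_real (Pois z \<zeta>) * bdry f \<zeta> \<partial>circ)"
    by (simp add: integral_Pois_power[OF assms(2)] mult.commute[of _ "complex_of_real _"])
  thus ?thesis using tcoeff_sums[OF H2_analytic[OF assms(1)] assms(2)] by (rule sums_unique2)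
qed

subsection \<open>Bounded analytic multipliers\<close>

definition Hinf :: "(complex \<Rightarrow> complex) set" where
  "Hinf = {g \<in> analytic_disc. \<exists>C. \<forall>z\<in>disc. cmod (g z) \<le> C}"

lemma HinfI: "g \<in> analytic_disc \<Longrightarrow> (\<And>z. cmod z < 1 \<Longrightarrow> cmod (g z) \<le> C) \<Longrightarrow> g \<in> Hinf"
  unfolding Hinf_def by (intro CollectI conjI exI[of _ C] ballI) auto

lemma Hinf_analytic: "g \<in> Hinf \<Longrightarrow> g \<in> analytic_disc"
  by (simp add: Hinf_def)

lemma HinfE:
  assumes "g \<in> Hinf"
  obtains C where "C \<ge> 0" "\<And>z. cmod (g z) \<le> C"
proof -
  from assms obtain C where C: "g \<in> analytic_disc" "\<forall>z\<in>disc. cmod (g z) \<le> C"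
    by (auto simp: Hinf_def)
  have "cmod (g z) \<le> max C 0" for z
    using C(2) analytic_disc_off[OF C(1), of z] by (cases "cmod z < 1") (auto simp: le_max_iff_disj)
  thus ?thesis using that[of "max C 0"] by auto
qed

lemma b_Hinf_Hinf: "b \<in> b_Hinf \<Longrightarrow> b \<in> Hinf"
  by (auto simp: b_Hinf_def Hinf_def)

lemma Hinf_mult: "f \<in> Hinf \<Longrightarrow> g \<in> Hinf \<Longrightarrow> (\<lambda>z. f z * g z) \<in> Hinf"
proof -
  assume fg: "f \<in> Hinf" "g \<in> Hinf"
  obtain C where C: "C \<ge> 0" "\<And>z. cmod (f z) \<le> C" using HinfE[OF fg(1)] by blast
  obtain D where D: "D \<ge> 0" "\<And>z. cmod (g z) \<le> D" using HinfE[OF fg(2)] by blast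
  show ?thesis
  proof (rule HinfI[of _ "C * D"])
    show "(\<lambda>z. f z * g z) \<in> analytic_disc" using fg by (simp add: analytic_disc_mult Hinf_analytic)
    show "cmod (f z * g z) \<le> C * D" for z using C D by (simp add: norm_mult mult_mono)
  qed
qed

lemma Hinf_add: "f \<in> Hinf \<Longrightarrow> g \<in> Hinf \<Longrightarrow> (\<lambda>z. f z + g z) \<in> Hinf"
proof -
  assume fg: "f \<in> Hinf" "g \<in> Hinf"
  obtain C where C: "\<And>z. cmod (f z) \<le> C" using HinfE[OF fg(1)] by blast
  obtain D where D: "\<And>z. cmod (g z) \<le> D" using HinfE[OF fg(2)] by blast
  show ?thesis
  proof (rule HinfI[of _ "C + D"])
    show "(\<lambda>z. f z + g z) \<in> analytic_disc" using fg by (simp add: analytic_disc_add Hinf_analytic)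
    show "cmod (f z + g z) \<le> C + D" for z by (rule norm_triangle_mono[OF C D])
  qed
qed

lemma Hinf_mult_H2:
  assumes "g \<in> Hinf" "f \<in> H2"
  shows "(\<lambda>z. g z * f z) \<in> H2"
proof -
  obtain C where C: "C \<ge> 0" "\<And>z. cmod (g z) \<le> C" using HinfE[OF assms(1)] by blast
  have fa: "f \<in> analytic_disc" and ga: "g \<in> analytic_disc"
    using assms by (auto intro: H2_analytic Hinf_analytic)
  obtain B where B: "\<And>r. 0 \<le> r \<Longrightarrow> r < 1 \<Longrightarrow> (\<integral>\<zeta>. (cmod (f (of_real r * \<zeta>)))\<^sup>2 \<partial>circ) \<le> B"
    using assms(2) by (simp add: H2_def bdd_above_def) (meson atLeastLessThan_iff)
  have "(\<integral>\<zeta>. (cmod (g (of_real r * \<zeta>) * f (of_real r * \<zeta>)))\<^sup>2 \<partial>circ) \<le> C\<^sup>2 * B" if r: "0 \<le> r" "r < 1" for r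
  proof -
    have c: "continuous_on (sphere 0 1) (\<lambda>\<zeta>. h (of_real r * \<zeta>))" if "h \<in> analytic_disc" for h
      by (rule continuous_on_compose2[OF analytic_disc_cont[OF that]])
        (use r in \<open>auto intro!: continuous_intros simp: norm_mult\<close>)
    have "(\<integral>\<zeta>. (cmod (g (of_real r * \<zeta>) * f (of_real r * \<zeta>)))\<^sup>2 \<partial>circ) \<le> (\<integral>\<zeta>. C\<^sup>2 * (cmod (f (of_real r * \<zeta>)))\<^sup>2 \<partial>circ)"
      by (intro integral_mono integrable_circ_continuous continuous_intros c fa ga)
        (auto simp: norm_mult power_mult_distrib intro!: mult_right_mono power_mono C)
    also have "\<dots> \<le> C\<^sup>2 * B" using B[OF r] by (simp add: mult_left_mono)
    finally show ?thesis .
  qed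
  thus ?thesis
    unfolding H2_def using analytic_disc_mult[OF ga fa] by (auto intro!: bdd_aboveI[of _ "C\<^sup>2 * B"])
qed

text \<open>Monomials cut off outside the disc, as \<open>analytic_disc\<close> demands;
  \<open>mono_disc 0\<close> is the constant 1 of this setting.\<close>

definition mono_disc :: "nat \<Rightarrow> complex \<Rightarrow> complex" where
  "mono_disc n z = (if cmod z < 1 then z ^ n else 0)"

lemma poly_disc_Hinf: "(\<lambda>z. if cmod z < 1 then poly p z else 0) \<in> Hinf"
proof -
  have "compact (poly p ` cball 0 1)"
    by (intro compact_continuous_image continuous_intros) auto
  then obtain B where B: "\<forall>x\<in>poly p ` cball 0 1. norm x \<le> B" using compact_imp_bounded bounded_iff by meson
  have "(\<lambda>z. if cmod z < 1 then poly p z else 0) holomorphic_on disc"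
    by (rule holomorphic_transform[of "poly p"]) (auto intro!: holomorphic_intros)
  thus ?thesis
    using B by (intro HinfI[of _ B]) (auto simp: analytic_disc_def)
qed

lemma mono_disc_Hinf: "mono_disc n \<in> Hinf"
proof -
  have "mono_disc n = (\<lambda>z. if cmod z < 1 then poly (monom 1 n) z else 0)"
    by (simp add: fun_eq_iff mono_disc_def poly_monom)
  thus ?thesis by (simp only: poly_disc_Hinf)
qed

lemma one_Hinf: "mono_disc 0 \<in> Hinf" by (rule mono_disc_Hinf)

lemma Hinf_H2: "g \<in> Hinf \<Longrightarrow> g \<in> H2"
proof -
  assume g: "g \<in> Hinf"
  have m: "tcoeff (mono_disc 0) = (\<lambda>n. if n = 0 then 1 else 0)"
  proof (rule tcoeff_unique)
    fix z :: complex assume "cmod z < 1"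
    thus "(\<lambda>n. (if n = 0 then 1 else 0) * z ^ n) sums mono_disc 0 z"
      using sums_If_finite_set[of "{0::nat}" "\<lambda>n. z ^ n"] by (simp add: mono_disc_def if_distrib if_distribR cong: if_cong)
  qed (simp add: mono_disc_def)
  have "summable (\<lambda>n. (cmod (tcoeff (mono_disc 0) n))\<^sup>2)"
    unfolding m by (rule summable_finite[of "{0}"]) auto
  hence "mono_disc 0 \<in> H2" by (simp add: H2_iff Hinf_analytic[OF mono_disc_Hinf])
  from Hinf_mult_H2[OF g this] have "(\<lambda>z. g z * mono_disc 0 z) \<in> H2" .
  moreover have "(\<lambda>z. g z * mono_disc 0 z) = g"
    using analytic_disc_off[OF Hinf_analytic[OF g]] by (auto simp: mono_disc_def)
  ultimately show ?thesis by simp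
qed

lemma mono_disc_H2: "mono_disc n \<in> H2"
  by (rule Hinf_H2[OF mono_disc_Hinf])

lemma bdry_continuous:
  assumes "continuous_on (cball 0 1) g" "\<And>z. cmod z < 1 \<Longrightarrow> f z = g z" "cmod \<zeta> = 1"
  shows "radial_limit f \<zeta> (g \<zeta>)" "bdry f \<zeta> = g \<zeta>"
proof -
  have "continuous_on {0..1} (\<lambda>r. g (of_real r * \<zeta>))"
    by (rule continuous_on_compose2[OF assms(1)]) (use assms in \<open>auto intro!: continuous_intros simp: norm_mult\<close>)
  hence "((\<lambda>r. g (of_real r * \<zeta>)) \<longlongrightarrow> g (of_real 1 * \<zeta>)) (at 1 within {0..1::real})"
    unfolding continuous_on_def by (metis atLeastAtMost_iff order_refl zero_le_one)
  moreover have "at 1 within {0..1::real} = at_left 1" by (rule at_within_Icc_at_left) simp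
  ultimately have "((\<lambda>r. g (of_real r * \<zeta>)) \<longlongrightarrow> g \<zeta>) (at_left (1::real))" by simp
  moreover have "\<forall>\<^sub>F r in at_left (1::real). g (of_real r * \<zeta>) = f (of_real r * \<zeta>)"
    unfolding at_left_1_iff by (rule exI[of _ 0]) (auto simp: assms norm_mult)
  ultimately show "radial_limit f \<zeta> (g \<zeta>)" unfolding radial_limit_def by (simp add: tendsto_cong)
  thus "bdry f \<zeta> = g \<zeta>" by (rule bdry_eqI)
qed

lemma bdry_mono_disc: "cmod \<zeta> = 1 \<Longrightarrow> bdry (mono_disc n) \<zeta> = \<zeta> ^ n"
  by (rule bdry_continuous(2)[of "\<lambda>z. z ^ n"]) (auto simp: mono_disc_def intro!: continuous_intros)

lemma bdry_mult:
  assumes "f \<in> H2" "g \<in> H2"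
  shows "AE \<zeta> in circ. bdry (\<lambda>z. f z * g z) \<zeta> = bdry f \<zeta> * bdry g \<zeta>"
  using Fatou_H2[OF assms(1)] Fatou_H2[OF assms(2)]
  by eventually_elim (auto intro!: bdry_eqI tendsto_mult simp: radial_limit_def)

lemma bdry_bound:
  assumes "g \<in> H2" "\<And>z. cmod z < 1 \<Longrightarrow> cmod (g z) \<le> C"
  shows "AE \<zeta> in circ. cmod (bdry g \<zeta>) \<le> C"
  using Fatou_H2[OF assms(1)]
proof (rule AE_mp, intro AE_circI impI)
  fix \<zeta> assume z: "cmod \<zeta> = 1" and l: "radial_limit g \<zeta> (bdry g \<zeta>)"
  have "((\<lambda>r. cmod (g (of_real r * \<zeta>))) \<longlongrightarrow> cmod (bdry g \<zeta>)) (at_left (1::real))"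
    by (intro tendsto_intros l[unfolded radial_limit_def])
  moreover have "\<forall>\<^sub>F r in at_left (1::real). cmod (g (of_real r * \<zeta>)) \<le> C"
    unfolding at_left_1_iff by (rule exI[of _ 0]) (auto intro!: assms simp: norm_mult z)
  ultimately show "cmod (bdry g \<zeta>) \<le> C" by (rule tendsto_upperbound) simp
qed

text \<open>The Poisson kernel is a probability density. This is how estimates on the circle are
  brought back into the disc.\<close>

lemma Poisson_sup_bound:
  assumes "f \<in> H2" "AE \<zeta> in circ. cmod (bdry f \<zeta>) \<le> C" "cmod z < 1"
  shows "cmod (f z) \<le> C"
proof -
  note [measurable] = bdry_measurable[OF H2_analytic[OF assms(1)]]
  have ip: "integrable circ (\<lambda>\<zeta>. Pois z \<zeta>)" by (intro integrable_circ_continuous continuous_on_Pois assms)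
  have "cmod (f z) \<le> (\<integral>\<zeta>. cmod (of_real (Pois z \<zeta>) * bdry f \<zeta>) \<partial>circ)"
    unfolding Poisson_bdry[OF assms(1,3), symmetric] by (rule integral_norm_bound)
  also have "\<dots> \<le> (\<integral>\<zeta>. C * Pois z \<zeta> \<partial>circ)"
  proof (rule integral_mono_AE)
    have "(\<lambda>\<zeta>. complex_of_real (Pois z \<zeta>)) \<in> L2" 
      by (intro L2_continuous continuous_intros continuous_on_Pois assms)
    thus "integrable circ (\<lambda>\<zeta>. cmod (of_real (Pois z \<zeta>) * bdry f \<zeta>))"
      using L2_product_integrable(2)[OF _ bdry_L2[OF assms(1)]] by auto
    show "AE \<zeta> in circ. cmod (of_real (Pois z \<zeta>) * bdry f \<zeta>) \<le> C * Pois z \<zeta>"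
      using assms(2)
      by (rule AE_mp, intro AE_circI impI)
        (use Pois_nonneg[OF assms(3)] in \<open>simp add: norm_mult mult.commute[of _ "Pois z _"] mult_left_mono\<close>)
  qed (use ip in auto)
  also have "\<dots> = C" by (simp add: integral_Pois_1[OF assms(3)])
  finally show ?thesis .
qed

subsection \<open>The inner product of \<open>H2\<close>\<close>

definition inner_H2 :: "(complex \<Rightarrow> complex) \<Rightarrow> (complex \<Rightarrow> complex) \<Rightarrow> complex" where
  "inner_H2 f g = (\<integral>\<zeta>. bdry f \<zeta> * cnj (bdry g \<zeta>) \<partial>circ)"

lemma inner_H2_sums:
  "f \<in> H2 \<Longrightarrow> g \<in> H2 \<Longrightarrow> (\<lambda>n. tcoeff f n * cnj (tcoeff g n)) sums inner_H2 f g"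
  unfolding inner_H2_def by (rule H2_inner_sums)

lemma inner_H2_add_left:
  assumes "f \<in> H2" "g \<in> H2" "h \<in> H2"
  shows "inner_H2 (\<lambda>z. f z + g z) h = inner_H2 f h + inner_H2 g h"
  using inner_H2_sums[OF H2_add[OF assms(1,2)] assms(3)]
    sums_add[OF inner_H2_sums[OF assms(1,3)] inner_H2_sums[OF assms(2,3)]] assms
  by (simp add: tcoeff_add H2_analytic distrib_right sums_iff)

lemma inner_H2_scale_left:
  assumes "f \<in> H2" "g \<in> H2"
  shows "inner_H2 (\<lambda>z. c * f z) g = c * inner_H2 f g"
  using inner_H2_sums[OF H2_scale[OF assms(1), of c] assms(2)]
    sums_mult[OF inner_H2_sums[OF assms], of c] assms
  by (simp add: tcoeff_scale H2_analytic mult.assoc sums_iff)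

lemma inner_H2_commute: "inner_H2 g f = cnj (inner_H2 f g)"
  unfolding inner_H2_def Bochner_Integration.integral_cnj[symmetric] by (simp add: mult.commute)

lemma inner_H2_add_right:
  assumes "f \<in> H2" "g \<in> H2" "h \<in> H2"
  shows "inner_H2 h (\<lambda>z. f z + g z) = inner_H2 h f + inner_H2 h g"
  by (simp add: inner_H2_add_left[OF assms] inner_H2_commute[of h f] inner_H2_commute[of h g]
      inner_H2_commute[of h "\<lambda>z. f z + g z"])

lemma inner_H2_scale_right:
  assumes "f \<in> H2" "g \<in> H2"
  shows "inner_H2 g (\<lambda>z. c * f z) = cnj c * inner_H2 g f"
  by (simp add: inner_H2_scale_left[OF assms] inner_H2_commute[of g f] inner_H2_commute[of g "\<lambda>z. c * f z"])

definition norm_H2 :: "(complex \<Rightarrow> complex) \<Rightarrow> real" where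
  "norm_H2 f = L2norm (bdry f)"

lemma norm_H2_nonneg [simp]: "norm_H2 f \<ge> 0" by (simp add: norm_H2_def)

lemma norm_H2_sums: "f \<in> H2 \<Longrightarrow> (\<lambda>n. (cmod (tcoeff f n))\<^sup>2) sums (norm_H2 f)\<^sup>2"
  using Parseval_H2 H2_summable by (simp add: norm_H2_def sums_iff)

lemma inner_H2_self: "inner_H2 f f = of_real ((norm_H2 f)\<^sup>2)"
proof -
  have "inner_H2 f f = (\<integral>\<zeta>. complex_of_real ((cmod (bdry f \<zeta>))\<^sup>2) \<partial>circ)"
    unfolding inner_H2_def by (simp only: complex_norm_square)
  thus ?thesis by (simp only: integral_complex_of_real norm_H2_def L2norm_sq)
qed

lemma sum_tcoeff_le_norm_H2:
  assumes "f \<in> H2" "finite A"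
  shows "(\<Sum>n\<in>A. (cmod (tcoeff f n))\<^sup>2) \<le> (norm_H2 f)\<^sup>2"
  unfolding sums_unique[OF norm_H2_sums[OF assms(1)]]
  by (rule sum_le_suminf[OF H2_summable[OF assms(1)] assms(2)]) simp

lemma tcoeff_le_norm_H2: 
  assumes "f \<in> H2"
  shows "cmod (tcoeff f n) \<le> norm_H2 f"
  using sum_tcoeff_le_norm_H2[OF assms, of "{n}"] by - (rule power2_le_imp_le, simp_all)

lemma norm_H2_zero_iff: "f \<in> H2 \<Longrightarrow> norm_H2 f = 0 \<Longrightarrow> f = (\<lambda>z. 0)"
  using tcoeff_le_norm_H2[of f]
  by (intro analytic_disc_ext[OF H2_analytic analytic_disc_zero]) (auto simp: tcoeff_zero)

lemma inner_H2_le: 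
  assumes "f \<in> H2" "g \<in> H2"
  shows "cmod (inner_H2 f g) \<le> norm_H2 f * norm_H2 g"
  using L2_Cauchy_Schwarz_norm[OF bdry_L2[OF assms(1)] L2_cnj[OF bdry_L2[OF assms(2)]]]
  by (simp add: inner_H2_def norm_H2_def)

lemma inner_H2_mono_disc:
  assumes "f \<in> H2"
  shows "inner_H2 f (mono_disc n) = tcoeff f n"
  unfolding inner_H2_def Fourier_bdry[OF assms, symmetric]
  by (intro Bochner_Integration.integral_cong refl) (simp add: bdry_mono_disc)

lemma H2_eqI_inner:
  assumes "f \<in> H2" "g \<in> H2" "\<And>k. k \<in> H2 \<Longrightarrow> inner_H2 f k = inner_H2 g k"
  shows "f = g"
  using assms(3)[OF mono_disc_H2]
  by (intro analytic_disc_ext H2_analytic assms) (simp add: inner_H2_mono_disc assms)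

text \<open>Coefficients converge one by one. The norm estimate is proved for finitely many of them
  by letting m tend to infinity, and only then are all coefficients included.\<close>

lemma H2_complete:
  assumes s: "\<And>n. s n \<in> H2"
    and C: "\<And>e. e > 0 \<Longrightarrow> \<exists>N. \<forall>m\<ge>N. \<forall>n\<ge>N. norm_H2 (\<lambda>z. s m z - s n z) < e"
  obtains f where "f \<in> H2" "(\<lambda>n. norm_H2 (\<lambda>z. s n z - f z)) \<longlonglongrightarrow> 0"
proof -
  have td: "tcoeff (\<lambda>z. s m z - s n z) k = tcoeff (s m) k - tcoeff (s n) k" for m n k
    by (intro tcoeff_diff H2_analytic s)
  have "Cauchy (\<lambda>n. tcoeff (s n) k)" for k
  proof (rule metric_CauchyI)
    fix e :: real assume "e > 0"
    then obtain N where N: "\<And>m n. m \<ge> N \<Longrightarrow> n \<ge> N \<Longrightarrow> norm_H2 (\<lambda>z. s m z - s n z) < e" using C by meson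
    have "dist (tcoeff (s m) k) (tcoeff (s n) k) < e" if "m \<ge> N" "n \<ge> N" for m n
      using N[OF that] tcoeff_le_norm_H2[OF H2_diff[OF s[of m] s[of n]], of k] by (simp add: td dist_norm)
    thus "\<exists>N. \<forall>m\<ge>N. \<forall>n\<ge>N. dist (tcoeff (s m) k) (tcoeff (s n) k) < e" by blast
  qed
  hence "\<forall>k. \<exists>c. (\<lambda>n. tcoeff (s n) k) \<longlonglongrightarrow> c" by (simp add: Cauchy_convergent_iff convergent_def)
  then obtain c where c: "\<And>k. (\<lambda>n. tcoeff (s n) k) \<longlonglongrightarrow> c k" by metis
  have bound: "(\<Sum>k\<le>K. (cmod (tcoeff (s n) k - c k))\<^sup>2) \<le> e\<^sup>2"
    if N: "\<And>m n. m \<ge> N \<Longrightarrow> n \<ge> N \<Longrightarrow> norm_H2 (\<lambda>z. s m z - s n z) < e" and n: "n \<ge> N" for N e n K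
  proof (rule LIMSEQ_le_const2)
    show "(\<lambda>m. \<Sum>k\<le>K. (cmod (tcoeff (s n) k - tcoeff (s m) k))\<^sup>2) \<longlonglongrightarrow> (\<Sum>k\<le>K. (cmod (tcoeff (s n) k - c k))\<^sup>2)"
      by (intro tendsto_intros c)
    have "(\<Sum>k\<le>K. (cmod (tcoeff (s n) k - tcoeff (s m) k))\<^sup>2) \<le> e\<^sup>2" if m: "m \<ge> N" for m
    proof -
      have h: "(\<lambda>z. s n z - s m z) \<in> H2" by (intro H2_diff s)
      have "(\<Sum>k\<le>K. (cmod (tcoeff (\<lambda>z. s n z - s m z) k))\<^sup>2) \<le> (norm_H2 (\<lambda>z. s n z - s m z))\<^sup>2"
        by (rule sum_tcoeff_le_norm_H2[OF h]) simp
      also have "\<dots> \<le> e\<^sup>2" using N[OF n m] by (intro power_mono) auto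
      finally show ?thesis by (simp only: td)
    qed
    thus "\<exists>M. \<forall>m\<ge>M. (\<Sum>k\<le>K. (cmod (tcoeff (s n) k - tcoeff (s m) k))\<^sup>2) \<le> e\<^sup>2" by blast
  qed
  have summ: "summable (\<lambda>k. (cmod (tcoeff (s n) k - c k))\<^sup>2) \<and> (\<Sum>k. (cmod (tcoeff (s n) k - c k))\<^sup>2) \<le> e\<^sup>2"
    if N: "\<And>m n. m \<ge> N \<Longrightarrow> n \<ge> N \<Longrightarrow> norm_H2 (\<lambda>z. s m z - s n z) < e" and n: "n \<ge> N" for N e n
  proof
    show 1: "summable (\<lambda>k. (cmod (tcoeff (s n) k - c k))\<^sup>2)"
      by (rule bounded_imp_summable[of _ "e\<^sup>2"]) (use bound[OF N n] in auto)
    show "(\<Sum>k. (cmod (tcoeff (s n) k - c k))\<^sup>2) \<le> e\<^sup>2"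
      by (rule LIMSEQ_le_const2[OF summable_LIMSEQ'[OF 1]]) (use bound[OF N n] in auto)
  qed
  obtain N1 where N1: "\<And>m n. m \<ge> N1 \<Longrightarrow> n \<ge> N1 \<Longrightarrow> norm_H2 (\<lambda>z. s m z - s n z) < 1" using C[of 1] by auto
  \<comment> \<open>The limit sequence \<open>c\<close> is the coefficient sequence of
    \<open>s N1\<close> minus a square-summable difference.\<close>
  have "summable (\<lambda>k. (cmod (tcoeff (s N1) k + (- 1) * (tcoeff (s N1) k - c k)))\<^sup>2)"
    using summ[OF N1 order_refl]
    by (intro summable_sq_add H2_summable s) (simp add: norm_minus_commute)
  hence cs: "summable (\<lambda>k. (cmod (c k))\<^sup>2)" by simp
  define f where "f = powser_disc c"
  have f: "f \<in> H2" "tcoeff f = c" using powser_disc_H2[OF cs] by (simp_all add: f_def)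
  have tf: "tcoeff (\<lambda>z. s n z - f z) k = tcoeff (s n) k - c k" for n k
    using f by (simp add: tcoeff_diff[OF H2_analytic[OF s] H2_analytic[OF f(1)]])
  have "(\<lambda>n. norm_H2 (\<lambda>z. s n z - f z)) \<longlonglongrightarrow> 0"
  proof (rule metric_LIMSEQ_I)
    fix e :: real assume "e > 0"
    then obtain N where N: "\<And>m n. m \<ge> N \<Longrightarrow> n \<ge> N \<Longrightarrow> norm_H2 (\<lambda>z. s m z - s n z) < e / 2"
      using C[of "e / 2"] by auto
    have "dist (norm_H2 (\<lambda>z. s n z - f z)) 0 < e" if n: "n \<ge> N" for n
    proof -
      have "(norm_H2 (\<lambda>z. s n z - f z))\<^sup>2 \<le> (e / 2)\<^sup>2"
        using norm_H2_sums[OF H2_diff[OF s[of n] f(1)]] summ[OF N n] by (simp add: tf sums_iff)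
      hence "norm_H2 (\<lambda>z. s n z - f z) \<le> e / 2" using \<open>e > 0\<close> by - (rule power2_le_imp_le, auto)
      thus ?thesis using \<open>e > 0\<close> by simp
    qed
    thus "\<exists>N. \<forall>n\<ge>N. dist (norm_H2 (\<lambda>z. s n z - f z)) 0 < e" by blast
  qed
  thus ?thesis using f(1) that by blast
qed

subsection \<open>The projection onto H2 and co-analytic Toeplitz operators\<close>

text \<open>The partial Fourier sum \<open>S\<close> satisfies: inner product of \<open>g\<close>
  with \<open>S\<close> equals the squared norm of \<open>S\<close>. Cauchy-Schwarz then bounds the
  norm of \<open>S\<close> by that of \<open>g\<close>.\<close>

lemma Bessel_circ:
  assumes g: "g \<in> L2"
  shows "summable (\<lambda>n. (cmod (\<integral>\<zeta>. g \<zeta> * cnj \<zeta> ^ n \<partial>circ))\<^sup>2)"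
proof (rule bounded_imp_summable)
  fix N
  define c where "c = (\<lambda>n. if n \<le> N then (\<integral>\<zeta>. g \<zeta> * cnj \<zeta> ^ n \<partial>circ) else 0)"
  define S where "S = (\<lambda>\<zeta>. \<Sum>n\<le>N. c n * \<zeta> ^ n)"
  define X where "X = (\<Sum>n\<le>N. (cmod (c n))\<^sup>2)"
  have SL: "S \<in> L2" unfolding S_def by (intro L2_continuous continuous_intros)
  have cs: "summable (\<lambda>n. cmod (c n))" by (rule summable_finite[of "{..N}"]) (auto simp: c_def)
  have Sc: "(\<Sum>n. c n * \<zeta> ^ n) = S \<zeta>" for \<zeta>
    unfolding S_def by (rule suminf_finite) (auto simp: c_def)
  have Xc: "(\<Sum>n. (cmod (c n))\<^sup>2) = X"
    unfolding X_def by (rule suminf_finite) (auto simp: c_def)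
  have XS: "X = (L2norm S)\<^sup>2"
    using Parseval_powser[OF cs] by (simp add: Sc Xc L2norm_sq sums_iff)
  have "(\<integral>\<zeta>. g \<zeta> * cnj (S \<zeta>) \<partial>circ) = (\<integral>\<zeta>. (\<Sum>n\<le>N. cnj (c n) * (g \<zeta> * cnj \<zeta> ^ n)) \<partial>circ)"
    by (intro Bochner_Integration.integral_cong refl) (simp add: S_def sum_distrib_left mult_ac)
  also have "\<dots> = (\<Sum>n\<le>N. cnj (c n) * (\<integral>\<zeta>. g \<zeta> * cnj \<zeta> ^ n \<partial>circ))"
    by (subst Bochner_Integration.integral_sum)
      (auto intro!: L2_product_integrable(2)[OF g] L2_continuous continuous_intros)
  also have "\<dots> = of_real X"
    unfolding X_def of_real_sum by (intro sum.cong refl) (simp only: complex_norm_square, simp add: c_def mult.commute)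
  finally have "(\<integral>\<zeta>. g \<zeta> * cnj (S \<zeta>) \<partial>circ) = of_real X" .
  moreover have "cmod (\<integral>\<zeta>. g \<zeta> * cnj (S \<zeta>) \<partial>circ) \<le> L2norm g * L2norm S"
    using L2_Cauchy_Schwarz_norm[OF g L2_cnj[OF SL]] by simp
  ultimately have "(L2norm S)\<^sup>2 \<le> L2norm g * L2norm S" by (simp add: XS norm_power)
  hence le: "L2norm S * L2norm S \<le> L2norm g * L2norm S" by (simp only: power2_eq_square)
  have "L2norm S \<le> L2norm g"
  proof (cases "L2norm S = 0")
    case False
    hence "L2norm S > 0" using L2norm_nonneg[of S] by linarith
    thus ?thesis by (rule mult_right_le_imp_le[OF le])
  qed simp
  hence "X \<le> (L2norm g)\<^sup>2" unfolding XS by (rule power_mono) simp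
  thus "(\<Sum>n\<le>N. (cmod (\<integral>\<zeta>. g \<zeta> * cnj \<zeta> ^ n \<partial>circ))\<^sup>2) \<le> (L2norm g)\<^sup>2"
    by (simp add: X_def c_def)
qed auto

text \<open>The projection is the power series whose coefficients are the Fourier coefficients of
  \<open>g\<close> with index at least 0; uniqueness holds because inner products with monomials are
  Taylor coefficients. The second conclusion is the form in which \<open>P_plus\<close> is used from
  here on.\<close>

lemma P_plus_props:
  assumes g: "g \<in> L2"
  shows "P_plus g \<in> H2"
    and "\<And>k. k \<in> H2 \<Longrightarrow> inner_H2 (P_plus g) k = (\<integral>\<zeta>. g \<zeta> * cnj (bdry k \<zeta>) \<partial>circ)"
proof -
  let ?Q = "\<lambda>h. h \<in> H2 \<and> (\<forall>k\<in>H2. (\<integral>\<zeta>. (g \<zeta> - bdry h \<zeta>) * cnj (bdry k \<zeta>) \<partial>circ) = 0)"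
  have Q: "?Q h \<longleftrightarrow> h \<in> H2 \<and> (\<forall>k\<in>H2. inner_H2 h k = (\<integral>\<zeta>. g \<zeta> * cnj (bdry k \<zeta>) \<partial>circ))" for h
  proof -
    have d: "(\<integral>\<zeta>. (g \<zeta> - bdry h \<zeta>) * cnj (bdry k \<zeta>) \<partial>circ) = (\<integral>\<zeta>. g \<zeta> * cnj (bdry k \<zeta>) \<partial>circ) - inner_H2 h k"
      if "h \<in> H2" "k \<in> H2" for k
      unfolding inner_H2_def left_diff_distrib
      by (intro Bochner_Integration.integral_diff L2_product_integrable(3) g bdry_L2 that)
    hence "(\<integral>\<zeta>. (g \<zeta> - bdry h \<zeta>) * cnj (bdry k \<zeta>) \<partial>circ) = 0 \<longleftrightarrow> inner_H2 h k = (\<integral>\<zeta>. g \<zeta> * cnj (bdry k \<zeta>) \<partial>circ)"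
      if "h \<in> H2" "k \<in> H2" for k
      by (subst d[OF that]) (rule trans[OF right_minus_eq eq_commute])
    thus ?thesis by blast
  qed
  define c where "c = (\<lambda>n. \<integral>\<zeta>. g \<zeta> * cnj \<zeta> ^ n \<partial>circ)"
  define h where "h = powser_disc c"
  have h: "h \<in> H2" "tcoeff h = c"
    using powser_disc_H2[of c] Bessel_circ[OF g] by (simp_all add: h_def c_def)
  have "?Q h" unfolding Q
  proof (intro conjI ballI h(1))
    fix k assume k: "k \<in> H2"
    have "(\<lambda>n. tcoeff k n * (\<integral>\<zeta>. \<zeta> ^ n * cnj (g \<zeta>) \<partial>circ)) sums (\<integral>\<zeta>. bdry k \<zeta> * cnj (g \<zeta>) \<partial>circ)"
      by (rule integral_bdry_series[OF k L2_cnj[OF g]])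
    hence m1: "(\<lambda>n. cnj (tcoeff k n * (\<integral>\<zeta>. \<zeta> ^ n * cnj (g \<zeta>) \<partial>circ))) sums cnj (\<integral>\<zeta>. bdry k \<zeta> * cnj (g \<zeta>) \<partial>circ)"
      by (simp only: sums_cnj)
    have m2: "cnj (tcoeff k n * (\<integral>\<zeta>. \<zeta> ^ n * cnj (g \<zeta>) \<partial>circ)) = tcoeff h n * cnj (tcoeff k n)" for n
      unfolding h(2) c_def complex_cnj_mult Bochner_Integration.integral_cnj[symmetric] by (simp add: mult.commute)
    have m3: "cnj (\<integral>\<zeta>. bdry k \<zeta> * cnj (g \<zeta>) \<partial>circ) = (\<integral>\<zeta>. g \<zeta> * cnj (bdry k \<zeta>) \<partial>circ)"
      unfolding Bochner_Integration.integral_cnj[symmetric] by (simp add: mult.commute)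
    have "(\<lambda>n. tcoeff h n * cnj (tcoeff k n)) sums (\<integral>\<zeta>. g \<zeta> * cnj (bdry k \<zeta>) \<partial>circ)"
      using m1 by (simp only: m2 m3)
    thus "inner_H2 h k = (\<integral>\<zeta>. g \<zeta> * cnj (bdry k \<zeta>) \<partial>circ)"
      by (rule sums_unique2[OF inner_H2_sums[OF h(1) k]])
  qed
  moreover have "h' = h" if "?Q h'" for h'
    using that \<open>?Q h\<close> unfolding Q by (intro H2_eqI_inner) auto
  ultimately have "?Q (THE h. ?Q h)" by (rule theI)
  hence "?Q (P_plus g)" unfolding P_plus_def .
  thus "P_plus g \<in> H2" "\<And>k. k \<in> H2 \<Longrightarrow> inner_H2 (P_plus g) k = (\<integral>\<zeta>. g \<zeta> * cnj (bdry k \<zeta>) \<partial>circ)"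
    unfolding Q by auto
qed

definition coT :: "(complex \<Rightarrow> complex) \<Rightarrow> (complex \<Rightarrow> complex) \<Rightarrow> complex \<Rightarrow> complex" where
  "coT a = toeplitz (\<lambda>\<zeta>. cnj (bdry a \<zeta>))"

text \<open>\<open>coT a\<close> is the adjoint of multiplication by \<open>a\<close>. In this form
  the algebra of these operators is done by moving multiplications across the inner product, without
  boundary values.\<close>

lemma coT:
  assumes "a \<in> Hinf" "f \<in> H2"
  shows coT_H2: "coT a f \<in> H2"
    and inner_coT: "\<And>k. k \<in> H2 \<Longrightarrow> inner_H2 (coT a f) k = inner_H2 f (\<lambda>z. a z * k z)"
proof -
  obtain C where C: "C \<ge> 0" "\<And>z. cmod (a z) \<le> C" using HinfE[OF assms(1)] by blast
  have aH: "a \<in> H2" using assms(1) by (rule Hinf_H2)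
  have L: "(\<lambda>\<zeta>. cnj (bdry a \<zeta>) * bdry f \<zeta>) \<in> L2"
    using bdry_bound[OF aH C(2)]
    by (intro L2_mult_bounded[of _ _ C] bdry_L2 assms L2_measurable L2_cnj aH) auto
  show "coT a f \<in> H2" unfolding coT_def toeplitz_def by (rule P_plus_props(1)[OF L])
  fix k assume k: "k \<in> H2"
  have ak: "(\<lambda>z. a z * k z) \<in> H2" by (rule Hinf_mult_H2[OF assms(1) k])
  have "inner_H2 (coT a f) k = (\<integral>\<zeta>. cnj (bdry a \<zeta>) * bdry f \<zeta> * cnj (bdry k \<zeta>) \<partial>circ)"
    unfolding coT_def toeplitz_def by (rule P_plus_props(2)[OF L k])
  also have "\<dots> = inner_H2 f (\<lambda>z. a z * k z)"
    unfolding inner_H2_def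
  proof (rule integral_cong_AE)
    show "AE \<zeta> in circ. cnj (bdry a \<zeta>) * bdry f \<zeta> * cnj (bdry k \<zeta>) = bdry f \<zeta> * cnj (bdry (\<lambda>z. a z * k z) \<zeta>)"
      using bdry_mult[OF aH k] by eventually_elim simp
    show "(\<lambda>\<zeta>. cnj (bdry a \<zeta>) * bdry f \<zeta> * cnj (bdry k \<zeta>)) \<in> borel_measurable circ"
      by (rule borel_measurable_integrable[OF L2_product_integrable(3)[OF L bdry_L2[OF k]]])
    show "(\<lambda>\<zeta>. bdry f \<zeta> * cnj (bdry (\<lambda>z. a z * k z) \<zeta>)) \<in> borel_measurable circ"
      by (rule borel_measurable_integrable[OF L2_product_integrable(3)[OF bdry_L2[OF assms(2)] bdry_L2[OF ak]]])
  qed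
  finally show "inner_H2 (coT a f) k = inner_H2 f (\<lambda>z. a z * k z)" .
qed

lemma coT_eqI:
  assumes "a \<in> Hinf" "f \<in> H2" "h \<in> H2" "\<And>k. k \<in> H2 \<Longrightarrow> inner_H2 h k = inner_H2 f (\<lambda>z. a z * k z)"
  shows "coT a f = h"
  using assms by (intro H2_eqI_inner coT_H2) (simp_all add: inner_coT)

text \<open>Adjoints reverse the order of the factors, but multiplications commute; hence any two of
  these operators commute.\<close>

lemma coT_coT:
  assumes "a \<in> Hinf" "b \<in> Hinf" "f \<in> H2"
  shows "coT a (coT b f) = coT (\<lambda>z. b z * a z) f"
  using assms by (intro coT_eqI[symmetric] Hinf_mult coT_H2)
    (simp_all add: inner_coT coT_H2 Hinf_mult_H2 mult.assoc)

lemma coT_add_symbol: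
  assumes "a \<in> Hinf" "b \<in> Hinf" "f \<in> H2"
  shows "coT (\<lambda>z. a z + b z) f = (\<lambda>z. coT a f z + coT b f z)"
  using assms by (intro coT_eqI Hinf_add H2_add coT_H2)
    (simp_all add: inner_coT coT_H2 Hinf_mult_H2 distrib_right inner_H2_add_left inner_H2_add_right)

lemma coT_add:
  assumes "a \<in> Hinf" "f \<in> H2" "g \<in> H2"
  shows "coT a (\<lambda>z. f z + g z) = (\<lambda>z. coT a f z + coT a g z)"
  using assms by (intro coT_eqI H2_add coT_H2)
    (simp_all add: inner_coT coT_H2 Hinf_mult_H2 inner_H2_add_left)

lemma coT_scale:
  assumes "a \<in> Hinf" "f \<in> H2"
  shows "coT a (\<lambda>z. c * f z) = (\<lambda>z. c * coT a f z)"
  using assms by (intro coT_eqI H2_scale coT_H2)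
    (simp_all add: inner_coT coT_H2 Hinf_mult_H2 inner_H2_scale_left)

lemma coT_one:
  assumes "f \<in> H2"
  shows "coT (mono_disc 0) f = f"
proof (rule coT_eqI[OF one_Hinf assms assms])
  fix k assume "k \<in> H2"
  hence "(\<lambda>z. mono_disc 0 z * k z) = k"
    using analytic_disc_off[OF H2_analytic, of k] by (auto simp: mono_disc_def)
  thus "inner_H2 f k = inner_H2 f (\<lambda>z. mono_disc 0 z * k z)" by simp
qed

subsection \<open>Poisson integrals of integrable functions\<close>

definition Pint :: "(complex \<Rightarrow> real) \<Rightarrow> complex \<Rightarrow> real" where
  "Pint u z = (\<integral>\<zeta>. Pois z \<zeta> * u \<zeta> \<partial>circ)"

lemma integrable_kernel_mult:
  fixes K :: "complex \<Rightarrow> 'b::{euclidean_space, real_normed_algebra}"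
  assumes "integrable circ u" "continuous_on (sphere 0 1) K"
  shows "integrable circ (\<lambda>\<zeta>. K \<zeta> * u \<zeta>)"
proof -
  have "compact (K ` sphere 0 1)"
    by (intro compact_continuous_image assms) auto
  then obtain B where "\<forall>x\<in>K ` sphere 0 1. norm x \<le> B" using compact_imp_bounded bounded_iff by meson
  hence B: "norm (K \<zeta>) \<le> B" if "cmod \<zeta> = 1" for \<zeta> using that by auto
  have "norm (K \<zeta> * u \<zeta>) \<le> norm (B * norm (u \<zeta>))" if "cmod \<zeta> = 1" for \<zeta>
  proof -
    have "norm (K \<zeta> * u \<zeta>) \<le> norm (K \<zeta>) * norm (u \<zeta>)" by (rule norm_mult_ineq)
    also have "\<dots> \<le> B * norm (u \<zeta>)" using B[OF that] by (intro mult_right_mono) auto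
    finally show ?thesis by simp
  qed
  note le = this
  show ?thesis
  proof (rule Bochner_Integration.integrable_bound)
    show "integrable circ (\<lambda>\<zeta>. B * norm (u \<zeta>))" using assms(1) by auto
    show "(\<lambda>\<zeta>. K \<zeta> * u \<zeta>) \<in> borel_measurable circ"
      by (rule borel_measurable_times[OF borel_measurable_circ_continuous[OF assms(2)] borel_measurable_integrable[OF assms(1)]])
    show "AE \<zeta> in circ. norm (K \<zeta> * u \<zeta>) \<le> norm (B * norm (u \<zeta>))"
      by (rule AE_circI) (rule le)
  qed
qed

lemma integrable_Pois_mult:
  "integrable circ u \<Longrightarrow> cmod z < 1 \<Longrightarrow> integrable circ (\<lambda>\<zeta>. Pois z \<zeta> * (u \<zeta> :: real))"
  by (intro integrable_kernel_mult continuous_on_Pois)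

lemma rad_disc: "cmod \<zeta> = 1 \<Longrightarrow> cmod (of_real (rad_seq k) * \<zeta>) < 1"
  using rad_seq[of k] by (simp add: norm_mult)

lemma Pint_measurable [measurable]:
  assumes [measurable]: "u \<in> borel_measurable circ"
  shows "(\<lambda>\<zeta>. Pint u (of_real r * \<zeta>)) \<in> borel_measurable circ"
proof -
  have [measurable]: "(\<lambda>x. fst x) \<in> borel_measurable (circ \<Otimes>\<^sub>M circ)" "(\<lambda>x. snd x) \<in> borel_measurable (circ \<Otimes>\<^sub>M circ)"
    using measurable_compose[OF measurable_fst id_circ] measurable_compose[OF measurable_snd id_circ] by simp_all
  have "(\<lambda>x. Pois (of_real r * fst x) (snd x) * u (snd x)) \<in> borel_measurable (circ \<Otimes>\<^sub>M circ)"
    unfolding Pois_def by measurable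
  thus ?thesis unfolding Pint_def
    by (intro circ.borel_measurable_lebesgue_integral) (simp add: case_prod_unfold)
qed

text \<open>The L^1 error at radius \<open>rad_seq k\<close>. With values in \<open>ennreal\<close>
  it can be estimated before the difference is known to be integrable.\<close>

definition Perr :: "nat \<Rightarrow> (complex \<Rightarrow> real) \<Rightarrow> ennreal" where
  "Perr k u = (\<integral>\<^sup>+\<zeta>. ennreal \<bar>Pint u (of_real (rad_seq k) * \<zeta>) - u \<zeta>\<bar> \<partial>circ)"

lemma Pint_add:
  assumes "integrable circ u" "integrable circ v" "cmod z < 1"
  shows "Pint (\<lambda>\<zeta>. u \<zeta> + v \<zeta>) z = Pint u z + Pint v z"
  unfolding Pint_def distrib_left
  by (intro Bochner_Integration.integral_add integrable_Pois_mult assms)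

lemma Perr_add:
  assumes "integrable circ u" "integrable circ v"
  shows "Perr k (\<lambda>\<zeta>. u \<zeta> + v \<zeta>) \<le> Perr k u + Perr k v"
proof -
  have [measurable]: "u \<in> borel_measurable circ" "v \<in> borel_measurable circ" using assms by auto
  have "Perr k (\<lambda>\<zeta>. u \<zeta> + v \<zeta>) \<le>
    (\<integral>\<^sup>+\<zeta>. ennreal \<bar>Pint u (of_real (rad_seq k) * \<zeta>) - u \<zeta>\<bar> + ennreal \<bar>Pint v (of_real (rad_seq k) * \<zeta>) - v \<zeta>\<bar> \<partial>circ)"
    unfolding Perr_def
    by (intro nn_integral_mono) (simp add: Pint_add[OF assms rad_disc] ennreal_plus[symmetric] ennreal_leI del: ennreal_plus)
  also have "\<dots> = Perr k u + Perr k v" unfolding Perr_def by (intro nn_integral_add) measurable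
  finally show ?thesis .
qed

text \<open>Averaging against the Poisson kernel is an L^1 contraction: after Tonelli, symmetry of
  the kernel turns the inner integral into a total mass of 1. The other half of the factor 2 is
  \<open>u\<close> itself.\<close>

lemma Perr_le:
  assumes "integrable circ u"
  shows "Perr k u \<le> 2 * (\<integral>\<^sup>+\<zeta>. ennreal \<bar>u \<zeta>\<bar> \<partial>circ)"
proof -
  have [measurable]: "u \<in> borel_measurable circ" using assms by auto
  have [measurable]: "(\<lambda>x. fst x) \<in> borel_measurable (circ \<Otimes>\<^sub>M circ)" "(\<lambda>x. snd x) \<in> borel_measurable (circ \<Otimes>\<^sub>M circ)"
    using measurable_compose[OF measurable_fst id_circ] measurable_compose[OF measurable_snd id_circ] by simp_all
  have m: "(\<lambda>x. ennreal (Pois (of_real (rad_seq k) * fst x) (snd x)) * ennreal \<bar>u (snd x)\<bar>) \<in> borel_measurable (circ \<Otimes>\<^sub>M circ)"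
    unfolding Pois_def by measurable
  have mP: "(\<lambda>\<eta>. ennreal (Pois z \<eta>)) \<in> borel_measurable circ" for z
    unfolding Pois_def by measurable
  have "Perr k u \<le> (\<integral>\<^sup>+\<zeta>. ennreal \<bar>Pint u (of_real (rad_seq k) * \<zeta>)\<bar> + ennreal \<bar>u \<zeta>\<bar> \<partial>circ)"
    unfolding Perr_def by (intro nn_integral_mono) (simp add: ennreal_plus[symmetric] ennreal_leI del: ennreal_plus)
  also have "\<dots> = (\<integral>\<^sup>+\<zeta>. ennreal \<bar>Pint u (of_real (rad_seq k) * \<zeta>)\<bar> \<partial>circ) + (\<integral>\<^sup>+\<zeta>. ennreal \<bar>u \<zeta>\<bar> \<partial>circ)"
    by (intro nn_integral_add) measurable
  also have "(\<integral>\<^sup>+\<zeta>. ennreal \<bar>Pint u (of_real (rad_seq k) * \<zeta>)\<bar> \<partial>circ)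
      \<le> (\<integral>\<^sup>+\<zeta>. (\<integral>\<^sup>+\<eta>. ennreal (Pois (of_real (rad_seq k) * \<zeta>) \<eta>) * ennreal \<bar>u \<eta>\<bar> \<partial>circ) \<partial>circ)"
  proof (rule nn_integral_mono)
    fix \<zeta> assume "\<zeta> \<in> space circ"
    hence z: "cmod (of_real (rad_seq k) * \<zeta>) < 1" by (intro rad_disc) simp
    have "ennreal \<bar>Pint u (of_real (rad_seq k) * \<zeta>)\<bar> \<le> (\<integral>\<^sup>+\<eta>. ennreal (norm (Pois (of_real (rad_seq k) * \<zeta>) \<eta> * u \<eta>)) \<partial>circ)"
      using integral_norm_bound_ennreal[OF integrable_Pois_mult[OF assms z]] by (simp add: Pint_def)
    also have "\<dots> = (\<integral>\<^sup>+\<eta>. ennreal (Pois (of_real (rad_seq k) * \<zeta>) \<eta>) * ennreal \<bar>u \<eta>\<bar> \<partial>circ)"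
      using Pois_nonneg[OF z] by (intro nn_integral_cong) (simp add: abs_mult ennreal_mult)
    finally show "ennreal \<bar>Pint u (of_real (rad_seq k) * \<zeta>)\<bar> \<le> (\<integral>\<^sup>+\<eta>. ennreal (Pois (of_real (rad_seq k) * \<zeta>) \<eta>) * ennreal \<bar>u \<eta>\<bar> \<partial>circ)" .
  qed
  also have "\<dots> = (\<integral>\<^sup>+\<eta>. (\<integral>\<^sup>+\<zeta>. ennreal (Pois (of_real (rad_seq k) * \<zeta>) \<eta>) * ennreal \<bar>u \<eta>\<bar> \<partial>circ) \<partial>circ)"
    by (rule circ2.Fubini'[symmetric]) (use m in \<open>simp add: case_prod_unfold\<close>)
  also have "\<dots> = (\<integral>\<^sup>+\<eta>. ennreal \<bar>u \<eta>\<bar> \<partial>circ)"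
  proof (rule nn_integral_cong)
    fix \<eta> assume e: "\<eta> \<in> space circ"
    have "(\<integral>\<^sup>+\<zeta>. ennreal (Pois (of_real (rad_seq k) * \<zeta>) \<eta>) * ennreal \<bar>u \<eta>\<bar> \<partial>circ)
        = (\<integral>\<^sup>+\<zeta>. ennreal (Pois (of_real (rad_seq k) * \<eta>) \<zeta>) * ennreal \<bar>u \<eta>\<bar> \<partial>circ)"
      using e by (intro nn_integral_cong) (simp add: Pois_symmetric[of _ \<eta>])
    also have "\<dots> = (\<integral>\<^sup>+\<zeta>. ennreal (Pois (of_real (rad_seq k) * \<eta>) \<zeta>) \<partial>circ) * ennreal \<bar>u \<eta>\<bar>"
      by (intro nn_integral_multc mP)
    also have "\<dots> = ennreal \<bar>u \<eta>\<bar>" using e by (subst nn_integral_Pois) (auto simp: rad_disc)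
    finally show "(\<integral>\<^sup>+\<zeta>. ennreal (Pois (of_real (rad_seq k) * \<zeta>) \<eta>) * ennreal \<bar>u \<eta>\<bar> \<partial>circ) = ennreal \<bar>u \<eta>\<bar>" .
  qed
  finally show ?thesis by (simp add: mult_2 add_right_mono)
qed

definition Pconv :: "(complex \<Rightarrow> real) \<Rightarrow> bool" where
  "Pconv u \<longleftrightarrow> integrable circ u \<and> (\<forall>e>0. \<forall>\<^sub>F k in sequentially. Perr k u \<le> ennreal e)"

text \<open>The error is subadditive and bounded by the L^1 norm uniformly in the radius, so
  convergence survives L^1 limits. The distance e / 4 is doubled by \<open>Perr_le\<close>.\<close>

lemma Pconv_closed:
  assumes u: "integrable circ u"
    and ap: "\<And>e. e > 0 \<Longrightarrow> \<exists>v. Pconv v \<and> (\<integral>\<zeta>. \<bar>u \<zeta> - v \<zeta>\<bar> \<partial>circ) \<le> e"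
  shows "Pconv u"
  unfolding Pconv_def
proof (intro conjI allI impI u)
  fix e :: real assume "e > 0"
  then obtain v where v: "Pconv v" "(\<integral>\<zeta>. \<bar>u \<zeta> - v \<zeta>\<bar> \<partial>circ) \<le> e / 4" using ap[of "e / 4"] by auto
  have iv: "integrable circ v" using v(1) by (simp add: Pconv_def)
  have id: "integrable circ (\<lambda>\<zeta>. u \<zeta> - v \<zeta>)" using u iv by auto
  have "\<forall>\<^sub>F k in sequentially. Perr k v \<le> ennreal (e / 2)" using v(1) \<open>e > 0\<close> unfolding Pconv_def by (meson half_gt_zero)
  thus "\<forall>\<^sub>F k in sequentially. Perr k u \<le> ennreal e"
  proof eventually_elim
    case (elim k)
    have "Perr k u \<le> Perr k v + Perr k (\<lambda>\<zeta>. u \<zeta> - v \<zeta>)"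
      using Perr_add[OF iv id, of k] by simp
    also have "Perr k (\<lambda>\<zeta>. u \<zeta> - v \<zeta>) \<le> 2 * (\<integral>\<^sup>+\<zeta>. ennreal \<bar>u \<zeta> - v \<zeta>\<bar> \<partial>circ)" by (rule Perr_le[OF id])
    also have "(\<integral>\<^sup>+\<zeta>. ennreal \<bar>u \<zeta> - v \<zeta>\<bar> \<partial>circ) = ennreal (\<integral>\<zeta>. \<bar>u \<zeta> - v \<zeta>\<bar> \<partial>circ)"
      using id by (intro nn_integral_eq_integral) auto
    also have "2 * ennreal (\<integral>\<zeta>. \<bar>u \<zeta> - v \<zeta>\<bar> \<partial>circ) \<le> ennreal (e / 2)"
    proof -
      have "2 * ennreal (\<integral>\<zeta>. \<bar>u \<zeta> - v \<zeta>\<bar> \<partial>circ) = ennreal (2 * (\<integral>\<zeta>. \<bar>u \<zeta> - v \<zeta>\<bar> \<partial>circ))"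
        by (simp add: ennreal_mult)
      also have "\<dots> \<le> ennreal (e / 2)" using v(2) by (intro ennreal_leI) linarith
      finally show ?thesis .
    qed
    also have "Perr k v + ennreal (e / 2) \<le> ennreal (e / 2) + ennreal (e / 2)" using elim by (rule add_right_mono)
    also have "\<dots> = ennreal e" using \<open>e > 0\<close> by (simp add: ennreal_plus[symmetric] del: ennreal_plus)
    finally show ?case by (simp add: add_left_mono)
  qed
qed

lemma Pconv_add:
  assumes "Pconv u" "Pconv v"
  shows "Pconv (\<lambda>\<zeta>. u \<zeta> + v \<zeta>)"
  unfolding Pconv_def
proof (intro conjI allI impI)
  have i: "integrable circ u" "integrable circ v" using assms by (auto simp: Pconv_def)
  thus "integrable circ (\<lambda>\<zeta>. u \<zeta> + v \<zeta>)" by auto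
  fix e :: real assume e: "e > 0"
  have "\<forall>\<^sub>F k in sequentially. Perr k u \<le> ennreal (e / 2)" "\<forall>\<^sub>F k in sequentially. Perr k v \<le> ennreal (e / 2)"
    using assms e unfolding Pconv_def by (meson half_gt_zero)+
  thus "\<forall>\<^sub>F k in sequentially. Perr k (\<lambda>\<zeta>. u \<zeta> + v \<zeta>) \<le> ennreal e"
  proof eventually_elim
    case (elim k)
    have "Perr k (\<lambda>\<zeta>. u \<zeta> + v \<zeta>) \<le> Perr k u + Perr k v" by (rule Perr_add[OF i])
    also have "\<dots> \<le> ennreal (e / 2) + ennreal (e / 2)" using elim by (rule add_mono)
    also have "\<dots> = ennreal e" using e by (simp add: ennreal_plus[symmetric] del: ennreal_plus)
    finally show ?case .
  qed
qed

text \<open>On the circle the squared distance of \<eta> from \<zeta> is 2 - 2 Re (\<eta> cnj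
  \<zeta>), whose Poisson integral at r \<zeta> is exactly 2 (1 - r). AM-GM with weight \<delta> =
  sqrt (1 - r) passes from this second moment to the first, which is thus of order \<delta>,
  uniformly in \<zeta>.\<close>

lemma Pconv_Lipschitz:
  assumes L: "\<And>\<zeta> \<eta>. \<bar>u \<zeta> - u \<eta>\<bar> \<le> K * cmod (\<zeta> - \<eta>)" and K: "K \<ge> 0" and cu: "continuous_on (sphere 0 1) u"
  shows "Pconv u"
proof -
  have iu: "integrable circ u" by (rule integrable_circ_continuous[OF cu])
  have bound: "\<bar>Pint u (of_real r * \<zeta>) - u \<zeta>\<bar> \<le> 2 * K * sqrt (1 - r)" if z: "cmod \<zeta> = 1" and r: "0 < r" "r < 1" for r \<zeta>
  proof -
    define w where "w = of_real r * \<zeta>"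
    define \<delta> where "\<delta> = sqrt (1 - r)"
    have d: "\<delta> > 0" "\<delta>\<^sup>2 = 1 - r" using r by (auto simp: \<delta>_def)
    have w: "cmod w < 1" using z r by (simp add: w_def norm_mult)
    have cP: "continuous_on (sphere 0 1) (Pois w)" by (rule continuous_on_Pois[OF w])
    have 2: "(\<integral>\<eta>. Pois w \<eta> * (cmod (\<eta> - \<zeta>))\<^sup>2 \<partial>circ) = 2 - 2 * r"
    proof -
      have sq: "(cmod (\<eta> - \<zeta>))\<^sup>2 = 2 - 2 * Re (\<eta> * cnj \<zeta>)" if "cmod \<eta> = 1" for \<eta>
      proof -
        have "(cmod (\<eta> - \<zeta>))\<^sup>2 = (cmod \<eta>)\<^sup>2 + (cmod \<zeta>)\<^sup>2 - 2 * Re (\<eta> * cnj \<zeta>)"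
          unfolding cmod_power2 by (simp add: power2_eq_square algebra_simps)
        thus ?thesis using that z by simp
      qed
      have i1: "integrable circ (\<lambda>\<eta>. of_real (Pois w \<eta>) * \<eta> ^ 1 * cnj \<zeta>)"
        by (intro integrable_circ_continuous continuous_intros cP)
      have "(\<integral>\<eta>. Pois w \<eta> * (cmod (\<eta> - \<zeta>))\<^sup>2 \<partial>circ) = (\<integral>\<eta>. 2 * Pois w \<eta> - 2 * Re (of_real (Pois w \<eta>) * \<eta> ^ 1 * cnj \<zeta>) \<partial>circ)"
        by (intro Bochner_Integration.integral_cong refl) (simp add: sq algebra_simps)
      also have "\<dots> = 2 * (\<integral>\<eta>. Pois w \<eta> \<partial>circ) - 2 * Re (\<integral>\<eta>. of_real (Pois w \<eta>) * \<eta> ^ 1 * cnj \<zeta> \<partial>circ)"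
        by (subst Bochner_Integration.integral_diff[OF integrable_mult_right integrable_mult_right[OF integrable_Re[OF i1]]])
          (simp_all only: integrable_circ_continuous[OF cP] integral_mult_right_zero integral_Re[OF i1])
      also have "(\<integral>\<eta>. of_real (Pois w \<eta>) * \<eta> ^ 1 * cnj \<zeta> \<partial>circ) = w * cnj \<zeta>"
        using integral_Pois_power[OF w, of 1] by simp
      also have "w * cnj \<zeta> = of_real r" using cnj_circ[OF z] by (simp add: w_def)
      finally show ?thesis by (simp add: integral_Pois_1[OF w])
    qed
    have "Pint u w - u \<zeta> = (\<integral>\<eta>. Pois w \<eta> * (u \<eta> - u \<zeta>) \<partial>circ)"
      using integrable_Pois_mult[OF iu w] integrable_circ_continuous[OF cP]
      by (simp add: Pint_def right_diff_distrib integral_Pois_1[OF w])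
    hence "\<bar>Pint u w - u \<zeta>\<bar> \<le> (\<integral>\<eta>. \<bar>Pois w \<eta> * (u \<eta> - u \<zeta>)\<bar> \<partial>circ)"
      using integral_abs_bound[of circ "\<lambda>\<eta>. Pois w \<eta> * (u \<eta> - u \<zeta>)"] by simp
    also have "\<dots> \<le> (\<integral>\<eta>. K * (\<delta> / 2 * Pois w \<eta> + 1 / (2 * \<delta>) * (Pois w \<eta> * (cmod (\<eta> - \<zeta>))\<^sup>2)) \<partial>circ)"
    proof (rule integral_mono)
      show "integrable circ (\<lambda>\<eta>. \<bar>Pois w \<eta> * (u \<eta> - u \<zeta>)\<bar>)"
        by (intro integrable_circ_continuous continuous_intros cP cu)
      show "integrable circ (\<lambda>\<eta>. K * (\<delta> / 2 * Pois w \<eta> + 1 / (2 * \<delta>) * (Pois w \<eta> * (cmod (\<eta> - \<zeta>))\<^sup>2)))"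
        by (intro integrable_circ_continuous continuous_intros cP)
      fix \<eta> assume "\<eta> \<in> space circ"
      hence P: "Pois w \<eta> \<ge> 0" using Pois_nonneg[OF w] by simp
      have "0 \<le> (\<delta> - cmod (\<eta> - \<zeta>))\<^sup>2 / (2 * \<delta>)" using d by simp
      also have "\<dots> = \<delta> / 2 + (cmod (\<eta> - \<zeta>))\<^sup>2 / (2 * \<delta>) - cmod (\<eta> - \<zeta>)"
        using d by (simp add: power2_eq_square field_simps)
      finally have x: "cmod (\<eta> - \<zeta>) \<le> \<delta> / 2 + (cmod (\<eta> - \<zeta>))\<^sup>2 / (2 * \<delta>)" by simp
      have "\<bar>Pois w \<eta> * (u \<eta> - u \<zeta>)\<bar> \<le> Pois w \<eta> * (K * cmod (\<eta> - \<zeta>))"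
        using P L[of \<eta> \<zeta>] by (simp add: abs_mult mult_left_mono)
      also have "\<dots> \<le> Pois w \<eta> * (K * (\<delta> / 2 + (cmod (\<eta> - \<zeta>))\<^sup>2 / (2 * \<delta>)))"
        using P K x by (intro mult_left_mono) auto
      finally show "\<bar>Pois w \<eta> * (u \<eta> - u \<zeta>)\<bar> \<le> K * (\<delta> / 2 * Pois w \<eta> + 1 / (2 * \<delta>) * (Pois w \<eta> * (cmod (\<eta> - \<zeta>))\<^sup>2))"
        by (simp add: algebra_simps)
    qed
    also have "\<dots> = K * (\<delta> / 2 * (\<integral>\<eta>. Pois w \<eta> \<partial>circ) + 1 / (2 * \<delta>) * (\<integral>\<eta>. Pois w \<eta> * (cmod (\<eta> - \<zeta>))\<^sup>2 \<partial>circ))"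
    proof -
      have "integrable circ (Pois w)" "integrable circ (\<lambda>\<eta>. Pois w \<eta> * (cmod (\<eta> - \<zeta>))\<^sup>2)"
        by (intro integrable_circ_continuous continuous_intros cP)+
      thus ?thesis by (simp del: times_divide_eq_left)
    qed
    also have "\<dots> = K * (\<delta> / 2 + 1 / (2 * \<delta>) * (2 * \<delta>\<^sup>2))" by (simp only: 2 integral_Pois_1[OF w] d(2)) simp
    also have "\<dots> = K * (3 / 2 * \<delta>)" using d(1) by (simp add: power2_eq_square field_simps)
    also have "\<dots> \<le> 2 * K * \<delta>" using K d(1) by (simp add: mult_left_mono)
    finally show ?thesis by (simp add: w_def \<delta>_def)
  qed
  have "Perr k u \<le> ennreal (2 * K * sqrt (1 - rad_seq k))" for k
  proof -
    have "Perr k u \<le> (\<integral>\<^sup>+\<zeta>. ennreal (2 * K * sqrt (1 - rad_seq k)) \<partial>circ)"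
      unfolding Perr_def by (intro nn_integral_mono ennreal_leI bound rad_seq) auto
    thus ?thesis by (simp add: emeasure_space_circ)
  qed
  moreover have "(\<lambda>k. 2 * K * sqrt (1 - rad_seq k)) \<longlonglongrightarrow> 2 * K * sqrt (1 - 1)"
    by (intro tendsto_intros rad_seq_tendsto)
  hence "\<forall>\<^sub>F k in sequentially. 2 * K * sqrt (1 - rad_seq k) < e" if "e > 0" for e
    using that by (intro order_tendstoD) auto
  ultimately have "\<forall>\<^sub>F k in sequentially. Perr k u \<le> ennreal e" if "e > 0" for e
  proof -
    from \<open>\<And>e. e > 0 \<Longrightarrow> \<forall>\<^sub>F k in sequentially. 2 * K * sqrt (1 - rad_seq k) < e\<close>[OF that]
    show ?thesis
    proof eventually_elim
      case (elim k)
      have "Perr k u \<le> ennreal (2 * K * sqrt (1 - rad_seq k))" by fact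
      also have "\<dots> \<le> ennreal e" using elim by (intro ennreal_leI) simp
      finally show ?case .
    qed
  qed
  thus ?thesis using iu by (simp add: Pconv_def)
qed

lemma Pconv_compact:
  assumes "compact K" "K \<subseteq> sphere 0 1"
  shows "Pconv (\<lambda>\<zeta>. indicator K \<zeta> * c)"
\<comment> \<open>\<open>infdist\<close> to the empty set is 0 by convention, so the cutoffs below
  would not tend to the indicator.\<close>
proof (cases "K = {}")
  case True
  thus ?thesis using Pconv_Lipschitz[of "\<lambda>_. 0" 0] by simp
next
  case False
  have clK: "closed K" using assms(1) by (rule compact_imp_closed)
  have Km: "K \<in> sets circ"
  proof -
    have "K = K \<inter> sphere 0 1" using assms(2) by auto
    thus ?thesis using clK unfolding sets_circ sets_restrict_space by (metis borel_closed imageI inf_commute)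
  qed
  \<comment> \<open>Lipschitz cutoffs that fall linearly from \<open>c\<close> on \<open>K\<close>
    to 0 at distance 1 / n.\<close>
  define v where "v = (\<lambda>n \<zeta>. max 0 (1 - real n * infdist \<zeta> K) * c)"
  have vc: "continuous_on (sphere 0 1) (v n)" for n
    unfolding v_def by (intro continuous_intros)
  have vP: "Pconv (v n)" for n
  proof (rule Pconv_Lipschitz[of _ "real n * \<bar>c\<bar>", OF _ _ vc])
    fix \<zeta> \<eta> :: complex
    have "\<bar>max 0 (1 - real n * infdist \<zeta> K) - max 0 (1 - real n * infdist \<eta> K)\<bar> \<le> \<bar>real n * infdist \<eta> K - real n * infdist \<zeta> K\<bar>"
      by linarith
    also have "\<dots> = real n * \<bar>infdist \<zeta> K - infdist \<eta> K\<bar>"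
      by (simp add: right_diff_distrib[symmetric] abs_mult abs_minus_commute)
    also have "\<dots> \<le> real n * cmod (\<zeta> - \<eta>)"
      using infdist_triangle_abs[of \<zeta> K \<eta>] by (intro mult_left_mono) (auto simp: dist_norm)
    finally have "\<bar>max 0 (1 - real n * infdist \<zeta> K) - max 0 (1 - real n * infdist \<eta> K)\<bar> * \<bar>c\<bar> \<le> (real n * cmod (\<zeta> - \<eta>)) * \<bar>c\<bar>"
      by (rule mult_right_mono) simp
    moreover have "v n \<zeta> - v n \<eta> = (max 0 (1 - real n * infdist \<zeta> K) - max 0 (1 - real n * infdist \<eta> K)) * c"
      by (simp only: v_def left_diff_distrib)
    ultimately show "\<bar>v n \<zeta> - v n \<eta>\<bar> \<le> real n * \<bar>c\<bar> * cmod (\<zeta> - \<eta>)"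
      by (simp only: abs_mult mult_ac)
  qed simp
  have lim: "(\<lambda>n. v n \<zeta>) \<longlonglongrightarrow> indicator K \<zeta> * c" for \<zeta>
  proof (cases "\<zeta> \<in> K")
    case True
    hence "infdist \<zeta> K = 0" by simp
    thus ?thesis using True by (simp add: v_def)
  next
    case nK: False
    hence d: "infdist \<zeta> K > 0" using in_closed_iff_infdist_zero[OF clK False] infdist_nonneg[of \<zeta> K] by (auto simp: order.strict_iff_order)
    obtain N where N: "real N > 1 / infdist \<zeta> K" using reals_Archimedean2 by blast
    have "\<forall>\<^sub>F n in sequentially. v n \<zeta> = indicator K \<zeta> * c"
      using eventually_ge_at_top[of N]
    proof eventually_elim
      case (elim n)
      have "real n > 1 / infdist \<zeta> K" using N elim by (meson less_le_trans of_nat_le_iff)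
      hence "real n * infdist \<zeta> K > 1" using d by (simp add: field_simps)
      thus ?case using nK by (simp add: v_def)
    qed
    thus ?thesis by (rule tendsto_eventually)
  qed
  have lim0: "(\<lambda>n. \<integral>\<zeta>. \<bar>indicator K \<zeta> * c - v n \<zeta>\<bar> \<partial>circ) \<longlonglongrightarrow> (\<integral>\<zeta>. 0 \<partial>circ)"
  proof (rule integral_dominated_convergence[where w = "\<lambda>_. 2 * \<bar>c\<bar>"])
    have "(\<lambda>n. \<bar>indicator K \<zeta> * c - v n \<zeta>\<bar>) \<longlonglongrightarrow> 0" for \<zeta>
      using tendsto_rabs[OF tendsto_diff[OF tendsto_const lim[of \<zeta>]], of "indicator K \<zeta> * c"] by simp
    thus "AE \<zeta> in circ. (\<lambda>n. \<bar>indicator K \<zeta> * c - v n \<zeta>\<bar>) \<longlonglongrightarrow> 0" by simp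
    have "\<bar>indicator K \<zeta> * c - v n \<zeta>\<bar> \<le> 2 * \<bar>c\<bar>" for n \<zeta>
    proof -
      have "\<bar>v n \<zeta>\<bar> \<le> 1 * \<bar>c\<bar>" unfolding v_def abs_mult by (intro mult_right_mono) (auto simp: infdist_nonneg)
      moreover have "\<bar>indicator K \<zeta> * c\<bar> \<le> \<bar>c\<bar>" by (simp add: indicator_def)
      ultimately show ?thesis by linarith
    qed
    thus "AE \<zeta> in circ. norm \<bar>indicator K \<zeta> * c - v n \<zeta>\<bar> \<le> 2 * \<bar>c\<bar>" for n by simp
    show "(\<lambda>\<zeta>. \<bar>indicator K \<zeta> * c - v n \<zeta>\<bar>) \<in> borel_measurable circ" for n
      using borel_measurable_circ_continuous[OF vc] Km by measurable
  qed auto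
  show ?thesis
  proof (rule Pconv_closed)
    show "integrable circ (\<lambda>\<zeta>. indicator K \<zeta> * c)" using Km by (simp add: circ.emeasure_eq_measure)
    fix e :: real assume "e > 0"
    hence "\<forall>\<^sub>F n in sequentially. (\<integral>\<zeta>. \<bar>indicator K \<zeta> * c - v n \<zeta>\<bar> \<partial>circ) < e"
      using lim0 by (intro order_tendstoD) auto
    then obtain n where "(\<integral>\<zeta>. \<bar>indicator K \<zeta> * c - v n \<zeta>\<bar> \<partial>circ) < e" by (meson eventually_sequentially order_refl)
    thus "\<exists>v. Pconv v \<and> (\<integral>\<zeta>. \<bar>indicator K \<zeta> * c - v \<zeta>\<bar> \<partial>circ) \<le> e" using vP by (meson less_imp_le)
  qed
qed

lemma Pconv_indicator:
  assumes A: "A \<in> sets circ"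
  shows "Pconv (\<lambda>\<zeta>. indicator A \<zeta> * c)"
proof (rule Pconv_closed)
  show "integrable circ (\<lambda>\<zeta>. indicator A \<zeta> * c)" using A by (simp add: circ.emeasure_eq_measure)
  fix e :: real assume e: "e > 0"
  \<comment> \<open>Inner regularity is available for finite Borel measures on the whole plane,
    whereas the sets of \<open>circ\<close> live on the circle; hence the push-forward along the
    inclusion.\<close>
  define M where "M = distr circ borel (\<lambda>\<zeta>. \<zeta>)"
  have AS: "A \<subseteq> sphere 0 1" using sets.sets_into_space[OF A] by simp
  have Ab: "A \<in> sets borel"
    using A unfolding sets_circ by (auto simp: sets_restrict_space)
  have eM: "emeasure M B = emeasure circ (B \<inter> sphere 0 1)" if "B \<in> sets borel" for B
    unfolding M_def using that by (subst emeasure_distr) (auto intro!: arg_cong[where f = "emeasure circ"])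
  have fin: "emeasure M (space M) \<noteq> \<infinity>" using eM[of UNIV] by (simp add: M_def emeasure_space_circ)
  have reg: "emeasure M A = (SUP K \<in> {K. K \<subseteq> A \<and> compact K}. emeasure M K)"
    by (rule inner_regular[OF _ fin Ab]) (simp add: M_def)
  define d where "d = e / (\<bar>c\<bar> + 1)"
  have d: "d > 0" using e by (simp add: d_def)
  obtain K where K: "K \<subseteq> A" "compact K" "emeasure M A \<le> emeasure M K + ennreal d"
  proof (cases "emeasure M A = 0")
    case True thus ?thesis using that[of "{}"] by simp
  next
    case False
    have "emeasure M A \<noteq> top" using fin emeasure_mono[of A "space M" M] Ab by (auto simp: M_def top_unique)
    hence "emeasure M A - ennreal d < emeasure M A" using False d by (intro ennreal_between) (auto simp: less_top zero_less_iff_neq_zero)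
    then obtain K where "K \<subseteq> A" "compact K" "emeasure M A - ennreal d < emeasure M K"
      unfolding reg less_SUP_iff by auto
    moreover from this(3) have "emeasure M A \<le> emeasure M K + ennreal d"
      by (auto dest!: less_imp_le simp: ennreal_minus_le_iff add.commute)
    ultimately show ?thesis using that[of K] by blast
  qed
  have Kb: "K \<in> sets borel" using K(2) by (intro borel_compact)
  have Km: "K \<in> sets circ"
    unfolding sets_circ sets_restrict_space using Kb K(1) AS by (metis Int_absorb1 image_eqI inf.commute order.trans)
  have "emeasure M A = ennreal (measure circ A)" "emeasure M K = ennreal (measure circ K)"
    using K(1) AS by (simp_all add: eM Ab Kb circ.emeasure_eq_measure Int_absorb2)
  hence "ennreal (measure circ A) \<le> ennreal (measure circ K + d)" using K(3) d by simp
  hence m: "measure circ A \<le> measure circ K + d" using d by (subst (asm) ennreal_le_iff) (auto simp: add_nonneg_nonneg)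
  have "(\<integral>\<zeta>. \<bar>indicator A \<zeta> * c - indicator K \<zeta> * c\<bar> \<partial>circ) = (\<integral>\<zeta>. indicator (A - K) \<zeta> * \<bar>c\<bar> \<partial>circ)"
    using K(1) by (intro Bochner_Integration.integral_cong refl) (auto simp: indicator_def)
  also have "\<dots> = measure circ (A - K) * \<bar>c\<bar>"
  proof -
    have "(A - K) \<inter> sphere 0 1 = A - K" using AS by auto
    thus ?thesis using A Km by simp
  qed
  also have "measure circ (A - K) = measure circ A - measure circ K"
    using K(1) A Km by (intro circ.finite_measure_Diff)
  also have "(measure circ A - measure circ K) * \<bar>c\<bar> \<le> d * (\<bar>c\<bar> + 1)" using m d by (intro mult_mono) auto
  also have "\<dots> = e" by (simp add: d_def)
  finally show "\<exists>v. Pconv v \<and> (\<integral>\<zeta>. \<bar>indicator A \<zeta> * c - v \<zeta>\<bar> \<partial>circ) \<le> e"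
    using Pconv_compact[OF K(2)] K(1) AS by (intro exI[of _ "\<lambda>\<zeta>. indicator K \<zeta> * c"]) auto
qed

theorem Poisson_L1_convergence:
  assumes "integrable circ u"
  shows "Pconv u"
  using assms
proof (induction rule: integrable_induct)
  case (base A c)
  thus ?case using Pconv_indicator[of A c] by simp
next
  case (add f g)
  thus ?case using Pconv_add by blast
next
  case (lim f s)
  have [measurable]: "f \<in> borel_measurable circ" "s i \<in> borel_measurable circ" for i using lim.hyps by auto
  have l0: "(\<lambda>i. \<integral>\<zeta>. \<bar>f \<zeta> - s i \<zeta>\<bar> \<partial>circ) \<longlonglongrightarrow> (\<integral>\<zeta>. 0 \<partial>circ)"
  \<comment> \<open>The approximants supplied by the induction satisfy |s i| \<le> 2 |f|, which
    gives the 3.\<close>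
  proof (rule integral_dominated_convergence[where w = "\<lambda>\<zeta>. 3 * \<bar>f \<zeta>\<bar>"])
    show "AE \<zeta> in circ. (\<lambda>i. \<bar>f \<zeta> - s i \<zeta>\<bar>) \<longlonglongrightarrow> 0"
    proof (rule AE_I2)
      fix \<zeta> assume "\<zeta> \<in> space circ"
      from tendsto_rabs[OF tendsto_diff[OF tendsto_const lim.hyps(2)[OF this]], of "f \<zeta>"]
      show "(\<lambda>i. \<bar>f \<zeta> - s i \<zeta>\<bar>) \<longlonglongrightarrow> 0" by simp
    qed
    show "AE \<zeta> in circ. norm \<bar>f \<zeta> - s i \<zeta>\<bar> \<le> 3 * \<bar>f \<zeta>\<bar>" for i
    proof (rule AE_I2)
      fix \<zeta> assume "\<zeta> \<in> space circ"
      from lim.hyps(3)[OF this, of i] show "norm \<bar>f \<zeta> - s i \<zeta>\<bar> \<le> 3 * \<bar>f \<zeta>\<bar>" by simp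
    qed
  qed (use lim.hyps(4) in auto)
  show ?case
  proof (rule Pconv_closed[OF lim.hyps(4)])
    fix e :: real assume "e > 0"
    hence "\<forall>\<^sub>F i in sequentially. (\<integral>\<zeta>. \<bar>f \<zeta> - s i \<zeta>\<bar> \<partial>circ) < e"
      using l0 by (intro order_tendstoD) auto
    then obtain i where "(\<integral>\<zeta>. \<bar>f \<zeta> - s i \<zeta>\<bar> \<partial>circ) < e" by (meson eventually_sequentially order_refl)
    thus "\<exists>v. Pconv v \<and> (\<integral>\<zeta>. \<bar>f \<zeta> - v \<zeta>\<bar> \<partial>circ) \<le> e" using lim.IH by (meson less_imp_le)
  qed
qed

lemma Poisson_AE_subseq:
  assumes u: "integrable circ u"
  obtains s :: "nat \<Rightarrow> nat" where "strict_mono s"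
    "AE \<zeta> in circ. (\<lambda>n. Pint u (of_real (rad_seq (s n)) * \<zeta>)) \<longlonglongrightarrow> u \<zeta>"
proof -
  have [measurable]: "u \<in> borel_measurable circ" using u by auto
  let ?d = "\<lambda>k \<zeta>. Pint u (of_real (rad_seq k) * \<zeta>) - u \<zeta>"
  have int: "integrable circ (?d k)" for k
  proof (rule integrableI_bounded)
    have "(\<integral>\<^sup>+\<zeta>. ennreal (norm (?d k \<zeta>)) \<partial>circ) \<le> 2 * (\<integral>\<^sup>+\<zeta>. ennreal \<bar>u \<zeta>\<bar> \<partial>circ)"
      using Perr_le[OF u, of k] by (simp add: Perr_def)
    also have "\<dots> < \<infinity>"
      using u by (auto simp: integrable_iff_bounded ennreal_mult_less_top)
    finally show "(\<integral>\<^sup>+\<zeta>. ennreal (norm (?d k \<zeta>)) \<partial>circ) < \<infinity>" .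
  qed measurable
  have "(\<lambda>k. \<integral>\<zeta>. norm (?d k \<zeta>) \<partial>circ) \<longlonglongrightarrow> 0"
  proof (rule metric_LIMSEQ_I)
    fix e :: real assume e: "e > 0"
    have "\<forall>\<^sub>F k in sequentially. Perr k u \<le> ennreal (e / 2)"
      using Poisson_L1_convergence[OF u] e unfolding Pconv_def by (meson half_gt_zero)
    then obtain N where N: "\<And>k. k \<ge> N \<Longrightarrow> Perr k u \<le> ennreal (e / 2)" by (auto simp: eventually_sequentially)
    have "dist (\<integral>\<zeta>. norm (?d k \<zeta>) \<partial>circ) 0 < e" if "k \<ge> N" for k
    proof -
      have "ennreal (\<integral>\<zeta>. norm (?d k \<zeta>) \<partial>circ) = Perr k u"
        unfolding Perr_def using int[of k] by (subst nn_integral_eq_integral) auto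
      hence "ennreal (\<integral>\<zeta>. norm (?d k \<zeta>) \<partial>circ) \<le> ennreal (e / 2)" using N[OF that] by simp
      hence "(\<integral>\<zeta>. norm (?d k \<zeta>) \<partial>circ) \<le> e / 2" using e by (subst (asm) ennreal_le_iff) auto
      moreover have "(\<integral>\<zeta>. norm (?d k \<zeta>) \<partial>circ) \<ge> 0" by simp
      ultimately show ?thesis using e by simp
    qed
    thus "\<exists>N. \<forall>k\<ge>N. dist (\<integral>\<zeta>. norm (?d k \<zeta>) \<partial>circ) 0 < e" by blast
  qed
  from tendsto_L1_AE_subseq[OF int this]
  obtain s where s: "strict_mono s" "AE \<zeta> in circ. (\<lambda>n. ?d (s n) \<zeta>) \<longlonglongrightarrow> 0" by auto
  have "AE \<zeta> in circ. (\<lambda>n. Pint u (of_real (rad_seq (s n)) * \<zeta>)) \<longlonglongrightarrow> u \<zeta>"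
    using s(2) by eventually_elim (simp add: LIM_zero_iff)
  thus ?thesis using s(1) that by blast
qed

subsection \<open>Outer functions\<close>

text \<open>The expression in \<open>outer\<close> without its unimodular constant, extended by 0
  off the disc.\<close>

definition outer_fun :: "(complex \<Rightarrow> real) \<Rightarrow> complex \<Rightarrow> complex" where
  "outer_fun u z = (if cmod z < 1 then exp (\<integral>\<zeta>. Herg z \<zeta> * of_real (u \<zeta>) \<partial>circ) else 0)"

lemma Re_Herg_integral:
  assumes "integrable circ u" "cmod z < 1"
  shows "Re (\<integral>\<zeta>. Herg z \<zeta> * of_real (u \<zeta>) \<partial>circ) = Pint u z"
proof -
  have "integrable circ (\<lambda>\<zeta>. Herg z \<zeta> * of_real (u \<zeta>))"
    by (rule integrable_kernel_mult[OF _ continuous_on_Herg[OF assms(2)]]) (use assms(1) in auto)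
  hence "Re (\<integral>\<zeta>. Herg z \<zeta> * of_real (u \<zeta>) \<partial>circ) = (\<integral>\<zeta>. Re (Herg z \<zeta> * of_real (u \<zeta>)) \<partial>circ)"
    by (rule integral_Re[symmetric])
  also have "\<dots> = Pint u z"
    unfolding Pint_def by (intro Bochner_Integration.integral_cong refl) (simp add: Re_Herg)
  finally show ?thesis .
qed

lemma cmod_outer_fun:
  "integrable circ u \<Longrightarrow> cmod z < 1 \<Longrightarrow> cmod (outer_fun u z) = exp (Pint u z)"
  by (simp add: outer_fun_def Re_Herg_integral)

lemma outer_fun_nonzero: "cmod z < 1 \<Longrightarrow> outer_fun u z \<noteq> 0"
  by (simp add: outer_fun_def)

text \<open>The Herglotz integral is the sum of the power series from
  \<open>integral_Herg_series\<close>; its coefficients are Fourier coefficients of the density,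
  doubled except at index 0.\<close>

lemma outer_fun_analytic:
  assumes "integrable circ u"
  shows "outer_fun u \<in> analytic_disc"
proof -
  have i: "integrable circ (\<lambda>\<zeta>. complex_of_real (u \<zeta>))" using assms by auto
  define c where "c = (\<lambda>n::nat. (if n = 0 then 1 else 2) * (\<integral>\<zeta>. cnj \<zeta> ^ n * of_real (u \<zeta>) \<partial>circ))"
  have "(\<lambda>n. c n * (w - 0) ^ n) sums (\<integral>\<zeta>. Herg w \<zeta> * of_real (u \<zeta>) \<partial>circ)" if "w \<in> ball 0 1" for w
    using integral_Herg_series[OF _ i, of w] that by (simp add: c_def mult_ac)
  hence "(\<lambda>z. \<integral>\<zeta>. Herg z \<zeta> * of_real (u \<zeta>) \<partial>circ) holomorphic_on disc"
    by (rule power_series_holomorphic)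
  hence "(\<lambda>z. exp (\<integral>\<zeta>. Herg z \<zeta> * of_real (u \<zeta>) \<partial>circ)) holomorphic_on disc"
    by (intro holomorphic_intros)
  hence "outer_fun u holomorphic_on disc"
    by (rule holomorphic_transform) (simp add: outer_fun_def)
  thus ?thesis by (simp add: analytic_disc_def outer_fun_def)
qed

lemma outer_iff:
  assumes "f \<in> analytic_disc"
  shows "outer f \<longleftrightarrow> (\<exists>c u. cmod c = 1 \<and> integrable circ u \<and> f = (\<lambda>z. c * outer_fun u z))"
proof -
  have "(\<forall>z\<in>disc. f z = c * exp (\<integral>\<zeta>. (\<zeta> + z) / (\<zeta> - z) * of_real (u \<zeta>) \<partial>circ)) \<longleftrightarrow>
      f = (\<lambda>z. c * outer_fun u z)" for c u
    using analytic_disc_off[OF assms] by (auto simp: fun_eq_iff outer_fun_def Herg_def)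
  thus ?thesis unfolding outer_def by simp
qed

lemma bdry_outer_fun:
  assumes u: "integrable circ u" and c: "cmod c = 1" and F: "(\<lambda>z. c * outer_fun u z) \<in> H2"
  shows "AE \<zeta> in circ. cmod (bdry (\<lambda>z. c * outer_fun u z) \<zeta>) = exp (u \<zeta>)"
proof -
  obtain s :: "nat \<Rightarrow> nat" where s: "strict_mono s"
    "AE \<zeta> in circ. (\<lambda>n. Pint u (of_real (rad_seq (s n)) * \<zeta>)) \<longlonglongrightarrow> u \<zeta>"
    using Poisson_AE_subseq[OF u] by blast
  have "AE \<zeta> in circ. cmod \<zeta> = 1" by (rule AE_circI)
  with s(2) Fatou_H2[OF F] show ?thesis
  proof eventually_elim
    case (elim \<zeta>)
    have "(\<lambda>n. c * outer_fun u (of_real (rad_seq n) * \<zeta>)) \<longlonglongrightarrow> bdry (\<lambda>z. c * outer_fun u z) \<zeta>"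
      using radial_limit_seq[OF elim(2)] by simp
    from tendsto_norm[OF LIMSEQ_subseq_LIMSEQ[OF this s(1)]]
    have "(\<lambda>n. exp (Pint u (of_real (rad_seq (s n)) * \<zeta>))) \<longlonglongrightarrow> cmod (bdry (\<lambda>z. c * outer_fun u z) \<zeta>)"
      by (simp add: o_def norm_mult c cmod_outer_fun[OF u rad_disc[OF elim(3)]])
    moreover have "(\<lambda>n. exp (Pint u (of_real (rad_seq (s n)) * \<zeta>))) \<longlonglongrightarrow> exp (u \<zeta>)"
      by (intro tendsto_intros elim)
    ultimately show ?case by (rule LIMSEQ_unique)
  qed
qed

section \<open>Truncated densities, division by outer functions and injectivity of the
  adjoint\<close>

definition trunc_below :: "(complex \<Rightarrow> real) \<Rightarrow> nat \<Rightarrow> complex \<Rightarrow> real" where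
  "trunc_below u n \<zeta> = max (u \<zeta>) (- real n)"

lemma trunc_below_integrable: "integrable circ u \<Longrightarrow> integrable circ (trunc_below u n)"
  unfolding trunc_below_def by (intro integrable_max) auto

lemma Pint_mono_AE:
  assumes "integrable circ u" "integrable circ v" "cmod z < 1" "AE \<zeta> in circ. u \<zeta> \<le> v \<zeta>"
  shows "Pint u z \<le> Pint v z"
  unfolding Pint_def
proof (rule integral_mono_AE)
  show "AE \<zeta> in circ. Pois z \<zeta> * u \<zeta> \<le> Pois z \<zeta> * v \<zeta>"
    using assms(4) by (rule AE_mp, intro AE_circI impI) (use Pois_nonneg[OF assms(3)] in \<open>auto intro: mult_left_mono\<close>)
qed (use assms in \<open>auto intro: integrable_Pois_mult\<close>)

lemma Pint_const: "cmod z < 1 \<Longrightarrow> Pint (\<lambda>_. c) z = c"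
  unfolding Pint_def by (simp add: integral_Pois_1)

lemma Pint_trunc_tendsto:
  assumes u: "integrable circ u" and z: "cmod z < 1"
  shows "(\<lambda>n. Pint (trunc_below u n) z) \<longlonglongrightarrow> Pint u z"
  unfolding Pint_def
proof (rule integral_dominated_convergence[where w = "\<lambda>\<zeta>. Pois z \<zeta> * \<bar>u \<zeta>\<bar>"])
  show "(\<lambda>\<zeta>. Pois z \<zeta> * u \<zeta>) \<in> borel_measurable circ" "(\<lambda>\<zeta>. Pois z \<zeta> * trunc_below u n \<zeta>) \<in> borel_measurable circ" for n
    using integrable_Pois_mult[OF u z] integrable_Pois_mult[OF trunc_below_integrable[OF u] z] by auto
  show "integrable circ (\<lambda>\<zeta>. Pois z \<zeta> * \<bar>u \<zeta>\<bar>)" using u z by (intro integrable_Pois_mult) auto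
  have "(\<lambda>n. trunc_below u n \<zeta>) \<longlonglongrightarrow> u \<zeta>" for \<zeta>
  proof (rule tendsto_eventually)
    obtain N where "- u \<zeta> \<le> real N" using real_arch_simple by blast
    thus "\<forall>\<^sub>F n in sequentially. trunc_below u n \<zeta> = u \<zeta>"
      unfolding eventually_sequentially by (intro exI[of _ N]) (auto simp: trunc_below_def max_def)
  qed
  thus "AE \<zeta> in circ. (\<lambda>n. Pois z \<zeta> * trunc_below u n \<zeta>) \<longlonglongrightarrow> Pois z \<zeta> * u \<zeta>"
    by (intro AE_I2 tendsto_intros)
  have "norm (Pois z \<zeta> * trunc_below u n \<zeta>) \<le> Pois z \<zeta> * \<bar>u \<zeta>\<bar>" if "cmod \<zeta> = 1" for n \<zeta>
  proof -
    have "\<bar>trunc_below u n \<zeta>\<bar> \<le> \<bar>u \<zeta>\<bar>" by (auto simp: trunc_below_def max_def)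
    thus ?thesis using Pois_nonneg[OF z that] by (simp add: abs_mult mult_left_mono)
  qed
  thus "AE \<zeta> in circ. norm (Pois z \<zeta> * trunc_below u n \<zeta>) \<le> Pois z \<zeta> * \<bar>u \<zeta>\<bar>" for n by (rule AE_circI)
qed

text \<open>Boundedness of \<open>a\<close> bounds its density from above, truncation bounds it from
  below, so \<open>A n\<close> and its inverse are both bounded. Raising the density raises the
  modulus, on the circle as well as in the disc. Division by \<open>A n\<close> therefore stays
  among bounded functions, and \<open>A n\<close> still dominates \<open>a\<close>.\<close>

lemma outer_trunc:
  assumes a: "a \<in> Hinf" and u: "integrable circ u" and c: "cmod c = 1" and ae: "a = (\<lambda>z. c * outer_fun u z)"
  defines "A \<equiv> \<lambda>n. outer_fun (trunc_below u n)"
  shows "A n \<in> Hinf" "(\<lambda>z. inverse (A n z)) \<in> Hinf"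
    and "AE \<zeta> in circ. cmod (bdry (A n) \<zeta>) \<ge> cmod (bdry a \<zeta>)" "AE \<zeta> in circ. cmod (bdry (A n) \<zeta>) > 0"
    and "cmod z < 1 \<Longrightarrow> cmod (a z) \<le> cmod (A n z)"
proof -
  note uT = trunc_below_integrable[OF u]
  obtain B where B: "B \<ge> 0" "\<And>z. cmod (a z) \<le> B" using HinfE[OF a] by blast
  \<comment> \<open>At least 1, so that \<open>ln B'\<close> is nonnegative and also lies above the
    truncation level - n.\<close>
  define B' where "B' = max B 1"
  have aH: "(\<lambda>z. c * outer_fun u z) \<in> H2" using Hinf_H2[OF a] by (simp add: ae)
  have ba: "AE \<zeta> in circ. cmod (bdry a \<zeta>) = exp (u \<zeta>)"
    using bdry_outer_fun[OF u c aH] by (simp add: ae)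
  have "AE \<zeta> in circ. exp (u \<zeta>) \<le> B'"
    using ba bdry_bound[OF Hinf_H2[OF a] B(2)] by eventually_elim (simp add: B'_def)
  hence ul: "AE \<zeta> in circ. trunc_below u n \<zeta> \<le> ln B'"
  proof eventually_elim
    case (elim \<zeta>)
    have "u \<zeta> \<le> ln B'" using elim by (subst ln_ge_iff) (auto simp: B'_def)
    moreover have "- real n \<le> ln B'" using ln_ge_zero[of B'] by (simp add: B'_def order.trans[of _ 0])
    ultimately show ?case by (simp add: trunc_below_def)
  qed
  have up: "cmod (A n z) \<le> B'" if "cmod z < 1" for z
  proof -
    have "Pint (trunc_below u n) z \<le> Pint (\<lambda>_. ln B') z"
      by (rule Pint_mono_AE[OF uT _ that ul]) simp
    hence "exp (Pint (trunc_below u n) z) \<le> exp (ln B')" by (simp add: Pint_const[OF that])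
    thus ?thesis by (simp add: A_def cmod_outer_fun[OF uT that] B'_def)
  qed
  have lo: "cmod (A n z) \<ge> exp (- real n)" if "cmod z < 1" for z
  proof -
    have "Pint (\<lambda>_. - real n) z \<le> Pint (trunc_below u n) z"
      by (rule Pint_mono_AE[OF _ uT that]) (auto simp: trunc_below_def)
    thus ?thesis by (simp add: A_def cmod_outer_fun[OF uT that] Pint_const[OF that])
  qed
  have Aa: "A n \<in> analytic_disc" unfolding A_def by (rule outer_fun_analytic[OF uT])
  show An: "A n \<in> Hinf" by (rule HinfI[OF Aa up])
  have "(\<lambda>z. inverse (A n z)) holomorphic_on disc"
    using analytic_disc_holo[OF Aa] outer_fun_nonzero by (intro holomorphic_intros) (auto simp: A_def)
  hence "(\<lambda>z. inverse (A n z)) \<in> analytic_disc"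
    using analytic_disc_off[OF Aa] by (simp add: analytic_disc_def)
  moreover have "cmod (inverse (A n z)) \<le> exp (real n)" if "cmod z < 1" for z
    using le_imp_inverse_le[OF lo[OF that]] by (simp add: norm_inverse exp_minus)
  ultimately show "(\<lambda>z. inverse (A n z)) \<in> Hinf" by (rule HinfI)
  have AH: "(\<lambda>z. 1 * outer_fun (trunc_below u n) z) \<in> H2" using Hinf_H2[OF An] by (simp add: A_def)
  have bA: "AE \<zeta> in circ. cmod (bdry (A n) \<zeta>) = exp (trunc_below u n \<zeta>)"
    using bdry_outer_fun[OF uT _ AH] by (simp add: A_def)
  show "AE \<zeta> in circ. cmod (bdry (A n) \<zeta>) \<ge> cmod (bdry a \<zeta>)"
    using ba bA by eventually_elim (simp add: trunc_below_def)
  show "AE \<zeta> in circ. cmod (bdry (A n) \<zeta>) > 0"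
    using bA by eventually_elim simp
  show "cmod (a z) \<le> cmod (A n z)" if "cmod z < 1" for z
  proof -
    have "Pint u z \<le> Pint (trunc_below u n) z"
      by (rule Pint_mono_AE[OF u uT that]) (auto simp: trunc_below_def)
    thus ?thesis by (simp add: ae A_def norm_mult c cmod_outer_fun u uT that)
  qed
qed

text \<open>The quotient of \<open>f\<close> by \<open>A n\<close> is bounded analytic and has
  boundary modulus at most \<open>C\<close>, since \<open>A n\<close> dominates \<open>a\<close>
  there. The bound persists inside the disc, and the modulus of \<open>A n\<close> tends to that of
  \<open>a\<close> at each point.\<close>

theorem Smirnov_bound:
  assumes f: "f \<in> Hinf" and a: "a \<in> Hinf" and o: "outer a" and C: "C \<ge> 0"
    and le: "AE \<zeta> in circ. cmod (bdry f \<zeta>) \<le> C * cmod (bdry a \<zeta>)" and z: "cmod z < 1"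
  shows "cmod (f z) \<le> C * cmod (a z)"
proof -
  obtain c u where cu: "cmod c = 1" "integrable circ u" "a = (\<lambda>z. c * outer_fun u z)"
    using o outer_iff[OF Hinf_analytic[OF a]] by blast
  define A where "A = (\<lambda>n. outer_fun (trunc_below u n))"
  have A: "outer_fun (trunc_below u n) = A n" for n by (simp add: A_def)
  note tr = outer_trunc[OF a cu(2,1,3), unfolded A]
  note inv = tr(2)
  have "cmod (f z) \<le> C * cmod (A n z)" for n
  proof -
    define G where "G = (\<lambda>z. f z * inverse (A n z))"
    have G: "G \<in> H2" unfolding G_def by (intro Hinf_H2 Hinf_mult f inv)
    have AH: "A n \<in> H2" by (rule Hinf_H2[OF tr(1)])
    have nz: "A n w \<noteq> 0" if "cmod w < 1" for w using outer_fun_nonzero[OF that] by (simp add: A_def)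
    have "f = (\<lambda>z. G z * A n z)"
      using nz analytic_disc_off[OF Hinf_analytic[OF f]] by (fastforce simp: G_def fun_eq_iff not_less)
    hence "AE \<zeta> in circ. bdry f \<zeta> = bdry G \<zeta> * bdry (A n) \<zeta>"
      using bdry_mult[OF G AH] by simp
    hence "AE \<zeta> in circ. cmod (bdry G \<zeta>) \<le> C"
      using le tr(3)[of n] tr(4)[of n]
    proof eventually_elim
      case (elim \<zeta>)
      have "cmod (bdry G \<zeta>) * cmod (bdry (A n) \<zeta>) \<le> C * cmod (bdry (A n) \<zeta>)"
        using elim(1,2) mult_left_mono[OF elim(3) C] by (simp add: norm_mult)
      thus ?case using elim(4) by (rule mult_right_le_imp_le)
    qed
    hence "cmod (G z) \<le> C" by (rule Poisson_sup_bound[OF G _ z])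
    hence "cmod (G z) * cmod (A n z) \<le> C * cmod (A n z)" by (rule mult_right_mono) simp
    thus ?thesis using nz[OF z] by (simp add: G_def norm_mult[symmetric] mult.assoc)
  qed
  moreover have "(\<lambda>n. C * cmod (A n z)) \<longlonglongrightarrow> C * cmod (a z)"
    unfolding A_def cu(3)
    by (simp add: norm_mult cu(1) cmod_outer_fun[OF cu(2) z] cmod_outer_fun[OF trunc_below_integrable[OF cu(2)] z])
      (intro tendsto_intros Pint_trunc_tendsto cu z)
  ultimately show ?thesis by (intro LIMSEQ_le_const) auto
qed

lemma tcoeff_0: "f \<in> analytic_disc \<Longrightarrow> tcoeff f 0 = f 0"
  by (simp add: tcoeff_def)

text \<open>This is the cyclicity of outer functions in Beurling's theorem, in dual form. The
  hypothesis says that \<open>g\<close> is orthogonal to all multiples of \<open>a\<close>, in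
  particular to z^m times the quotient \<phi> of \<open>a\<close> by \<open>A n\<close>. These
  quotients tend in norm to the constant \<open>c\<close>, so \<open>g\<close> is orthogonal to
  every monomial.\<close>

theorem coT_outer_inj:
  assumes a: "a \<in> Hinf" and o: "outer a" and g: "g \<in> H2" and 0: "coT a g = (\<lambda>z. 0)"
  shows "g = (\<lambda>z. 0)"
proof -
  obtain c u where cu: "cmod c = 1" "integrable circ u" "a = (\<lambda>z. c * outer_fun u z)"
    using o outer_iff[OF Hinf_analytic[OF a]] by blast
  define A where "A = (\<lambda>n. outer_fun (trunc_below u n))"
  have A: "outer_fun (trunc_below u n) = A n" for n by (simp add: A_def)
  note tr = outer_trunc[OF a cu(2,1,3), unfolded A]
  note inv = tr(2)
  define \<phi> where "\<phi> = (\<lambda>n z. a z * inverse (A n z))"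
  have \<phi>: "\<phi> n \<in> Hinf" for n unfolding \<phi>_def by (intro Hinf_mult a inv)
  note \<phi>H = Hinf_H2[OF \<phi>]
  have \<phi>1: "cmod (\<phi> n z) \<le> 1" if "cmod z < 1" for n z
  proof -
    have "A n z \<noteq> 0" using outer_fun_nonzero[OF that] by (simp add: A_def)
    thus ?thesis using tr(5)[OF that, of n] by (simp add: \<phi>_def divide_inverse[symmetric] norm_divide divide_le_eq_1)
  qed
  have \<phi>b: "AE \<zeta> in circ. cmod (bdry (\<phi> n) \<zeta>) \<le> 1" for n
    by (rule bdry_bound[OF \<phi>H]) (rule \<phi>1)
  have n\<phi>: "(norm_H2 (\<phi> n))\<^sup>2 \<le> 1" for n
  proof -
    have "(norm_H2 (\<phi> n))\<^sup>2 \<le> (\<integral>\<zeta>. 1 \<partial>circ)"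
      unfolding norm_H2_def L2norm_sq
    proof (rule integral_mono_AE)
      show "AE \<zeta> in circ. (cmod (bdry (\<phi> n) \<zeta>))\<^sup>2 \<le> 1"
        using \<phi>b[of n] by eventually_elim (simp add: power_le_one)
    qed (use L2_integrable_sq[OF bdry_L2[OF \<phi>H]] in auto)
    thus ?thesis by simp
  qed
  define one where "one = mono_disc 0"
  have one: "one \<in> H2" by (simp add: one_def mono_disc_H2)
  have \<phi>0: "\<phi> n 0 = c * of_real (exp (Pint u 0 - Pint (trunc_below u n) 0))" for n
  proof -
    have "Herg 0 \<zeta> = 1" if "cmod \<zeta> = 1" for \<zeta> using that by (auto simp: Herg_def)
    hence H: "(\<integral>\<zeta>. Herg 0 \<zeta> * of_real (v \<zeta>) \<partial>circ) = of_real (Pint v 0)" if "integrable circ v" for v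
    proof -
      have P: "Pois 0 \<zeta> = 1" if "cmod \<zeta> = 1" for \<zeta> using that by (simp add: Pois_def)
      have "(\<integral>\<zeta>. Herg 0 \<zeta> * of_real (v \<zeta>) \<partial>circ) = (\<integral>\<zeta>. of_real (Pois 0 \<zeta> * v \<zeta>) \<partial>circ)"
        using \<open>\<And>\<zeta>. cmod \<zeta> = 1 \<Longrightarrow> Herg 0 \<zeta> = 1\<close> P by (intro Bochner_Integration.integral_cong refl) simp
      thus ?thesis by (simp only: integral_complex_of_real Pint_def)
    qed
    have O: "outer_fun v 0 = of_real (exp (Pint v 0))" if "integrable circ v" for v
      using H[OF that] by (simp only: outer_fun_def norm_zero zero_less_one if_True exp_of_real)
    show ?thesis
      unfolding \<phi>_def A_def cu(3)
      by (simp only: O[OF cu(2)] O[OF trunc_below_integrable[OF cu(2)]] exp_diff)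
        (simp add: divide_inverse mult.assoc)
  qed
  \<comment> \<open>\<phi> n has norm at most 1 and value \<open>c\<close> times \<open>x\<close> at
    0, with \<open>x\<close> positive and tending to 1. Expanding the square gives 1 - 2 x plus the
    squared norm of \<phi> n, hence at most 2 - 2 x.\<close>
  have lim: "(\<lambda>n. (norm_H2 (\<lambda>z. c * one z - \<phi> n z))\<^sup>2) \<longlonglongrightarrow> 0"
  proof (rule tendsto_sandwich[OF _ _ tendsto_const])
    show "\<forall>\<^sub>F n in sequentially. (norm_H2 (\<lambda>z. c * one z - \<phi> n z))\<^sup>2 \<le> 2 - 2 * exp (Pint u 0 - Pint (trunc_below u n) 0)"
    proof (rule always_eventually, rule allI)
      fix n
      define x where "x = exp (Pint u 0 - Pint (trunc_below u n) 0)"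
      have co: "(\<lambda>z. c * one z) \<in> H2" by (rule H2_scale[OF one])
      have m\<phi>: "(\<lambda>z. (- 1) * \<phi> n z) \<in> H2" by (rule H2_scale[OF \<phi>H])
      have i1: "inner_H2 one one = 1" 
        unfolding one_def by (simp add: inner_H2_mono_disc mono_disc_H2 tcoeff_0 H2_analytic) (simp add: mono_disc_def)
      have i2: "inner_H2 (\<phi> n) one = c * of_real x"
        unfolding one_def by (simp add: inner_H2_mono_disc \<phi>H tcoeff_0 H2_analytic \<phi>0 x_def)
      have cc: "c * cnj c = 1" by (rule cnj_circ[OF cu(1)])
      have "of_real ((norm_H2 (\<lambda>z. c * one z - \<phi> n z))\<^sup>2) = inner_H2 (\<lambda>z. c * one z + (- 1) * \<phi> n z) (\<lambda>z. c * one z + (- 1) * \<phi> n z)"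
        using inner_H2_self[of "\<lambda>z. c * one z - \<phi> n z"] by simp
      also have "\<dots> = (c * (cnj c * inner_H2 one one) - cnj c * inner_H2 (\<phi> n) one) + (- (c * inner_H2 one (\<phi> n)) + inner_H2 (\<phi> n) (\<phi> n))"
        by (subst inner_H2_add_left[OF co m\<phi> H2_add[OF co m\<phi>]], subst (1 2) inner_H2_add_right[OF co m\<phi>])
          (use co m\<phi> in \<open>simp_all only: inner_H2_scale_left inner_H2_scale_right one \<phi>H\<close>, simp)
      also have "inner_H2 one (\<phi> n) = cnj (c * of_real x)" using inner_H2_commute[of one "\<phi> n"] by (simp only: i2)
      also have "(c * (cnj c * inner_H2 one one) - cnj c * inner_H2 (\<phi> n) one) + (- (c * cnj (c * of_real x)) + inner_H2 (\<phi> n) (\<phi> n))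
          = c * cnj c * (1 - 2 * of_real x) + of_real ((norm_H2 (\<phi> n))\<^sup>2)"
        by (simp only: i1 i2 inner_H2_self[of "\<phi> n"]) (simp add: algebra_simps)
      also have "\<dots> = of_real (1 - 2 * x + (norm_H2 (\<phi> n))\<^sup>2)" by (simp add: cc)
      finally have "(norm_H2 (\<lambda>z. c * one z - \<phi> n z))\<^sup>2 = 1 - 2 * x + (norm_H2 (\<phi> n))\<^sup>2" by (simp only: of_real_eq_iff)
      thus "(norm_H2 (\<lambda>z. c * one z - \<phi> n z))\<^sup>2 \<le> 2 - 2 * exp (Pint u 0 - Pint (trunc_below u n) 0)"
        using n\<phi>[of n] by (simp add: x_def)
    qed
    have "(\<lambda>n. 2 - 2 * exp (Pint u 0 - Pint (trunc_below u n) 0)) \<longlonglongrightarrow> 2 - 2 * exp (Pint u 0 - Pint u 0)"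
      by (intro tendsto_intros Pint_trunc_tendsto cu) simp
    thus "(\<lambda>n. 2 - 2 * exp (Pint u 0 - Pint (trunc_below u n) 0)) \<longlonglongrightarrow> 0" by simp
  qed auto
  hence "(\<lambda>n. sqrt ((norm_H2 (\<lambda>z. c * one z - \<phi> n z))\<^sup>2)) \<longlonglongrightarrow> sqrt 0" by (rule tendsto_real_sqrt)
  hence lim': "(\<lambda>n. norm_H2 (\<lambda>z. c * one z - \<phi> n z)) \<longlonglongrightarrow> 0" by simp
  have "tcoeff g m = 0" for m
  proof -
    have mg: "coT (mono_disc m) g \<in> H2" by (rule coT_H2[OF mono_disc_Hinf g])
    have "inner_H2 g (\<lambda>z. mono_disc m z * \<phi> n z) = 0" for n
    proof -
      have "(\<lambda>z. inverse (A n z) * mono_disc m z) \<in> H2"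
        by (intro Hinf_mult_H2 inv mono_disc_H2)
      from inner_coT[OF a g this] have "inner_H2 (\<lambda>z. 0) (\<lambda>z. inverse (A n z) * mono_disc m z) = inner_H2 g (\<lambda>z. mono_disc m z * \<phi> n z)"
        by (simp add: 0 \<phi>_def mult_ac)
      moreover have "inner_H2 (\<lambda>z. 0) k = 0" if "k \<in> H2" for k
        using inner_H2_scale_left[OF H2_zero that, of 0] by simp
      ultimately show ?thesis using \<open>(\<lambda>z. inverse (A n z) * mono_disc m z) \<in> H2\<close> by metis
    qed
    hence i0: "inner_H2 (coT (mono_disc m) g) (\<phi> n) = 0" for n
      using inner_coT[OF mono_disc_Hinf g \<phi>H] by simp
    have "cmod (inner_H2 (coT (mono_disc m) g) (\<lambda>z. c * one z)) \<le> norm_H2 (coT (mono_disc m) g) * norm_H2 (\<lambda>z. c * one z - \<phi> n z)" for n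
    proof -
      have d: "(\<lambda>z. c * one z - \<phi> n z) \<in> H2" by (intro H2_diff H2_scale one \<phi>H)
      have "inner_H2 (coT (mono_disc m) g) (\<lambda>z. (c * one z - \<phi> n z) + \<phi> n z) = inner_H2 (coT (mono_disc m) g) (\<lambda>z. c * one z - \<phi> n z)"
        unfolding inner_H2_add_right[OF d \<phi>H mg] by (simp add: i0)
      thus ?thesis using inner_H2_le[OF mg d] by simp
    qed
    moreover have "(\<lambda>n. norm_H2 (coT (mono_disc m) g) * norm_H2 (\<lambda>z. c * one z - \<phi> n z)) \<longlonglongrightarrow> norm_H2 (coT (mono_disc m) g) * 0"
      by (intro tendsto_intros lim')
    ultimately have "cmod (inner_H2 (coT (mono_disc m) g) (\<lambda>z. c * one z)) \<le> norm_H2 (coT (mono_disc m) g) * 0"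
      by (intro LIMSEQ_le_const) auto
    hence "inner_H2 (coT (mono_disc m) g) (\<lambda>z. c * one z) = 0" by simp
    hence "cnj c * inner_H2 (coT (mono_disc m) g) one = 0" by (simp add: inner_H2_scale_right[OF one mg])
    moreover have "inner_H2 (coT (mono_disc m) g) one = tcoeff g m"
    proof -
      have "(\<lambda>z. mono_disc m z * one z) = mono_disc m" by (auto simp: mono_disc_def one_def)
      thus ?thesis using inner_coT[OF mono_disc_Hinf g one] by (simp add: inner_H2_mono_disc[OF g])
    qed
    ultimately show ?thesis using cu(1) by auto
  qed
  thus ?thesis by (intro analytic_disc_ext H2_analytic g analytic_disc_zero) (simp add: tcoeff_zero)
qed

subsection \<open>Uniqueness of reproducing kernel Hilbert spaces\<close>

lemma squeeze_zero:
  fixes f g :: "nat \<Rightarrow> real"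
  assumes "\<And>n. 0 \<le> f n" "\<And>n. f n \<le> g n" "g \<longlonglongrightarrow> 0"
  shows "f \<longlonglongrightarrow> 0"
  by (rule tendsto_sandwich[of "\<lambda>_. 0" f sequentially g 0]) (use assms in auto)

locale rkhs =
  fixes X :: "'a set" and K :: "'a \<Rightarrow> 'a \<Rightarrow> complex" and V :: "('a \<Rightarrow> complex) set"
    and ip :: "('a \<Rightarrow> complex) \<Rightarrow> ('a \<Rightarrow> complex) \<Rightarrow> complex"
  assumes R: "is_rkhs X K V ip"
begin

lemma off: "f \<in> V \<Longrightarrow> z \<notin> X \<Longrightarrow> f z = 0"
  and zero_mem: "(\<lambda>z. 0) \<in> V"
  and add_mem: "f \<in> V \<Longrightarrow> g \<in> V \<Longrightarrow> (\<lambda>z. f z + g z) \<in> V"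
  and scale_mem: "f \<in> V \<Longrightarrow> (\<lambda>z. c * f z) \<in> V"
  and ip_add: "f \<in> V \<Longrightarrow> g \<in> V \<Longrightarrow> h \<in> V \<Longrightarrow> ip (\<lambda>z. f z + g z) h = ip f h + ip g h"
  and ip_scale: "f \<in> V \<Longrightarrow> g \<in> V \<Longrightarrow> ip (\<lambda>z. c * f z) g = c * ip f g"
  and ip_commute: "f \<in> V \<Longrightarrow> g \<in> V \<Longrightarrow> ip g f = cnj (ip f g)"
  and ip_nonneg: "f \<in> V \<Longrightarrow> Re (ip f f) \<ge> 0"
  using R unfolding is_rkhs_def by - (elim conjE, blast)+

lemma complete:
  assumes "\<And>n. s n \<in> V"
    and "\<And>e. e > 0 \<Longrightarrow> \<exists>N. \<forall>m\<ge>N. \<forall>n\<ge>N. sqrt (Re (ip (\<lambda>z. s m z - s n z) (\<lambda>z. s m z - s n z))) < e"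
  shows "\<exists>f\<in>V. (\<lambda>n. sqrt (Re (ip (\<lambda>z. s n z - f z) (\<lambda>z. s n z - f z)))) \<longlonglongrightarrow> 0"
proof -
  have "\<forall>s :: nat \<Rightarrow> 'a \<Rightarrow> complex. (\<forall>n. s n \<in> V) \<and>
        (\<forall>e>0. \<exists>N. \<forall>m\<ge>N. \<forall>n\<ge>N.
           sqrt (Re (ip (\<lambda>z. s m z - s n z) (\<lambda>z. s m z - s n z))) < e) \<longrightarrow>
        (\<exists>f\<in>V. (\<lambda>n. sqrt (Re (ip (\<lambda>z. s n z - f z) (\<lambda>z. s n z - f z)))) \<longlonglongrightarrow> 0)"
    using R unfolding is_rkhs_def by (elim conjE)
  thus ?thesis using assms by blast
qed

definition ker :: "'a \<Rightarrow> 'a \<Rightarrow> complex" where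
  "ker w = (\<lambda>z. if z \<in> X then K w z else 0)"

lemma ker_mem: "w \<in> X \<Longrightarrow> ker w \<in> V"
  and reproducing: "w \<in> X \<Longrightarrow> f \<in> V \<Longrightarrow> ip f (ker w) = f w"
proof -
  have "\<forall>w\<in>X. ker w \<in> V \<and> (\<forall>f\<in>V. ip f (ker w) = f w)"
    using R unfolding is_rkhs_def ker_def by (elim conjE) assumption
  thus "w \<in> X \<Longrightarrow> ker w \<in> V" "w \<in> X \<Longrightarrow> f \<in> V \<Longrightarrow> ip f (ker w) = f w" by blast+
qed

lemma diff_mem: "f \<in> V \<Longrightarrow> g \<in> V \<Longrightarrow> (\<lambda>z. f z - g z) \<in> V"
  using add_mem[OF _ scale_mem[of g "-1"], of f] by simp

definition nsq :: "('a \<Rightarrow> complex) \<Rightarrow> real" where "nsq f = Re (ip f f)"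

lemma nsq_nonneg: "f \<in> V \<Longrightarrow> nsq f \<ge> 0"
  by (simp add: nsq_def ip_nonneg)

lemma ip_self: "f \<in> V \<Longrightarrow> ip f f = of_real (nsq f)"
  using ip_commute[of f f] unfolding nsq_def by (simp add: complex_eq_iff)

lemma nsq_add_scale:
  assumes "f \<in> V" "g \<in> V"
  shows "nsq (\<lambda>z. f z + c * g z) = nsq f + 2 * Re (cnj c * ip f g) + (cmod c)\<^sup>2 * nsq g"
proof -
  let ?h = "\<lambda>z. f z + c * g z"
  have h: "?h \<in> V" and cg: "(\<lambda>z. c * g z) \<in> V" using assms by (auto intro: add_mem scale_mem)
  have r: "ip k ?h = ip k f + cnj c * ip k g" if "k \<in> V" for k
  proof -
    have "ip k ?h = cnj (ip ?h k)" by (rule ip_commute[OF h that])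
    also have "\<dots> = cnj (ip f k) + cnj c * cnj (ip g k)"
      using assms that cg by (simp add: ip_add ip_scale)
    also have "\<dots> = ip k f + cnj c * ip k g"
      using ip_commute[OF assms(1) that] ip_commute[OF assms(2) that] by simp
    finally show ?thesis .
  qed
  have "ip ?h ?h = ip f ?h + c * ip g ?h" using assms h cg by (simp add: ip_add ip_scale)
  also have "\<dots> = (ip f f + cnj c * ip f g) + c * (ip g f + cnj c * ip g g)"
    by (simp only: r[OF assms(1)] r[OF assms(2)])
  also have "\<dots> = ip f f + (cnj c * ip f g + cnj (cnj c * ip f g)) + c * cnj c * ip g g"
    using ip_commute[OF assms] by (simp add: algebra_simps)
  also have "c * cnj c = of_real ((cmod c)\<^sup>2)" by (simp only: complex_norm_square)
  finally show ?thesis by (simp add: nsq_def)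
qed

text \<open>A vector that nearly minimizes its distance along \<open>k\<close> is nearly orthogonal
  to \<open>k\<close>: take the step \<open>c = - t * ip h k\<close>. For d = 0 this is a form of
  Cauchy-Schwarz; the summand 1 in \<open>nsq k + 1\<close> avoids a separate case for
  \<open>nsq k = 0\<close>.\<close>

lemma ip_bound_of_min:
  assumes h: "h \<in> V" and k: "k \<in> V" and d: "\<And>c. d \<le> nsq (\<lambda>z. h z + c * k z)"
  shows "(cmod (ip h k))\<^sup>2 \<le> (nsq h - d) * (nsq k + 1)"
proof -
  define t where "t = 1 / (nsq k + 1)"
  have k0: "nsq k \<ge> 0" by (rule nsq_nonneg[OF k])
  have t: "t > 0" "t * (nsq k + 1) = 1" using k0 by (auto simp: t_def)
  define c where "c = - (of_real t * ip h k)"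
  have c1: "Re (cnj c * ip h k) = - t * (cmod (ip h k))\<^sup>2"
  proof -
    have "cnj c * ip h k = - (of_real t * (ip h k * cnj (ip h k)))" by (simp add: c_def mult_ac)
    also have "\<dots> = of_real (- t * (cmod (ip h k))\<^sup>2)" by (simp add: complex_norm_square[symmetric] del: of_real_power)
    finally show ?thesis by (simp only: Re_complex_of_real)
  qed
  have c2: "(cmod c)\<^sup>2 = t\<^sup>2 * (cmod (ip h k))\<^sup>2" using t(1) by (simp add: c_def norm_mult power_mult_distrib)
  have "d \<le> nsq h + 2 * (- t * (cmod (ip h k))\<^sup>2) + (t\<^sup>2 * (cmod (ip h k))\<^sup>2) * nsq k"
    using d[of c] by (simp only: nsq_add_scale[OF h k] c1 c2)
  moreover have "(t\<^sup>2 * (cmod (ip h k))\<^sup>2) * nsq k \<le> t * (cmod (ip h k))\<^sup>2"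
  proof -
    have "t\<^sup>2 * nsq k \<le> t * (t * (nsq k + 1))" using t k0 by (simp add: power2_eq_square algebra_simps)
    hence "t\<^sup>2 * nsq k \<le> t" by (simp only: t(2) mult_1_right)
    hence "(t\<^sup>2 * nsq k) * (cmod (ip h k))\<^sup>2 \<le> t * (cmod (ip h k))\<^sup>2" by (rule mult_right_mono) simp
    thus ?thesis by (simp add: mult_ac)
  qed
  ultimately have "t * (cmod (ip h k))\<^sup>2 \<le> nsq h - d" by linarith
  hence "(nsq k + 1) * (t * (cmod (ip h k))\<^sup>2) \<le> (nsq k + 1) * (nsq h - d)"
    using k0 by (intro mult_left_mono) auto
  moreover have "(nsq k + 1) * (t * (cmod (ip h k))\<^sup>2) = (cmod (ip h k))\<^sup>2"
    using t(2) by (metis mult.assoc mult.commute mult_1)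
  ultimately show ?thesis by (simp add: mult.commute)
qed

lemma eval_bound:
  assumes "h \<in> V" "w \<in> X"
  shows "(cmod (h w))\<^sup>2 \<le> nsq h * (nsq (ker w) + 1)"
  using ip_bound_of_min[OF assms(1) ker_mem[OF assms(2)], of 0] nsq_nonneg[OF add_mem[OF assms(1) scale_mem[OF ker_mem[OF assms(2)]]]]
  by (simp add: reproducing assms)

text \<open>Lists of coefficients and points turn addition and scaling into append and map. The
  definition involves only \<open>X\<close> and \<open>K\<close>, so the same combination belongs to
  every Hilbert space with this kernel.\<close>

primrec comb :: "(complex \<times> 'a) list \<Rightarrow> 'a \<Rightarrow> complex" where
  "comb [] = (\<lambda>z. 0)"
| "comb (p # ps) = (\<lambda>z. fst p * ker (snd p) z + comb ps z)"

lemma comb_append: "comb (ps @ qs) z = comb ps z + comb qs z"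
  by (induction ps) auto

lemma comb_scale: "comb (map (\<lambda>p. (c * fst p, snd p)) ps) z = c * comb ps z"
  by (induction ps) (auto simp: algebra_simps)

lemma comb_mem: "snd ` set ps \<subseteq> X \<Longrightarrow> comb ps \<in> V"
  by (induction ps) (simp_all add: zero_mem add_mem scale_mem ker_mem)

lemma ip_comb:
  assumes "snd ` set ps \<subseteq> X" "g \<in> V"
  shows "ip (comb ps) g = (\<Sum>p\<leftarrow>ps. fst p * cnj (g (snd p)))"
  using assms(1)
proof (induction ps)
  case Nil
  show ?case using ip_scale[OF zero_mem assms(2), of 0] by simp
next
  case (Cons p ps)
  have w: "snd p \<in> X" using Cons.prems by simp
  have "ip (ker (snd p)) g = cnj (g (snd p))"
    using ip_commute[OF assms(2) ker_mem[OF w]] reproducing[OF w assms(2)] by simp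
  thus ?case using Cons assms(2) w by (simp add: ip_add ip_scale scale_mem ker_mem comb_mem)
qed

text \<open>\<open>s\<close> minimizes the distance from \<open>f\<close> to the span of the
  kernels. The parallelogram law makes a minimizing sequence Cauchy, and minimality makes the
  residuals asymptotically orthogonal to each kernel, that is, tend to 0 at each point.\<close>

lemma approx_by_comb:
  assumes f: "f \<in> V"
  obtains s where "\<And>n. snd ` set (s n) \<subseteq> X" "\<And>w. w \<in> X \<Longrightarrow> (\<lambda>n. comb (s n) w) \<longlonglongrightarrow> f w"
    "\<And>e. e > 0 \<Longrightarrow> \<exists>N. \<forall>m\<ge>N. \<forall>n\<ge>N. nsq (\<lambda>z. comb (s m) z - comb (s n) z) < (e :: real)"
proof -
  define D where "D = (\<lambda>ps. nsq (\<lambda>z. f z - comb ps z)) ` {ps. snd ` set ps \<subseteq> X}"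
  define d where "d = Inf D"
  have bdd: "bdd_below D" unfolding D_def
    by (intro bdd_belowI2[of _ 0]) (auto intro!: nsq_nonneg diff_mem f comb_mem)
  have ne: "D \<noteq> {}" unfolding D_def by (auto intro!: exI[of _ "[]"])
  have dle: "d \<le> nsq (\<lambda>z. f z - comb ps z)" if "snd ` set ps \<subseteq> X" for ps
    unfolding d_def by (rule cInf_lower[OF _ bdd]) (use that in \<open>auto simp: D_def\<close>)
  have "\<exists>ps. snd ` set ps \<subseteq> X \<and> nsq (\<lambda>z. f z - comb ps z) < d + 1 / real (Suc n)" for n
  proof -
    have "Inf D < d + 1 / real (Suc n)" by (simp add: d_def)
    from cInf_lessD[OF ne this] show ?thesis by (auto simp: D_def)
  qed
  then obtain s where s: "\<And>n. snd ` set (s n) \<subseteq> X" "\<And>n. nsq (\<lambda>z. f z - comb (s n) z) < d + 1 / real (Suc n)"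
    by metis
  have fs: "(\<lambda>z. f z - comb (s n) z) \<in> V" for n by (intro diff_mem f comb_mem s)
  have lim0: "(\<lambda>n. 1 / real (Suc n)) \<longlonglongrightarrow> 0" by (rule LIMSEQ_Suc[OF lim_1_over_n])
  have pt: "(\<lambda>n. comb (s n) w) \<longlonglongrightarrow> f w" if w: "w \<in> X" for w
  proof -
    have "(cmod (f w - comb (s n) w))\<^sup>2 \<le> 1 / real (Suc n) * (nsq (ker w) + 1)" for n
    proof -
      have "d \<le> nsq (\<lambda>z. (f z - comb (s n) z) + c * ker w z)" for c
      proof -
        have "(\<lambda>z. (f z - comb (s n) z) + c * ker w z) = (\<lambda>z. f z - comb ((- c, w) # s n) z)" by auto
        thus ?thesis using dle[of "(- c, w) # s n"] s(1)[of n] w by simp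
      qed
      from ip_bound_of_min[OF fs ker_mem[OF w] this]
      have "(cmod (f w - comb (s n) w))\<^sup>2 \<le> (nsq (\<lambda>z. f z - comb (s n) z) - d) * (nsq (ker w) + 1)"
        by (simp add: reproducing[OF w fs])
      also have "\<dots> \<le> 1 / real (Suc n) * (nsq (ker w) + 1)"
        using s(2)[of n] nsq_nonneg[OF ker_mem[OF w]] by (intro mult_right_mono) auto
      finally show ?thesis .
    qed
    moreover have "(\<lambda>n. 1 / real (Suc n) * (nsq (ker w) + 1)) \<longlonglongrightarrow> 0"
      using tendsto_mult_right[OF lim0, of "nsq (ker w) + 1"] by simp
    ultimately have "(\<lambda>n. (cmod (f w - comb (s n) w))\<^sup>2) \<longlonglongrightarrow> 0"
      by (rule squeeze_zero[rotated]) simp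
    from tendsto_real_sqrt[OF this] have "(\<lambda>n. cmod (f w - comb (s n) w)) \<longlonglongrightarrow> 0" by simp
    hence "(\<lambda>n. f w - comb (s n) w) \<longlonglongrightarrow> 0" by (rule tendsto_norm_zero_cancel)
    from tendsto_diff[OF tendsto_const this, of "f w"] show ?thesis by simp
  qed
  \<comment> \<open>Parallelogram identity: the midpoint \<open>ps\<close> of two combinations is
    again a combination, hence at squared distance at least \<open>d\<close> from
    \<open>f\<close>.\<close>
  have par: "nsq (\<lambda>z. comb (s m) z - comb (s n) z) \<le> 2 * (1 / real (Suc m)) + 2 * (1 / real (Suc n))" for m n
  proof -
    let ?x = "\<lambda>z. f z - comb (s n) z" and ?y = "\<lambda>z. f z - comb (s m) z"
    define ps where "ps = map (\<lambda>p. (1/2 * fst p, snd p)) (s m @ s n)"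
    have psX: "snd ` set ps \<subseteq> X" using s(1)[of m] s(1)[of n] by (auto simp: ps_def)
    have e1: "(\<lambda>z. ?x z + (- 1) * ?y z) = (\<lambda>z. comb (s m) z - comb (s n) z)" by auto
    have e2: "(\<lambda>z. ?x z + 1 * ?y z) = (\<lambda>z. 0 + 2 * (f z - comb ps z))"
    proof -
      have "comb ps z = 1 / 2 * (comb (s m) z + comb (s n) z)" for z
        unfolding ps_def comb_scale comb_append ..
      thus ?thesis by (simp add: fun_eq_iff algebra_simps)
    qed
    have 1: "nsq (\<lambda>z. comb (s m) z - comb (s n) z) = nsq ?x - 2 * Re (ip ?x ?y) + nsq ?y"
      using nsq_add_scale[OF fs[of n] fs[of m], of "-1"] unfolding e1 by simp
    have 2: "nsq (\<lambda>z. 0 + 2 * (f z - comb ps z)) = nsq ?x + 2 * Re (ip ?x ?y) + nsq ?y"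
      using nsq_add_scale[OF fs[of n] fs[of m], of 1] unfolding e2 by simp
    have fp: "(\<lambda>z. f z - comb ps z) \<in> V" by (intro diff_mem f comb_mem psX)
    have z: "ip (\<lambda>z. 0) (\<lambda>z. f z - comb ps z) = 0" "nsq (\<lambda>z. 0) = 0"
      using ip_scale[OF zero_mem fp, of 0] ip_scale[OF zero_mem zero_mem, of 0] by (simp_all add: nsq_def)
    have 3: "nsq (\<lambda>z. 0 + 2 * (f z - comb ps z)) = 4 * nsq (\<lambda>z. f z - comb ps z)"
      using nsq_add_scale[OF zero_mem fp, of 2] by (simp add: z)
    show ?thesis using 1 2 3 dle[OF psX] s(2)[of m] s(2)[of n] by linarith
  qed
  have "\<exists>N. \<forall>m\<ge>N. \<forall>n\<ge>N. nsq (\<lambda>z. comb (s m) z - comb (s n) z) < e" if e: "e > 0" for e :: real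
  proof -
    have "\<forall>\<^sub>F n in sequentially. 1 / real (Suc n) < e / 4" using e by (intro order_tendstoD(2)[OF lim0]) simp
    then obtain N where N: "\<And>n. n \<ge> N \<Longrightarrow> 1 / real (Suc n) < e / 4" by (auto simp: eventually_sequentially)
    have "nsq (\<lambda>z. comb (s m) z - comb (s n) z) < e" if "m \<ge> N" "n \<ge> N" for m n
      using par[of m n] N[OF that(1)] N[OF that(2)] by linarith
    thus ?thesis by blast
  qed
  thus ?thesis using that s(1) pt by blast
qed

end

text \<open>The norm of a kernel combination is computed from kernel values alone, so a sequence of
  combinations that is Cauchy in \<open>V1\<close> is Cauchy in \<open>V2\<close>. Evaluation is
  bounded in \<open>V2\<close>, so the limit there has the values of \<open>f\<close>.\<close>

lemma rkhs_subset:
  assumes "is_rkhs X K V1 ip1" "is_rkhs X K V2 ip2"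
  shows "V1 \<subseteq> V2"
proof
  interpret A: rkhs X K V1 ip1 by standard fact
  interpret B: rkhs X K V2 ip2 by standard fact
  fix f assume f: "f \<in> V1"
  obtain s where s: "\<And>n. snd ` set (s n) \<subseteq> X" "\<And>w. w \<in> X \<Longrightarrow> (\<lambda>n. A.comb (s n) w) \<longlonglongrightarrow> f w"
    "\<And>e. e > 0 \<Longrightarrow> \<exists>N. \<forall>m\<ge>N. \<forall>n\<ge>N. A.nsq (\<lambda>z. A.comb (s m) z - A.comb (s n) z) < (e :: real)"
    using A.approx_by_comb[OF f] by blast
  have nsq: "A.nsq (\<lambda>z. A.comb (s m) z - A.comb (s n) z) = B.nsq (\<lambda>z. A.comb (s m) z - A.comb (s n) z)" for m n
  proof -
    define ps where "ps = s m @ map (\<lambda>p. (- 1 * fst p, snd p)) (s n)"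
    have psX: "snd ` set ps \<subseteq> X" using s(1)[of m] s(1)[of n] by (auto simp: ps_def)
    have e: "(\<lambda>z. A.comb (s m) z - A.comb (s n) z) = A.comb ps"
      unfolding ps_def fun_eq_iff A.comb_append A.comb_scale by simp
    have "ip1 (A.comb ps) (A.comb ps) = ip2 (A.comb ps) (A.comb ps)"
      using A.ip_comb[OF psX A.comb_mem[OF psX]] B.ip_comb[OF psX B.comb_mem[OF psX]] by simp
    thus ?thesis by (simp add: e A.nsq_def B.nsq_def)
  qed
  have mem: "A.comb (s n) \<in> V2" for n by (rule B.comb_mem[OF s(1)])
  have "\<exists>g\<in>V2. (\<lambda>n. sqrt (Re (ip2 (\<lambda>z. A.comb (s n) z - g z) (\<lambda>z. A.comb (s n) z - g z)))) \<longlonglongrightarrow> 0"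
  proof (rule B.complete[OF mem])
    fix e :: real assume e: "e > 0"
    then obtain N where N: "\<And>m n. m \<ge> N \<Longrightarrow> n \<ge> N \<Longrightarrow> A.nsq (\<lambda>z. A.comb (s m) z - A.comb (s n) z) < e\<^sup>2"
      using s(3)[of "e\<^sup>2"] by auto
    have "sqrt (Re (ip2 (\<lambda>z. A.comb (s m) z - A.comb (s n) z) (\<lambda>z. A.comb (s m) z - A.comb (s n) z))) < e" if "m \<ge> N" "n \<ge> N" for m n
    proof -
      have "sqrt (A.nsq (\<lambda>z. A.comb (s m) z - A.comb (s n) z)) < sqrt (e\<^sup>2)"
        by (rule real_sqrt_less_mono[OF N[OF that]])
      also have "sqrt (e\<^sup>2) = e" using e by simp
      finally show ?thesis by (simp only: nsq B.nsq_def)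
    qed
    thus "\<exists>N. \<forall>m\<ge>N. \<forall>n\<ge>N. sqrt (Re (ip2 (\<lambda>z. A.comb (s m) z - A.comb (s n) z) (\<lambda>z. A.comb (s m) z - A.comb (s n) z))) < e" by blast
  qed
  then obtain g where g: "g \<in> V2" "(\<lambda>n. sqrt (B.nsq (\<lambda>z. A.comb (s n) z - g z))) \<longlonglongrightarrow> 0"
    unfolding B.nsq_def by blast
  have "f z = g z" for z
  proof (cases "z \<in> X")
    case z: True
    have "(\<lambda>n. A.comb (s n) z) \<longlonglongrightarrow> g z"
    proof -
      have "cmod (A.comb (s n) z - g z) \<le> sqrt (B.nsq (\<lambda>z. A.comb (s n) z - g z)) * sqrt (B.nsq (B.ker z) + 1)" for n
        using B.eval_bound[OF B.diff_mem[OF mem g(1)] z, of n]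
        unfolding real_sqrt_mult[symmetric] by (rule real_le_rsqrt)
      moreover have "(\<lambda>n. sqrt (B.nsq (\<lambda>z. A.comb (s n) z - g z)) * sqrt (B.nsq (B.ker z) + 1)) \<longlonglongrightarrow> 0"
        using tendsto_mult_right[OF g(2), of "sqrt (B.nsq (B.ker z) + 1)"] by simp
      ultimately have "(\<lambda>n. cmod (A.comb (s n) z - g z)) \<longlonglongrightarrow> 0"
        by (rule squeeze_zero[rotated]) simp
      hence "(\<lambda>n. A.comb (s n) z - g z) \<longlonglongrightarrow> 0" by (rule tendsto_norm_zero_cancel)
      thus ?thesis by (simp add: LIM_zero_iff)
    qed
    with s(2)[OF z] show ?thesis by (rule LIMSEQ_unique)
  qed (use A.off[OF f] B.off[OF g(1)] in simp)
  hence "f = g" by auto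
  thus "f \<in> V2" using g(1) by simp
qed

lemma dBR_space_eqI:
  assumes "V \<subseteq> analytic_disc" "is_rkhs disc (dBR_kernel b) V ip"
  shows "dBR_space b = V"
  unfolding dBR_space_def
proof (rule the_equality)
  show "V \<subseteq> analytic_disc \<and> (\<exists>ip. is_rkhs disc (dBR_kernel b) V ip)" using assms by blast
  show "W = V" if "W \<subseteq> analytic_disc \<and> (\<exists>ip. is_rkhs disc (dBR_kernel b) W ip)" for W
    using that rkhs_subset[OF assms(2)] rkhs_subset[OF _ assms(2)] by blast
qed

subsection \<open>De Branges-Rovnyak spaces\<close>

definition szego :: "complex \<Rightarrow> complex \<Rightarrow> complex" where
  "szego w z = (if cmod z < 1 then 1 / (1 - cnj w * z) else 0)"

lemma szego_sums:
  assumes "cmod w < 1" "cmod z < 1"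
  shows "(\<lambda>n. cnj w ^ n * z ^ n) sums szego w z"
proof -
  have "cmod (cnj w * z) < 1" 
    using assms mult_strict_mono'[of "cmod w" 1 "cmod z" 1] by (simp add: norm_mult)
  thus ?thesis using geometric_sums[of "cnj w * z"] assms by (simp add: szego_def power_mult_distrib)
qed

lemma szego_H2:
  assumes "cmod w < 1"
  shows "szego w \<in> H2" "tcoeff (szego w) = (\<lambda>n. cnj w ^ n)"
proof -
  note s = szego_sums[OF assms]
  show t: "tcoeff (szego w) = (\<lambda>n. cnj w ^ n)" by (rule tcoeff_unique[OF s]) (auto simp: szego_def)
  have "(cmod w)\<^sup>2 < 1" using assms by (simp add: abs_square_less_1)
  hence "summable (\<lambda>n. ((cmod w)\<^sup>2) ^ n)" by (intro summable_geometric) simp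
  hence "summable (\<lambda>n. (cmod (tcoeff (szego w) n))\<^sup>2)"
    unfolding t by (simp add: norm_power power_mult[symmetric] mult.commute)
  thus "szego w \<in> H2"
    unfolding H2_iff by (auto intro!: analytic_discI_sums[OF s] simp: szego_def)
qed

lemma szego_reproducing:
  assumes "f \<in> H2" "cmod w < 1"
  shows "inner_H2 f (szego w) = f w" "inner_H2 (szego w) f = cnj (f w)"
proof -
  show "inner_H2 f (szego w) = f w"
    using inner_H2_sums[OF assms(1) szego_H2(1)[OF assms(2)]] tcoeff_sums[OF H2_analytic[OF assms(1)] assms(2)]
    by (simp add: szego_H2(2)[OF assms(2)] sums_iff)
  thus "inner_H2 (szego w) f = cnj (f w)" using inner_H2_commute[of "szego w" f] by simp
qed

text \<open>The de Branges-Rovnyak space of \<open>b\<close> is realized on the graph of \<open>f \<mapsto> plus f\<close> (the function \<open>f\<^sup>+\<close> of the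
  literature), as a closed subspace of the direct sum of two copies of \<open>H2\<close>.\<close>

locale pyth_pair =
  fixes b a :: "complex \<Rightarrow> complex"
  assumes b: "b \<in> Hinf" and a: "a \<in> Hinf" and oa: "outer a"
    and pyth: "AE \<zeta> in circ. (cmod (bdry a \<zeta>))\<^sup>2 + (cmod (bdry b \<zeta>))\<^sup>2 = 1"
begin

definition V :: "(complex \<Rightarrow> complex) set" where
  "V = {f \<in> H2. \<exists>g\<in>H2. coT b f = coT a g}"

text \<open>The choice is unique by \<open>coT_inj\<close>, which is why \<open>VI\<close> can
  compute \<open>plus\<close>.\<close>

definition plus :: "(complex \<Rightarrow> complex) \<Rightarrow> complex \<Rightarrow> complex" where
  "plus f = (SOME g. g \<in> H2 \<and> coT b f = coT a g)"

lemma V_H2: "f \<in> V \<Longrightarrow> f \<in> H2"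
  by (simp add: V_def)

lemma plus:
  assumes "f \<in> V"
  shows "plus f \<in> H2 \<and> coT b f = coT a (plus f)"
proof -
  obtain g where "g \<in> H2 \<and> coT b f = coT a g" using assms by (auto simp: V_def)
  thus ?thesis unfolding plus_def by (rule someI[where P = "\<lambda>g. g \<in> H2 \<and> coT b f = coT a g"])
qed

lemma plus_H2: "f \<in> V \<Longrightarrow> plus f \<in> H2"
  using plus by blast

lemma coT_plus: "f \<in> V \<Longrightarrow> coT b f = coT a (plus f)"
  using plus by blast

lemma coT_inj:
  assumes "g \<in> H2" "h \<in> H2" "coT a g = coT a h"
  shows "g = h"
proof -
  have "coT a (\<lambda>z. g z + (- 1) * h z) = (\<lambda>z. coT a g z + (- 1) * coT a h z)"
    by (simp only: coT_add[OF a assms(1) H2_scale[OF assms(2)]] coT_scale[OF a assms(2)])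
  hence "coT a (\<lambda>z. g z + (- 1) * h z) = (\<lambda>z. 0)" by (simp add: assms(3))
  from coT_outer_inj[OF a oa H2_add[OF assms(1) H2_scale[OF assms(2)]] this]
  show ?thesis by (auto simp: fun_eq_iff)
qed

lemma VI: 
  assumes "f \<in> H2" "g \<in> H2" "coT b f = coT a g"
  shows "f \<in> V" "plus f = g"
proof -
  show f: "f \<in> V" using assms by (auto simp: V_def)
  show "plus f = g" by (rule coT_inj[OF plus_H2[OF f] assms(2)]) (simp add: assms(3) coT_plus[OF f, symmetric])
qed

lemma V_zero: "(\<lambda>z. 0) \<in> V"
proof -
  have "coT c (\<lambda>z. 0) = (\<lambda>z. 0)" if "c \<in> Hinf" for c
    using coT_scale[OF that H2_zero, of 0] by simp
  thus ?thesis by (intro VI(1)[OF H2_zero H2_zero]) (simp add: a b)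
qed

lemma V_add: 
  assumes "f \<in> V" "g \<in> V"
  shows "(\<lambda>z. f z + g z) \<in> V" "plus (\<lambda>z. f z + g z) = (\<lambda>z. plus f z + plus g z)"
proof -
  have "coT b (\<lambda>z. f z + g z) = coT a (\<lambda>z. plus f z + plus g z)"
    by (simp only: coT_add[OF b V_H2[OF assms(1)] V_H2[OF assms(2)]]
      coT_add[OF a plus_H2[OF assms(1)] plus_H2[OF assms(2)]] coT_plus[OF assms(1)] coT_plus[OF assms(2)])
  thus "(\<lambda>z. f z + g z) \<in> V" "plus (\<lambda>z. f z + g z) = (\<lambda>z. plus f z + plus g z)"
    using VI[OF H2_add[OF V_H2[OF assms(1)] V_H2[OF assms(2)]] H2_add[OF plus_H2[OF assms(1)] plus_H2[OF assms(2)]]] by blast+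
qed

lemma V_scale: 
  assumes "f \<in> V"
  shows "(\<lambda>z. c * f z) \<in> V" "plus (\<lambda>z. c * f z) = (\<lambda>z. c * plus f z)"
proof -
  have "coT b (\<lambda>z. c * f z) = coT a (\<lambda>z. c * plus f z)"
    by (simp only: coT_scale[OF b V_H2[OF assms]] coT_scale[OF a plus_H2[OF assms]] coT_plus[OF assms])
  thus "(\<lambda>z. c * f z) \<in> V" "plus (\<lambda>z. c * f z) = (\<lambda>z. c * plus f z)"
    using VI[OF H2_scale[OF V_H2[OF assms]] H2_scale[OF plus_H2[OF assms]]] by blast+
qed

lemma V_diff: 
  assumes "f \<in> V" "g \<in> V"
  shows "(\<lambda>z. f z - g z) \<in> V" "plus (\<lambda>z. f z - g z) = (\<lambda>z. plus f z - plus g z)"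
  using V_add[OF assms(1) V_scale(1)[OF assms(2), of "-1"]] V_scale(2)[OF assms(2), of "-1"] by simp_all

definition ip :: "(complex \<Rightarrow> complex) \<Rightarrow> (complex \<Rightarrow> complex) \<Rightarrow> complex" where
  "ip f g = inner_H2 f g + inner_H2 (plus f) (plus g)"

lemma ip_self: "ip f f = of_real ((norm_H2 f)\<^sup>2 + (norm_H2 (plus f))\<^sup>2)"
  unfolding ip_def inner_H2_self by simp

text \<open>On the circle the two integrands add up to (|a|^2 + |b|^2) times the third one. In other
  words, s -> (b s, a s) is an isometry into the direct sum.\<close>

lemma pyth_inner:
  assumes "s \<in> H2" "h \<in> H2"
  shows "inner_H2 (\<lambda>z. b z * s z) (\<lambda>z. b z * h z) + inner_H2 (\<lambda>z. a z * s z) (\<lambda>z. a z * h z) = inner_H2 s h"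
proof -
  note H = Hinf_mult_H2[OF b assms(1)] Hinf_mult_H2[OF b assms(2)] Hinf_mult_H2[OF a assms(1)] Hinf_mult_H2[OF a assms(2)]
  note I = L2_product_integrable(3)[OF bdry_L2[OF H(1)] bdry_L2[OF H(2)]] L2_product_integrable(3)[OF bdry_L2[OF H(3)] bdry_L2[OF H(4)]]
    L2_product_integrable(3)[OF bdry_L2[OF assms(1)] bdry_L2[OF assms(2)]]
  have "inner_H2 (\<lambda>z. b z * s z) (\<lambda>z. b z * h z) + inner_H2 (\<lambda>z. a z * s z) (\<lambda>z. a z * h z)
    = (\<integral>\<zeta>. bdry (\<lambda>z. b z * s z) \<zeta> * cnj (bdry (\<lambda>z. b z * h z) \<zeta>) + bdry (\<lambda>z. a z * s z) \<zeta> * cnj (bdry (\<lambda>z. a z * h z) \<zeta>) \<partial>circ)"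
    unfolding inner_H2_def by (rule Bochner_Integration.integral_add[symmetric, OF I(1,2)])
  also have "\<dots> = inner_H2 s h"
    unfolding inner_H2_def
  proof (rule integral_cong_AE)
    show "AE \<zeta> in circ. bdry (\<lambda>z. b z * s z) \<zeta> * cnj (bdry (\<lambda>z. b z * h z) \<zeta>) + bdry (\<lambda>z. a z * s z) \<zeta> * cnj (bdry (\<lambda>z. a z * h z) \<zeta>)
        = bdry s \<zeta> * cnj (bdry h \<zeta>)"
      using bdry_mult[OF Hinf_H2[OF b] assms(1)] bdry_mult[OF Hinf_H2[OF b] assms(2)]
        bdry_mult[OF Hinf_H2[OF a] assms(1)] bdry_mult[OF Hinf_H2[OF a] assms(2)] pyth
    proof eventually_elim
      case (elim \<zeta>)
      have "bdry (\<lambda>z. b z * s z) \<zeta> * cnj (bdry (\<lambda>z. b z * h z) \<zeta>) + bdry (\<lambda>z. a z * s z) \<zeta> * cnj (bdry (\<lambda>z. a z * h z) \<zeta>)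
         = (bdry a \<zeta> * cnj (bdry a \<zeta>) + bdry b \<zeta> * cnj (bdry b \<zeta>)) * (bdry s \<zeta> * cnj (bdry h \<zeta>))"
        by (simp only: elim(1-4)) (simp add: algebra_simps)
      also have "bdry a \<zeta> * cnj (bdry a \<zeta>) + bdry b \<zeta> * cnj (bdry b \<zeta>) = of_real ((cmod (bdry a \<zeta>))\<^sup>2 + (cmod (bdry b \<zeta>))\<^sup>2)"
        by (simp only: of_real_add complex_norm_square)
      finally show ?case by (simp only: elim(5)) simp
    qed
    show "(\<lambda>\<zeta>. bdry (\<lambda>z. b z * s z) \<zeta> * cnj (bdry (\<lambda>z. b z * h z) \<zeta>) + bdry (\<lambda>z. a z * s z) \<zeta> * cnj (bdry (\<lambda>z. a z * h z) \<zeta>)) \<in> borel_measurable circ"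
      by (intro borel_measurable_integrable Bochner_Integration.integrable_add I)
    show "(\<lambda>\<zeta>. bdry s \<zeta> * cnj (bdry h \<zeta>)) \<in> borel_measurable circ"
      by (intro borel_measurable_integrable I)
  qed
  finally show ?thesis .
qed

definition kb :: "complex \<Rightarrow> complex \<Rightarrow> complex" where
  "kb w = (\<lambda>z. szego w z + (- cnj (b w)) * (b z * szego w z))"

lemma kb_eq: "(\<lambda>z. if z \<in> disc then dBR_kernel b w z else 0) = kb w"
  by (auto simp: fun_eq_iff kb_def dBR_kernel_def szego_def diff_divide_distrib)

text \<open>\<open>coT b\<close> maps \<open>szego w\<close> to \<open>cnj (b w)\<close> times
  itself. What remains is \<open>cnj (b w)\<close> times \<open>szego w\<close> minus the image of b
  \<open>szego w\<close> under \<open>coT b\<close>, and \<open>pyth_inner\<close> rewrites this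
  difference as the image of a \<open>szego w\<close> under \<open>coT a\<close>.\<close>

lemma kb_V:
  assumes w: "cmod w < 1"
  shows "kb w \<in> V" "plus (kb w) = (\<lambda>z. cnj (b w) * (a z * szego w z))"
proof -
  have s: "szego w \<in> H2" by (rule szego_H2(1)[OF w])
  have bs: "(\<lambda>z. b z * szego w z) \<in> H2" and as: "(\<lambda>z. a z * szego w z) \<in> H2"
    using Hinf_mult_H2 a b s by auto
  have k: "kb w \<in> H2" unfolding kb_def by (intro H2_add H2_scale s bs)
  have g: "(\<lambda>z. cnj (b w) * (a z * szego w z)) \<in> H2" by (intro H2_scale as)
  have "coT b (kb w) = coT a (\<lambda>z. cnj (b w) * (a z * szego w z))"
  proof (rule coT_eqI[OF b k coT_H2[OF a g]])
    fix h assume h: "h \<in> H2"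
    have bh: "(\<lambda>z. b z * h z) \<in> H2" and ah: "(\<lambda>z. a z * h z) \<in> H2" using Hinf_mult_H2 a b h by auto
    have "inner_H2 (kb w) (\<lambda>z. b z * h z) = inner_H2 (szego w) (\<lambda>z. b z * h z) + (- cnj (b w)) * inner_H2 (\<lambda>z. b z * szego w z) (\<lambda>z. b z * h z)"
      unfolding kb_def by (simp only: inner_H2_add_left[OF s H2_scale[OF bs] bh] inner_H2_scale_left[OF bs bh])
    also have "\<dots> = cnj (b w) * (inner_H2 (szego w) h - inner_H2 (\<lambda>z. b z * szego w z) (\<lambda>z. b z * h z))"
      by (simp add: szego_reproducing(2)[OF bh w] szego_reproducing(2)[OF h w] algebra_simps)
    also have "\<dots> = cnj (b w) * inner_H2 (\<lambda>z. a z * szego w z) (\<lambda>z. a z * h z)"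
      by (simp add: pyth_inner[OF s h, symmetric])
    finally show "inner_H2 (coT a (\<lambda>z. cnj (b w) * (a z * szego w z))) h = inner_H2 (kb w) (\<lambda>z. b z * h z)"
      by (simp add: inner_coT[OF a g h] inner_H2_scale_left[OF as ah])
  qed
  from VI[OF k g this] show "kb w \<in> V" "plus (kb w) = (\<lambda>z. cnj (b w) * (a z * szego w z))" .
qed

text \<open>The term with \<open>b\<close> from the first copy cancels the term with
  \<open>a\<close> from the second by \<open>coT_plus\<close>; the Szego kernel then reproduces
  \<open>f w\<close>.\<close>

lemma ip_kb:
  assumes w: "cmod w < 1" and f: "f \<in> V"
  shows "ip f (kb w) = f w"
proof -
  have s: "szego w \<in> H2" by (rule szego_H2(1)[OF w])
  have bs: "(\<lambda>z. b z * szego w z) \<in> H2" and as: "(\<lambda>z. a z * szego w z) \<in> H2"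
    using Hinf_mult_H2 a b s by auto
  note fH = V_H2[OF f] and pH = plus_H2[OF f]
  have "inner_H2 f (\<lambda>z. b z * szego w z) = inner_H2 (plus f) (\<lambda>z. a z * szego w z)"
    using inner_coT[OF b fH s] inner_coT[OF a pH s] coT_plus[OF f] by simp
  thus ?thesis
    unfolding ip_def kb_V(2)[OF w] unfolding kb_def
    by (simp only: inner_H2_add_right[OF s H2_scale[OF bs] fH] inner_H2_scale_right[OF bs fH]
        inner_H2_scale_right[OF as pH] szego_reproducing(1)[OF fH w]) simp
qed

text \<open>A Cauchy sequence for \<open>ip\<close> converges in both coordinates of the graph, and
  the relation \<open>coT b f = coT a g\<close>, tested against a fixed \<open>k\<close>, passes to
  the limit.\<close>

lemma V_complete:
  assumes s: "\<And>n. s n \<in> V"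
    and C: "\<And>e. e > 0 \<Longrightarrow> \<exists>N. \<forall>m\<ge>N. \<forall>n\<ge>N. sqrt (Re (ip (\<lambda>z. s m z - s n z) (\<lambda>z. s m z - s n z))) < e"
  shows "\<exists>f\<in>V. (\<lambda>n. sqrt (Re (ip (\<lambda>z. s n z - f z) (\<lambda>z. s n z - f z)))) \<longlonglongrightarrow> 0"
proof -
  have ipd: "Re (ip (\<lambda>z. f z - g z) (\<lambda>z. f z - g z)) = (norm_H2 (\<lambda>z. f z - g z))\<^sup>2 + (norm_H2 (\<lambda>z. plus f z - plus g z))\<^sup>2"
    if "f \<in> V" "g \<in> V" for f g
    by (simp only: ip_self V_diff(2)[OF that] Re_complex_of_real)
  have le: "norm_H2 (\<lambda>z. s m z - s n z) \<le> sqrt (Re (ip (\<lambda>z. s m z - s n z) (\<lambda>z. s m z - s n z)))"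
    "norm_H2 (\<lambda>z. plus (s m) z - plus (s n) z) \<le> sqrt (Re (ip (\<lambda>z. s m z - s n z) (\<lambda>z. s m z - s n z)))" for m n
    by (auto simp: ipd[OF s s] intro!: real_le_rsqrt)
  obtain f where f: "f \<in> H2" "(\<lambda>n. norm_H2 (\<lambda>z. s n z - f z)) \<longlonglongrightarrow> 0"
  proof (rule H2_complete[of s])
    show "s n \<in> H2" for n by (rule V_H2[OF s])
    show "\<exists>N. \<forall>m\<ge>N. \<forall>n\<ge>N. norm_H2 (\<lambda>z. s m z - s n z) < e" if "e > 0" for e
      using C[OF that] le(1) by (meson le_less_trans)
  qed blast
  obtain g where g: "g \<in> H2" "(\<lambda>n. norm_H2 (\<lambda>z. plus (s n) z - g z)) \<longlonglongrightarrow> 0"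
  proof (rule H2_complete[of "\<lambda>n. plus (s n)"])
    show "plus (s n) \<in> H2" for n by (rule plus_H2[OF s])
    show "\<exists>N. \<forall>m\<ge>N. \<forall>n\<ge>N. norm_H2 (\<lambda>z. plus (s m) z - plus (s n) z) < e" if "e > 0" for e
      using C[OF that] le(2) by (meson le_less_trans)
  qed blast
  have lim: "(\<lambda>n. inner_H2 (t n) k) \<longlonglongrightarrow> inner_H2 x k"
    if "\<And>n. t n \<in> H2" "x \<in> H2" "(\<lambda>n. norm_H2 (\<lambda>z. t n z - x z)) \<longlonglongrightarrow> 0" "k \<in> H2" for t x k
  proof -
    have d: "(\<lambda>z. t n z - x z) \<in> H2" for n by (intro H2_diff that)
    have "cmod (inner_H2 (t n) k - inner_H2 x k) \<le> norm_H2 (\<lambda>z. t n z - x z) * norm_H2 k" for n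
    proof -
      have "inner_H2 (\<lambda>z. (t n z - x z) + x z) k = inner_H2 (\<lambda>z. t n z - x z) k + inner_H2 x k"
        by (rule inner_H2_add_left[OF d that(2,4)])
      hence "inner_H2 (t n) k - inner_H2 x k = inner_H2 (\<lambda>z. t n z - x z) k" by simp
      thus ?thesis using inner_H2_le[OF d that(4)] by simp
    qed
    moreover have "(\<lambda>n. norm_H2 (\<lambda>z. t n z - x z) * norm_H2 k) \<longlonglongrightarrow> 0"
      using tendsto_mult_right[OF that(3), of "norm_H2 k"] by simp
    ultimately have "(\<lambda>n. cmod (inner_H2 (t n) k - inner_H2 x k)) \<longlonglongrightarrow> 0"
      by (rule squeeze_zero[rotated]) simp
    hence "(\<lambda>n. inner_H2 (t n) k - inner_H2 x k) \<longlonglongrightarrow> 0" by (rule tendsto_norm_zero_cancel)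
    thus ?thesis by (simp add: LIM_zero_iff)
  qed
  have "coT b f = coT a g"
  proof (rule coT_eqI[OF b f(1) coT_H2[OF a g(1)]])
    fix k assume k: "k \<in> H2"
    have bk: "(\<lambda>z. b z * k z) \<in> H2" and ak: "(\<lambda>z. a z * k z) \<in> H2" using Hinf_mult_H2 a b k by auto
    have "inner_H2 (s n) (\<lambda>z. b z * k z) = inner_H2 (plus (s n)) (\<lambda>z. a z * k z)" for n
      using inner_coT[OF b V_H2[OF s] k] inner_coT[OF a plus_H2[OF s] k] coT_plus[OF s] by metis
    hence "(\<lambda>n. inner_H2 (s n) (\<lambda>z. b z * k z)) \<longlonglongrightarrow> inner_H2 g (\<lambda>z. a z * k z)"
      using lim[OF plus_H2[OF s] g ak] by simp
    with lim[OF V_H2[OF s] f bk] have "inner_H2 f (\<lambda>z. b z * k z) = inner_H2 g (\<lambda>z. a z * k z)"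
      by (rule LIMSEQ_unique)
    thus "inner_H2 (coT a g) k = inner_H2 f (\<lambda>z. b z * k z)" by (simp add: inner_coT[OF a g(1) k])
  qed
  note fV = VI[OF f(1) g(1) this]
  have "(\<lambda>n. sqrt ((norm_H2 (\<lambda>z. s n z - f z))\<^sup>2 + (norm_H2 (\<lambda>z. plus (s n) z - g z))\<^sup>2)) \<longlonglongrightarrow> sqrt (0\<^sup>2 + 0\<^sup>2)"
    by (intro tendsto_intros f(2) g(2))
  hence "(\<lambda>n. sqrt (Re (ip (\<lambda>z. s n z - f z) (\<lambda>z. s n z - f z)))) \<longlonglongrightarrow> 0"
    by (simp add: ipd[OF s fV(1)] fV(2))
  thus ?thesis using fV(1) by blast
qed

lemma is_rkhs_V: "is_rkhs disc (dBR_kernel b) V ip"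
  unfolding is_rkhs_def
proof (intro conjI)
  show "\<forall>f\<in>V. \<forall>z. z \<notin> disc \<longrightarrow> f z = 0"
    using analytic_disc_off[OF H2_analytic[OF V_H2]] by auto
  show "(\<lambda>z. 0) \<in> V" by (rule V_zero)
  show "\<forall>f\<in>V. \<forall>g\<in>V. (\<lambda>z. f z + g z) \<in> V" using V_add(1) by blast
  show "\<forall>c. \<forall>f\<in>V. (\<lambda>z. c * f z) \<in> V" using V_scale(1) by blast
  show "\<forall>f\<in>V. \<forall>g\<in>V. \<forall>h\<in>V. ip (\<lambda>z. f z + g z) h = ip f h + ip g h"
    by (auto simp: ip_def V_add(2) inner_H2_add_left V_H2 plus_H2)
  show "\<forall>c. \<forall>f\<in>V. \<forall>g\<in>V. ip (\<lambda>z. c * f z) g = c * ip f g"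
    by (auto simp: ip_def V_scale(2) inner_H2_scale_left V_H2 plus_H2 distrib_left)
  have "ip g f = cnj (ip f g)" for f g
    using inner_H2_commute[of g f] inner_H2_commute[of "plus g" "plus f"] by (simp add: ip_def)
  thus "\<forall>f\<in>V. \<forall>g\<in>V. ip g f = cnj (ip f g)" by blast
  show "\<forall>f\<in>V. Re (ip f f) \<ge> 0 \<and> (ip f f = 0 \<longrightarrow> f = (\<lambda>z. 0))"
  proof (intro ballI conjI impI)
    fix f assume f: "f \<in> V"
    show "Re (ip f f) \<ge> 0" by (simp only: ip_self Re_complex_of_real) simp
    assume "ip f f = 0"
    hence "(norm_H2 f)\<^sup>2 + (norm_H2 (plus f))\<^sup>2 = 0" by (simp only: ip_self of_real_eq_0_iff)
    hence "norm_H2 f = 0" by (simp add: sum_power2_eq_zero_iff)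
    thus "f = (\<lambda>z. 0)" by (rule norm_H2_zero_iff[OF V_H2[OF f]])
  qed
  show "\<forall>s :: nat \<Rightarrow> complex \<Rightarrow> complex. (\<forall>n. s n \<in> V) \<and>
        (\<forall>e>0. \<exists>N. \<forall>m\<ge>N. \<forall>n\<ge>N.
           sqrt (Re (ip (\<lambda>z. s m z - s n z) (\<lambda>z. s m z - s n z))) < e) \<longrightarrow>
        (\<exists>f\<in>V. (\<lambda>n. sqrt (Re (ip (\<lambda>z. s n z - f z) (\<lambda>z. s n z - f z)))) \<longlonglongrightarrow> 0)"
    using V_complete by blast
  show "\<forall>w\<in>disc. (\<lambda>z. if z \<in> disc then dBR_kernel b w z else 0) \<in> V \<and>
        (\<forall>f\<in>V. ip f (\<lambda>z. if z \<in> disc then dBR_kernel b w z else 0) = f w)"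
    unfolding kb_eq using kb_V(1) ip_kb by auto
qed

theorem dBR_space_eq: "dBR_space b = V"
  by (rule dBR_space_eqI[OF _ is_rkhs_V]) (auto intro: H2_analytic V_H2)

text \<open>Write T for \<open>coT\<close>. Applying T of a g1 + b g2 = 1 to \<open>f\<close> gives
  f = T_a T_g1 f + T_g2 T_b f, and T_b f = T_a (plus f) puts the second summand into the range of
  T_a as well. Conversely T_b T_a g = T_a T_b g exhibits T_a g as a member of
  \<open>V\<close>.\<close>

theorem dBR_space_corona:
  assumes g1: "g1 \<in> Hinf" and g2: "g2 \<in> Hinf"
    and corona: "\<And>z. cmod z < 1 \<Longrightarrow> a z * g1 z + b z * g2 z = 1"
  shows "dBR_space b = coT a ` H2"
  unfolding dBR_space_eq
proof (intro equalityI subsetI)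
  fix f assume f: "f \<in> V"
  note fH = V_H2[OF f] and pH = plus_H2[OF f]
  have one: "(\<lambda>z. g1 z * a z + b z * g2 z) = mono_disc 0"
    using corona analytic_disc_off[OF Hinf_analytic[OF a]] analytic_disc_off[OF Hinf_analytic[OF b]]
    by (auto simp: fun_eq_iff mono_disc_def mult.commute[of "g1 _"])
  have "f = coT (\<lambda>z. g1 z * a z + b z * g2 z) f" by (simp only: one coT_one[OF fH])
  also have "\<dots> = (\<lambda>z. coT a (coT g1 f) z + coT g2 (coT b f) z)"
    by (simp only: coT_add_symbol[OF Hinf_mult[OF g1 a] Hinf_mult[OF b g2] fH] coT_coT[OF a g1 fH] coT_coT[OF g2 b fH])
  also have "coT g2 (coT b f) = coT a (coT g2 (plus f))"
    unfolding coT_plus[OF f] coT_coT[OF g2 a pH] coT_coT[OF a g2 pH] by (simp add: mult.commute)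
  also have "(\<lambda>z. coT a (coT g1 f) z + coT a (coT g2 (plus f)) z) = coT a (\<lambda>z. coT g1 f z + coT g2 (plus f) z)"
    by (rule coT_add[symmetric, OF a coT_H2[OF g1 fH] coT_H2[OF g2 pH]])
  finally show "f \<in> coT a ` H2" using H2_add[OF coT_H2[OF g1 fH] coT_H2[OF g2 pH]] by (rule image_eqI)
next
  fix f assume "f \<in> coT a ` H2"
  then obtain g where g: "g \<in> H2" "f = coT a g" by blast
  have "coT b f = coT a (coT b g)"
    unfolding g(2) coT_coT[OF b a g(1)] coT_coT[OF a b g(1)] by (simp add: mult.commute)
  thus "f \<in> V" using VI(1)[OF coT_H2[OF a g(1)] coT_H2[OF b g(1)]] g(2) by simp
qed

end

subsection \<open>Division by outer functions\<close>

lemma outer_nonzero: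
  assumes "a \<in> analytic_disc" "outer a" "cmod z < 1"
  shows "a z \<noteq> 0"
proof -
  obtain c u where "cmod c = 1" "a = (\<lambda>z. c * outer_fun u z)"
    using outer_iff[OF assms(1)] assms(2) by blast
  thus ?thesis using outer_fun_nonzero[OF assms(3), of u] by auto
qed

lemma Hinf_quotient:
  assumes f: "f \<in> Hinf" and a: "a \<in> Hinf" and nz: "\<And>z. cmod z < 1 \<Longrightarrow> a z \<noteq> 0"
    and le: "\<And>z. cmod z < 1 \<Longrightarrow> cmod (f z) \<le> C * cmod (a z)"
  obtains G where "G \<in> Hinf" "f = (\<lambda>z. G z * a z)"
proof -
  define G where "G = (\<lambda>z. f z / a z)"
  have fa: "f \<in> analytic_disc" and aa: "a \<in> analytic_disc" using f a by (auto intro: Hinf_analytic)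
  have "G holomorphic_on disc" unfolding G_def
    using nz by (intro holomorphic_intros analytic_disc_holo fa aa) auto
  hence Ga: "G \<in> analytic_disc"
    using analytic_disc_off[OF fa] by (simp add: analytic_disc_def G_def)
  have "G \<in> Hinf"
  proof (rule HinfI[OF Ga])
    show "cmod (G z) \<le> C" if "cmod z < 1" for z
      using le[OF that] nz[OF that] by (simp add: G_def norm_divide divide_le_eq)
  qed
  moreover have "f z = G z * a z" for z
    using nz[of z] analytic_disc_off[OF fa, of z] by (cases "cmod z < 1") (auto simp: G_def)
  ultimately show ?thesis using that by blast
qed

text \<open>The factorization f = G a turns into \<open>coT f k = coT a (coT G k)\<close>.\<close>

lemma coT_range_subset:
  assumes f: "f \<in> Hinf" and a: "a \<in> Hinf" and o: "outer a" and C: "C \<ge> 0"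
    and le: "AE \<zeta> in circ. cmod (bdry f \<zeta>) \<le> C * cmod (bdry a \<zeta>)"
  shows "coT f ` H2 \<subseteq> coT a ` H2"
proof -
  obtain G where G: "G \<in> Hinf" "f = (\<lambda>z. G z * a z)"
    using Hinf_quotient[OF f a outer_nonzero[OF Hinf_analytic[OF a] o] Smirnov_bound[OF f a o C le]] by blast
  show ?thesis
  proof (intro subsetI, elim imageE)
    fix h k assume "h = coT f k" "k \<in> H2"
    hence "h = coT a (coT G k)" unfolding G(2) by (simp add: coT_coT[OF a G(1)])
    thus "h \<in> coT a ` H2" using coT_H2[OF G(1) \<open>k \<in> H2\<close>] by blast
  qed
qed

subsection \<open>Powers\<close>

lemma one_minus_powr_bounds:
  fixes y s :: real
  assumes "0 \<le> y" "y \<le> 1" "1 \<le> s"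
  shows "1 - y \<le> 1 - y powr s" "1 - y powr s \<le> s * (1 - y)"
proof -
  show "1 - y \<le> 1 - y powr s" using powr_mono'[of 1 s y] assms by simp
  show "1 - y powr s \<le> s * (1 - y)"
  proof (cases "y = 0 \<or> y = 1")
    case True
    thus ?thesis using assms by auto
  next
    case False
    hence y: "0 < y" "y < 1" using assms by auto
    have "\<exists>z>y. z < 1 \<and> 1 powr s - y powr s = (1 - y) * (s * z powr (s - 1))"
      by (rule MVT2) (use y in \<open>auto intro!: has_real_derivative_powr\<close>)
    then obtain z where z: "y < z" "z < 1" "1 powr s - y powr s = (1 - y) * (s * z powr (s - 1))" by blast
    have "z powr (s - 1) \<le> 1" using z y assms by (intro powr_le1) auto
    hence "(1 - y) * (s * z powr (s - 1)) \<le> (1 - y) * (s * 1)" using y assms by (intro mult_left_mono) auto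
    thus ?thesis using z(3) by (simp add: mult.commute)
  qed
qed

text \<open>For r < 1 the preceding bounds are used with exponent 1 / r at the point
  \<open>y powr r\<close>. The constant 1 + r + 1 / r dominates each of 1, r and 1 / r, so it serves
  all cases.\<close>

lemma one_minus_powr_comparable:
  fixes y r :: real
  assumes "0 \<le> y" "y \<le> 1" "0 < r"
  shows "1 - y powr r \<le> (1 + r + 1 / r) * (1 - y)" "1 - y \<le> (1 + r + 1 / r) * (1 - y powr r)"
proof -
  have p: "0 \<le> y powr r" "y powr r \<le> 1" using assms by (auto intro: powr_le1)
  have C: "1 \<le> 1 + r + 1 / r" "r \<le> 1 + r + 1 / r" "1 / r \<le> 1 + r + 1 / r" using assms by auto
  have up: "c * (1 - y) \<le> (1 + r + 1 / r) * (1 - y)" "c * (1 - y powr r) \<le> (1 + r + 1 / r) * (1 - y powr r)"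
    if "c \<le> 1 + r + 1 / r" for c
    using that assms p by (auto intro: mult_right_mono)
  show "1 - y powr r \<le> (1 + r + 1 / r) * (1 - y)"
  proof (cases "1 \<le> r")
    case True
    thus ?thesis using one_minus_powr_bounds(2)[OF assms(1,2) True] up(1)[OF C(2)] by linarith
  next
    case False
    hence "1 \<le> 1 / r" using assms by simp
    from one_minus_powr_bounds(1)[OF p this] have "1 - y powr r \<le> 1 - y"
      using assms by (simp add: powr_powr)
    thus ?thesis by (rule order_trans) (use up(1)[OF C(1)] in \<open>simp only: mult_1_left\<close>)
  qed
  show "1 - y \<le> (1 + r + 1 / r) * (1 - y powr r)"
  proof (cases "1 \<le> r")
    case True
    show ?thesis using one_minus_powr_bounds(1)[OF assms(1,2) True]
      by (rule order_trans) (use up(2)[OF C(1)] in \<open>simp only: mult_1_left\<close>)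
  next
    case False
    hence "1 \<le> 1 / r" using assms by simp
    from one_minus_powr_bounds(2)[OF p this] have "1 - y \<le> 1 / r * (1 - y powr r)"
      using assms by (simp add: powr_powr)
    thus ?thesis using up(2)[OF C(3)] by linarith
  qed
qed

lemma disc_power_b_Hinf:
  assumes q: "q \<in> b_Hinf" and L: "analytic_log q L" and r: "r > 0"
  shows "disc_power L r \<in> b_Hinf"
    and "cmod z < 1 \<Longrightarrow> cmod (disc_power L r z) = cmod (q z) powr r"
proof -
  have e: "exp (L z) = q z" if "cmod z < 1" for z using L that by (simp add: analytic_log_def)
  show n: "cmod (disc_power L r z) = cmod (q z) powr r" if "cmod z < 1" for z
    using that by (simp add: disc_power_def e[OF that, symmetric] powr_def)
  have "(\<lambda>z. exp (of_real r * L z)) holomorphic_on disc"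
    using L by (auto simp: analytic_log_def intro!: holomorphic_intros)
  hence "disc_power L r holomorphic_on disc"
    by (rule holomorphic_transform) (simp add: disc_power_def)
  moreover have "cmod (disc_power L r z) \<le> 1" if "cmod z < 1" for z
    unfolding n[OF that] using q that r by (intro powr_le1) (auto simp: b_Hinf_def)
  ultimately show "disc_power L r \<in> b_Hinf"
    by (auto simp: b_Hinf_def analytic_disc_def disc_power_def)
qed

lemma bdry_disc_power:
  assumes q: "q \<in> b_Hinf" and L: "analytic_log q L" and r: "r > 0"
  shows "AE \<zeta> in circ. cmod (bdry (disc_power L r) \<zeta>) = cmod (bdry q \<zeta>) powr r"
proof -
  have H: "disc_power L r \<in> H2" "q \<in> H2"
    using disc_power_b_Hinf(1)[OF assms] q by (auto intro: Hinf_H2 b_Hinf_Hinf)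
  have "AE \<zeta> in circ. cmod \<zeta> = 1" by (rule AE_circI)
  with Fatou_H2[OF H(1)] Fatou_H2[OF H(2)] show ?thesis
  proof eventually_elim
    case (elim \<zeta>)
    \<comment> \<open>The boundary value of \<open>q\<close> may be 0; continuity of
      \<open>powr\<close> there rests on r > 0.\<close>
    have "(\<lambda>k. cmod (q (of_real (rad_seq k) * \<zeta>)) powr r) \<longlonglongrightarrow> cmod (bdry q \<zeta>) powr r"
      using r by (intro tendsto_powr' tendsto_norm radial_limit_seq[OF elim(2)] tendsto_const) auto
    moreover have "(\<lambda>k. cmod (q (of_real (rad_seq k) * \<zeta>)) powr r) \<longlonglongrightarrow> cmod (bdry (disc_power L r) \<zeta>)"
      using tendsto_norm[OF radial_limit_seq[OF elim(1)]]
      by (simp add: disc_power_b_Hinf(2)[OF assms rad_disc[OF elim(3)]])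
    ultimately show ?case by (rule LIMSEQ_unique[symmetric])
  qed
qed

text \<open>With y = |q|^2 on the circle, the squared moduli of the two mates are 1 - y and 1 -
  y^r.\<close>

lemma mates_comparable:
  assumes q: "q \<in> b_Hinf" and L: "analytic_log q L" and r: "r > 0"
    and a: "pythagorean_mate q a" and a': "pythagorean_mate (disc_power L r) a'"
  obtains C where "C \<ge> 0" "AE \<zeta> in circ. cmod (bdry a' \<zeta>) \<le> C * cmod (bdry a \<zeta>)"
    "AE \<zeta> in circ. cmod (bdry a \<zeta>) \<le> C * cmod (bdry a' \<zeta>)"
proof -
  define K where "K = 1 + r + 1 / r"
  have K: "K \<ge> 0" using r by (simp add: K_def)
  have qb: "AE \<zeta> in circ. cmod (bdry q \<zeta>) \<le> 1"
    by (rule bdry_bound[OF Hinf_H2[OF b_Hinf_Hinf[OF q]]]) (use q in \<open>simp add: b_Hinf_def\<close>)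
  have "AE \<zeta> in circ. (cmod (bdry a' \<zeta>))\<^sup>2 \<le> K * (cmod (bdry a \<zeta>))\<^sup>2 \<and> (cmod (bdry a \<zeta>))\<^sup>2 \<le> K * (cmod (bdry a' \<zeta>))\<^sup>2"
    using qb bdry_disc_power[OF q L r] a[unfolded pythagorean_mate_def, THEN conjunct2, THEN conjunct2, THEN conjunct2, THEN conjunct2]
      a'[unfolded pythagorean_mate_def, THEN conjunct2, THEN conjunct2, THEN conjunct2, THEN conjunct2]
  proof eventually_elim
    case (elim \<zeta>)
    define y where "y = (cmod (bdry q \<zeta>))\<^sup>2"
    have y: "0 \<le> y" "y \<le> 1" using elim(1) by (auto simp: y_def power_le_one)
    have "(cmod (bdry q \<zeta>) powr r)\<^sup>2 = y powr r"
      unfolding y_def power2_eq_square by (simp add: powr_mult)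
    hence "(cmod (bdry a \<zeta>))\<^sup>2 = 1 - y" "(cmod (bdry a' \<zeta>))\<^sup>2 = 1 - y powr r"
      using elim(2-4) by (auto simp: y_def)
    thus ?case using one_minus_powr_comparable[OF y r] by (simp add: K_def)
  qed
  note sq = this
  have s: "x \<le> sqrt K * y" if "x\<^sup>2 \<le> K * y\<^sup>2" "0 \<le> x" "0 \<le> y" for x y
  proof -
    have "sqrt (x\<^sup>2) \<le> sqrt (K * y\<^sup>2)" using that(1) by (rule real_sqrt_le_mono)
    thus ?thesis using that by (simp add: real_sqrt_mult)
  qed
  have "AE \<zeta> in circ. cmod (bdry a' \<zeta>) \<le> sqrt K * cmod (bdry a \<zeta>)"
    using sq by eventually_elim (auto intro: s)
  moreover have "AE \<zeta> in circ. cmod (bdry a \<zeta>) \<le> sqrt K * cmod (bdry a' \<zeta>)"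
    using sq by eventually_elim (auto intro: s)
  ultimately show ?thesis using that[of "sqrt K"] K by simp
qed

subsection \<open>Rational functions\<close>

text \<open>In a representation whose denominator has least degree, a common root, inside or outside
  the disc, could be cancelled.\<close>

lemma rational_no_common_roots:
  fixes f :: "complex \<Rightarrow> complex"
  assumes "rational_on_disc f"
  shows "\<exists>p d :: complex poly. (\<forall>z. cmod z < 1 \<longrightarrow> poly d z \<noteq> 0 \<and> f z = poly p z / poly d z) \<and>
    (\<forall>z. \<not> (poly p z = 0 \<and> poly d z = 0))"
proof -
  define Q where "Q = (\<lambda>p d :: complex poly. \<forall>z. cmod z < 1 \<longrightarrow> poly d z \<noteq> 0 \<and> f z = poly p z / poly d z)"
  define n where "n = (LEAST n. \<exists>p d. Q p d \<and> degree d = n)"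
  obtain p0 d0 where "Q p0 d0" using assms unfolding rational_on_disc_def Q_def by force
  hence "\<exists>n p d. Q p d \<and> degree d = n" by blast
  hence "\<exists>p d. Q p d \<and> degree d = n" unfolding n_def by (rule LeastI_ex)
  then obtain p d where pd: "Q p d" "degree d = n" by blast
  have "\<not> (poly p z = 0 \<and> poly d z = 0)" for z
  proof
    assume "poly p z = 0 \<and> poly d z = 0"
    then obtain p' d' where e: "p = [:- z, 1:] * p'" "d = [:- z, 1:] * d'"
      unfolding poly_eq_0_iff_dvd dvd_def by blast
    have "poly d' w \<noteq> 0 \<and> f w = poly p' w / poly d' w" if "cmod w < 1" for w
    proof -
      have w: "poly d w \<noteq> 0" "f w = poly p w / poly d w" using pd(1) that by (auto simp: Q_def)
      have "w - z \<noteq> 0" "poly d' w \<noteq> 0" using w(1) unfolding e(2) by auto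
      moreover have "poly p w = (w - z) * poly p' w" "poly d w = (w - z) * poly d' w"
        unfolding e by (simp_all add: algebra_simps)
      ultimately show ?thesis using w(2) by simp
    qed
    hence "Q p' d'" by (simp add: Q_def)
    hence "n \<le> degree d'" unfolding n_def by (intro Least_le) blast
    moreover have "d' \<noteq> 0" using pd(1)[unfolded Q_def, rule_format, of 0] e(2) by auto
    hence "degree d = 1 + degree d'" unfolding e(2) by (subst degree_mult_eq) auto
    ultimately show False using pd(2) by simp
  qed
  hence "\<forall>z. \<not> (poly p z = 0 \<and> poly d z = 0)" by blast
  with pd(1)[unfolded Q_def] show ?thesis by (intro exI conjI)
qed

text \<open>A nonzero element \<open>g\<close> of least degree in the ideal generated by
  \<open>w\<close> and \<open>p\<close> divides both, so it has no roots and is constant by the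
  fundamental theorem of algebra.\<close>

lemma Bezout_no_common_roots:
  fixes p w :: "complex poly"
  assumes "\<And>z. \<not> (poly w z = 0 \<and> poly p z = 0)"
  obtains u v where "w * u + p * v = 1"
proof -
  define S where "S = {w * u + p * v | u v. True}"
  have SI: "w * u + p * v \<in> S" for u v unfolding S_def by blast
  have wS: "w \<in> S" and pS: "p \<in> S" using SI[of 1 0] SI[of 0 1] by simp_all
  have "w \<noteq> 0 \<or> p \<noteq> 0" using assms[of 0] by auto
  then obtain x where "x \<in> S \<and> x \<noteq> 0" using wS pS by blast
  then obtain g where g: "g \<in> S" "g \<noteq> 0" and min: "\<And>h. h \<in> S \<Longrightarrow> h \<noteq> 0 \<Longrightarrow> degree g \<le> degree h"
    using ex_has_least_nat[of "\<lambda>g. g \<in> S \<and> g \<noteq> 0" x degree] by blast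
  obtain u v where uv: "g = w * u + p * v" using g(1) by (auto simp: S_def)
  have dvd: "g dvd h" if hS: "h \<in> S" for h
  proof -
    obtain u' v' where h: "h = w * u' + p * v'" using hS by (auto simp: S_def)
    have "h mod g = h - g * (h div g)" by (simp add: minus_mult_div_eq_mod)
    also have "\<dots> = w * (u' - u * (h div g)) + p * (v' - v * (h div g))"
      by (subst (1) h, subst (1) uv) (simp add: algebra_simps)
    finally have "h mod g \<in> S" using SI by simp
    hence "h mod g = 0" using min[of "h mod g"] degree_mod_less[OF g(2), of h] by force
    thus ?thesis by (simp add: mod_eq_0_iff_dvd)
  qed
  have roots: "poly g z \<noteq> 0" for z
    using assms[of z] dvd[OF wS] dvd[OF pS] by (auto elim!: dvdE)
  obtain c where c: "c \<noteq> 0" "g = [:c:]" using fundamental_theorem_of_algebra_alt[of g] roots by blast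
  have "w * smult (inverse c) u + p * smult (inverse c) v = smult (inverse c) g"
    by (simp add: uv smult_add_right)
  also have "\<dots> = 1" using c by (simp add: one_pCons)
  finally show ?thesis using that by blast
qed

text \<open>\<open>circ_reflect N p\<close> is \<open>z\<^sup>N\<close> times the reflection of \<open>p\<close> in the unit circle, so that
  \<open>p \<cdot> circ_reflect N p\<close> equals \<open>z\<^sup>N \<bar>p\<bar>\<^sup>2\<close> on the circle.\<close>

definition circ_reflect :: "nat \<Rightarrow> complex poly \<Rightarrow> complex poly" where
  "circ_reflect N p = monom 1 (N - degree p) * reflect_poly (map_poly cnj p)"

lemma poly_circ_reflect:
  assumes "degree p \<le> N" "z \<noteq> 0"
  shows "poly (circ_reflect N p) z = z ^ N * cnj (poly p (1 / cnj z))"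
proof -
  have "degree (map_poly cnj p) = degree p" by (rule degree_map_poly) simp
  thus ?thesis
    using assms by (simp add: circ_reflect_def poly_monom poly_reflect_poly_nz mult.assoc[symmetric] power_add[symmetric]
        inverse_eq_divide)
qed

lemma poly_circ_reflect_circ:
  assumes "degree p \<le> N" "cmod \<zeta> = 1"
  shows "poly (circ_reflect N p) \<zeta> = \<zeta> ^ N * cnj (poly p \<zeta>)"
proof -
  have "\<zeta> \<noteq> 0" using assms(2) by auto
  have "cnj \<zeta> \<noteq> 0" using \<open>\<zeta> \<noteq> 0\<close> by simp
  hence "1 / cnj \<zeta> = \<zeta>" using cnj_circ[OF assms(2)] by (simp add: divide_eq_eq)
  thus ?thesis using poly_circ_reflect[OF assms(1) \<open>\<zeta> \<noteq> 0\<close>] by simp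
qed

section \<open>The corona equation for a rational symbol and its mate\<close>

theorem rational_corona:
  assumes q: "q \<in> b_Hinf" and rat: "rational_on_disc q" and oq: "outer q" and a: "pythagorean_mate q a"
  obtains g1 g2 where "g1 \<in> Hinf" "g2 \<in> Hinf" "\<And>z. cmod z < 1 \<Longrightarrow> a z * g1 z + q z * g2 z = 1"
proof -
  obtain p d :: "complex poly" where pd': "\<forall>z. cmod z < 1 \<longrightarrow> poly d z \<noteq> 0 \<and> q z = poly p z / poly d z"
    and ncr': "\<forall>z. \<not> (poly p z = 0 \<and> poly d z = 0)"
    using rational_no_common_roots[OF rat] by (elim exE conjE)
  note pd = pd'[rule_format] and ncr = ncr'[rule_format]
  have qa: "q \<in> analytic_disc" and q1: "\<And>z. cmod z < 1 \<Longrightarrow> cmod (q z) \<le> 1"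
    using q by (auto simp: b_Hinf_def)
  have aB: "a \<in> b_Hinf" and oa: "outer a" and pyth: "AE \<zeta> in circ. (cmod (bdry a \<zeta>))\<^sup>2 + (cmod (bdry q \<zeta>))\<^sup>2 = 1"
    using a by (auto simp: pythagorean_mate_def)
  have aI: "a \<in> Hinf" by (rule b_Hinf_Hinf[OF aB])
  have p0: "poly p z \<noteq> 0" if "cmod z < 1" for z
    using outer_nonzero[OF qa oq that] pd[OF that] by auto
  have le1: "cmod (poly p \<zeta>) \<le> cmod (poly d \<zeta>)" if "cmod \<zeta> = 1" for \<zeta>
  proof (rule LIMSEQ_le)
    have "(\<lambda>k. of_real (rad_seq k) * \<zeta>) \<longlonglongrightarrow> of_real 1 * \<zeta>"
      by (intro tendsto_intros rad_seq_tendsto)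
    hence l: "(\<lambda>k. of_real (rad_seq k) * \<zeta>) \<longlonglongrightarrow> \<zeta>" by simp
    show "(\<lambda>k. cmod (poly p (of_real (rad_seq k) * \<zeta>))) \<longlonglongrightarrow> cmod (poly p \<zeta>)"
      "(\<lambda>k. cmod (poly d (of_real (rad_seq k) * \<zeta>))) \<longlonglongrightarrow> cmod (poly d \<zeta>)"
      by (intro tendsto_intros l)+
    have "cmod (poly p (of_real (rad_seq k) * \<zeta>)) \<le> cmod (poly d (of_real (rad_seq k) * \<zeta>))" for k
      using q1[OF rad_disc[OF that, of k]] pd[OF rad_disc[OF that, of k]] by (simp add: norm_divide divide_le_eq)
    thus "\<exists>N. \<forall>k\<ge>N. cmod (poly p (of_real (rad_seq k) * \<zeta>)) \<le> cmod (poly d (of_real (rad_seq k) * \<zeta>))" by blast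
  qed
  \<comment> \<open>On the circle |p| \<le> |d|, so a zero of \<open>d\<close> there would be a zero
    of \<open>p\<close> too.\<close>
  have d0: "poly d z \<noteq> 0" if "cmod z \<le> 1" for z
  proof (cases "cmod z < 1")
    case False
    hence "cmod z = 1" using that by simp
    thus ?thesis using le1[of z] ncr[of z] by auto
  qed (use pd in blast)
  have bq: "bdry q \<zeta> = poly p \<zeta> / poly d \<zeta>" if "cmod \<zeta> = 1" for \<zeta>
  proof (rule bdry_continuous(2)[OF _ _ that, of "\<lambda>z. poly p z / poly d z"])
    show "continuous_on (cball 0 1) (\<lambda>z. poly p z / poly d z)"
      using d0 by (intro continuous_intros) auto
  qed (use pd in blast)
  define N where "N = max (degree p) (degree d)"
  define W where "W = d * circ_reflect N d - p * circ_reflect N p"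
  have Wc: "cmod (poly W \<zeta>) = (cmod (poly d \<zeta>))\<^sup>2 - (cmod (poly p \<zeta>))\<^sup>2" if z: "cmod \<zeta> = 1" for \<zeta>
  proof -
    have "poly W \<zeta> = \<zeta> ^ N * (poly d \<zeta> * cnj (poly d \<zeta>) - poly p \<zeta> * cnj (poly p \<zeta>))"
      by (simp add: W_def poly_circ_reflect_circ[OF _ z] N_def algebra_simps)
    also have "\<dots> = \<zeta> ^ N * of_real ((cmod (poly d \<zeta>))\<^sup>2 - (cmod (poly p \<zeta>))\<^sup>2)"
      by (simp only: of_real_diff complex_norm_square)
    finally have "cmod (poly W \<zeta>) = \<bar>(cmod (poly d \<zeta>))\<^sup>2 - (cmod (poly p \<zeta>))\<^sup>2\<bar>"
      by (simp only: norm_mult norm_power z norm_of_real) simp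
    moreover have "(cmod (poly p \<zeta>))\<^sup>2 \<le> (cmod (poly d \<zeta>))\<^sup>2" using le1[OF z] by (rule power_mono) simp
    ultimately show ?thesis by simp
  qed
  \<comment> \<open>\<open>q\<close> is outer, so the zeros of \<open>p\<close> satisfy |z| \<ge> 1.
    At such a zero \<open>W\<close> reduces to \<open>d\<close> times its reflection, and the
    reflection vanishes only if \<open>d\<close> vanishes at \<open>1 / cnj z\<close>, a point of
    the closed disc, where \<open>d\<close> has no zeros. Hence \<open>d z = 0\<close>, against the
    lowest terms.\<close>
  have "\<not> (poly W z = 0 \<and> poly p z = 0)" for z
  proof
    assume H: "poly W z = 0 \<and> poly p z = 0"
    hence z: "cmod z \<ge> 1" using p0[of z] by force
    hence "z \<noteq> 0" by auto
    have "cmod (1 / cnj z) \<le> 1" using z by (simp add: norm_divide divide_le_eq)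
    hence "poly (circ_reflect N d) z \<noteq> 0"
      using d0 \<open>z \<noteq> 0\<close> by (simp add: poly_circ_reflect N_def)
    moreover have "poly d z * poly (circ_reflect N d) z = 0" using H by (simp add: W_def)
    ultimately show False using ncr[of z] H by simp
  qed
  then obtain u v where uv: "W * u + p * v = 1" using Bezout_no_common_roots by blast
  \<comment> \<open>As a term, \<open>pd\<close> is from here on the cutoff of a polynomial outside
    the disc; as a fact, \<open>pd\<close> remains the representation of \<open>q\<close>.\<close>
  define pd where "pd = (\<lambda>(p :: complex poly) z. if cmod z < 1 then poly p z else 0)"
  have pdH: "pd p \<in> Hinf" for p unfolding pd_def by (rule poly_disc_Hinf)
  have "compact (poly d ` sphere 0 1)" by (intro compact_continuous_image continuous_intros) auto
  then obtain B where "\<forall>x\<in>poly d ` sphere 0 1. norm x \<le> B" using compact_imp_bounded bounded_iff by meson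
  hence B: "cmod (poly d \<zeta>) \<le> B" if "cmod \<zeta> = 1" for \<zeta> using that by auto
  have ab: "AE \<zeta> in circ. cmod (bdry a \<zeta>) \<le> 1"
    by (rule bdry_bound[OF Hinf_H2[OF aI]]) (use aB in \<open>auto simp: b_Hinf_def\<close>)
  have "AE \<zeta> in circ. cmod \<zeta> = 1" by (rule AE_circI)
  hence Wa: "AE \<zeta> in circ. cmod (bdry (pd W) \<zeta>) \<le> B\<^sup>2 * cmod (bdry a \<zeta>)"
    using pyth ab
  proof eventually_elim
    case (elim \<zeta>)
    have "bdry (pd W) \<zeta> = poly W \<zeta>"
      by (rule bdry_continuous(2)[OF _ _ elim(1)]) (auto simp: pd_def intro!: continuous_intros)
    hence "cmod (bdry (pd W) \<zeta>) = (cmod (poly d \<zeta>))\<^sup>2 - (cmod (poly p \<zeta>))\<^sup>2" by (simp add: Wc[OF elim(1)])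
    also have "\<dots> = (cmod (poly d \<zeta>))\<^sup>2 * (1 - (cmod (bdry q \<zeta>))\<^sup>2)"
      using d0[of \<zeta>] elim(1) by (simp add: bq[OF elim(1)] norm_divide power_divide right_diff_distrib)
    also have "1 - (cmod (bdry q \<zeta>))\<^sup>2 = (cmod (bdry a \<zeta>))\<^sup>2" using elim(2) by simp
    \<comment> \<open>One of the two powers of |a| is given away through |a| \<le> 1, since
      \<open>Smirnov_bound\<close> takes a bound by the first power.\<close>
    also have "(cmod (poly d \<zeta>))\<^sup>2 * (cmod (bdry a \<zeta>))\<^sup>2 \<le> B\<^sup>2 * cmod (bdry a \<zeta>)"
    proof (rule mult_mono)
      show "(cmod (poly d \<zeta>))\<^sup>2 \<le> B\<^sup>2" using B[OF elim(1)] by (rule power_mono) simp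
      show "(cmod (bdry a \<zeta>))\<^sup>2 \<le> cmod (bdry a \<zeta>)" using elim(3) by (simp add: power2_eq_square mult_left_le)
    qed auto
    finally show ?case .
  qed
  obtain G where G: "G \<in> Hinf" "pd W = (\<lambda>z. G z * a z)"
    using Hinf_quotient[OF pdH aI outer_nonzero[OF Hinf_analytic[OF aI] oa] Smirnov_bound[OF pdH aI oa _ Wa]] by auto
  show ?thesis
  \<comment> \<open>In the disc W = G a and q d = p, so the Bezout identity W u + p v = 1 reads a (G
    u) + q (d v) = 1.\<close>
  proof (rule that)
    show "(\<lambda>z. G z * pd u z) \<in> Hinf" by (rule Hinf_mult[OF G(1) pdH])
    show "(\<lambda>z. pd d z * pd v z) \<in> Hinf" by (rule Hinf_mult[OF pdH pdH])
    fix z :: complex assume z: "cmod z < 1"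
    have "a z * (G z * pd u z) + q z * (pd d z * pd v z) = pd W z * pd u z + q z * (pd d z * pd v z)"
      unfolding G(2) by (simp add: mult_ac)
    also have "\<dots> = poly W z * poly u z + poly p z * poly v z"
    proof -
      have "q z * poly d z = poly p z" using pd[OF z] by simp
      thus ?thesis using z by (simp add: pd_def mult.assoc[symmetric])
    qed
    also have "\<dots> = poly (W * u + p * v) z" by simp
    finally show "a z * (G z * pd u z) + q z * (pd d z * pd v z) = 1" by (simp add: uv)
  qed
qed

theorem mainTheorem3:
  fixes q L a a\<^sub>r :: "complex \<Rightarrow> complex" and r :: real
  assumes "q \<in> b_Hinf" and "rational_on_disc q" and "outer q" and "non_extreme q"
    and "r > 0"
    and "analytic_log q L"
    and "pythagorean_mate q a"
    and "pythagorean_mate (disc_power L r) a\<^sub>r"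
  shows "toeplitz (\<lambda>\<zeta>. cnj (bdry a \<zeta>)) ` H2 = toeplitz (\<lambda>\<zeta>. cnj (bdry a\<^sub>r \<zeta>)) ` H2 \<and>
         toeplitz (\<lambda>\<zeta>. cnj (bdry a\<^sub>r \<zeta>)) ` H2 = dBR_space q"
proof -
  have a: "a \<in> Hinf" "outer a" and ar: "a\<^sub>r \<in> Hinf" "outer a\<^sub>r"
    using assms(7,8) by (auto simp: pythagorean_mate_def intro: b_Hinf_Hinf)
  obtain C where C: "C \<ge> 0" "AE \<zeta> in circ. cmod (bdry a\<^sub>r \<zeta>) \<le> C * cmod (bdry a \<zeta>)"
    "AE \<zeta> in circ. cmod (bdry a \<zeta>) \<le> C * cmod (bdry a\<^sub>r \<zeta>)"
    using mates_comparable[OF assms(1,6,5,7,8)] by blast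
  have eq: "coT a ` H2 = coT a\<^sub>r ` H2"
    using coT_range_subset[OF a(1) ar C(1,3)] coT_range_subset[OF ar(1) a C(1,2)] by blast
  obtain g1 g2 where g: "g1 \<in> Hinf" "g2 \<in> Hinf" "\<And>z. cmod z < 1 \<Longrightarrow> a z * g1 z + q z * g2 z = 1"
    using rational_corona[OF assms(1,2,3,7)] by blast
  interpret pyth_pair q a
    using assms(7) by unfold_locales (auto simp: pythagorean_mate_def intro: b_Hinf_Hinf assms(1))
  have "dBR_space q = coT a ` H2" by (rule dBR_space_corona[OF g])
  thus ?thesis using eq by (simp add: coT_def)
qed

end
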